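(* Assume that $V\in C^\infty(\mathbb R^n;\mathbb R)$ satisfies $\partial_x^\alpha V\in L^\infty(\mathbb R^n)$ for all multiindices $\alpha\in\mathbb N^n$ with $|\alpha|\ge2$. There exists $t_0\in(0,1)$ such that for every $t\in(0,t_0)$ and every $A\in\mathcal A^{\nu,d}$ (with $\nu\in\mathbb R$, $d\ge0$), $$\mathcal E_A(t)=\mathcal I_{F_t}\,\mathrm{Op}(a_t),$$ where $(a_t)_{t\in(0,t_0)}$ is a family of symbols in $C^\infty(\mathbb R^{4n})$ satisfying: for every $N>0$ and all $\alpha,\beta',\gamma',\delta\in\mathbb N^n$ there exists a constant $c>0$ such that for every $t\in(0,t_0)$ and $(x,v,\xi,\eta)\in\mathbb R^{4n}$, $$\big|\partial_x^\alpha\partial_v^{\beta'}\partial_\xi^{\gamma'}\partial_\eta^{\delta}a_t(x,v,\xi,\eta)\big|\le c\,t^{\nu+\frac{|\beta'|+|\delta|+3|\gamma'|}{2}}\Big(1+|t^{3/2}\nabla V(x)|+|t^{1/2}v|+|t^{3/2}\xi|+|t^{1/2}\eta|\Big)^{-N}.$$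
   Context: Let $n\ge1$ be an integer, $m,\beta,\gamma>0$ constants; points of $\mathbb R^{2n}$ are written $(x,v)$, dual variables $(\xi,\eta)$. Phase. Set $x_t=x-tv-\frac{t^2}{2m}\nabla V(x)$, $w_t=\frac tm\nabla V(x)$, $\xi_t=t\xi$, and let $\psi(t,x,v,\xi,\eta)$ be the complex-valued function with $$\mathrm{Re}(\psi)=x_t\cdot\xi+(v+w_t)\cdot\eta,$$ $$\mathrm{Im}(\psi)=\frac{\gamma}{\beta m}t\Big(\big|\eta-\tfrac{\xi_t}{2}\big|^2+\tfrac13\big|\tfrac{\xi_t}{2}\big|^2\Big)+\frac{\gamma m\beta}{4}t\Big(\big|v+\tfrac{w_t}{2}\big|^2+\tfrac13\big|\tfrac{w_t}{2}\big|^2\Big).$$ Operators. For an amplitude $A=A(t,x,v,\xi,\eta)$ and $t>0$, $\mathcal E_A(t)$ is the operator with Schwartz kernel $$K_A(t,x,v,y,w)=(2\pi)^{-2n}\iint_{\mathbb R^{2n}}e^{i\psi(t,x,v,\xi,\eta)-iy\cdot\xi-iw\cdot\eta}A(t,x,v,\xi,\eta)\,d\xi\,d\eta,$$ i.e. $(\mathcal E_A(t)u)(x,v)=\iint K_A(t,x,v,y,w)u(y,w)\,dy\,dw$. Amplitude classes. For $\delta\ge0$, $\nu\in\mathbb R$, $\mathcal V^{\nu,\delta}$ is the space of $a=a(t,x,v)\in C^0((0,1)\times\mathbb R^{2n})$ such that $a(t,\cdot)\in C^\infty(\mathbb R^{2n})$ for all $t\in(0,1)$ and, for all $\alpha,\beta\in\mathbb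 N^n$, there is $C_{\alpha\beta}>0$ with $$|\partial_x^\alpha\partial_v^\beta a(t,x,v)|\le C_{\alpha\beta}\,t^{\nu+\frac{|\beta|}{2}}\big(1+|t^{1/2}v|+|t^{3/2}\nabla V(x)|\big)^\delta,\quad (t,x,v)\in(0,1)\times\mathbb R^{2n}.$$ For $\nu\in\mathbb R$, $d\ge0$, $\mathcal A^{\nu,d}$ is the space of functions on $(0,1)_t\times\mathbb R^{2n}_{x,v}\times\mathbb R^{2n}_{\xi,\eta}$ that are finite sums of terms $a_{\alpha\beta}(t,x,v)(t^{3/2}\xi)^\alpha(t^{1/2}\eta)^\beta$ with $a_{\alpha\beta}\in\mathcal V^{\nu,\delta}$ and $|\alpha|+|\beta|+\delta\le d$ ($\delta\ge0$ may depend on the term). Map $F_t$ and quantization. $F_t:\mathbb R^{2n}\to\mathbb R^{2n}$ is $F_t(x,v)=\big(x-tv-\frac{t^2}{2m}\nabla V(x),\,v+\frac tm\nabla V(x)\big)$, and $\mathcal I_{F_t}u=u\circ F_t$. $\mathrm{Op}$ is the standard quantization $$(\mathrm{Op}(a)u)(x,v)=(2\pi)^{-2n}\iiiint_{\mathbb R^{4n}}e^{i(x-y)\cdot\xi+i(v-w)\cdot\eta}a(x,v,\xi,\eta)u(y,w)\,dy\,dw\,d\xi\,d\eta.$$ *)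

theory Defs
  imports "HOL-Analysis.Analysis"
begin

section \<open>Multi-indices, partial derivatives, smooth functions\<close>

type_synonym 'n mindex = "nat ^ 'n"

definition mord :: "'n::finite mindex \<Rightarrow> nat" where
  "mord \<alpha> = (\<Sum>i\<in>UNIV. \<alpha> $ i)"

definition monom_pow :: "real ^ 'n::finite \<Rightarrow> 'n mindex \<Rightarrow> real" where
  "monom_pow x \<alpha> = (\<Prod>i\<in>UNIV. (x $ i) ^ (\<alpha> $ i))"

definition dir_deriv :: "'a::real_normed_vector \<Rightarrow> ('a \<Rightarrow> 'b::real_normed_vector) \<Rightarrow> 'a \<Rightarrow> 'b" where
  "dir_deriv h f = (\<lambda>x. frechet_derivative f (at x) h)"

primrec C_k :: "nat \<Rightarrow> ('a::real_normed_vector \<Rightarrow> 'b::real_normed_vector) \<Rightarrow> bool" where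
  "C_k 0 f \<longleftrightarrow> continuous_on UNIV f"
| "C_k (Suc k) f \<longleftrightarrow> (\<forall>x. f differentiable (at x)) \<and> (\<forall>h. C_k k (dir_deriv h f))"

definition C_inf :: "('a::real_normed_vector \<Rightarrow> 'b::real_normed_vector) \<Rightarrow> bool" where
  "C_inf f \<longleftrightarrow> (\<forall>k. C_k k f)"

text \<open>A finite index type carries no canonical order, so an arbitrary enumeration of it is fixed
  once and for all. Partial derivatives are only ever taken of smooth functions, where they commute
  and the choice is irrelevant.\<close>

definition index_list :: "'n::finite list" where
  "index_list = (SOME is. distinct is \<and> set is = UNIV)"

text \<open>Here \<open>e\<close> lists the basis vectors of the block of variables in which one differentiates.\<close>

definition mpartial ::
  "('n::finite \<Rightarrow> 'a::real_normed_vector) \<Rightarrow> 'n mindex \<Rightarrow> ('a \<Rightarrow> 'b::real_normed_vector) \<Rightarrow> 'a \<Rightarrow> 'b"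
  where "mpartial e \<alpha> f = foldr (\<lambda>i. dir_deriv (e i) ^^ (\<alpha> $ i)) index_list f"

definition partial_n :: "'n::finite mindex \<Rightarrow> (real ^ 'n \<Rightarrow> 'b::real_normed_vector) \<Rightarrow> real ^ 'n \<Rightarrow> 'b" where
  "partial_n \<alpha> = mpartial (\<lambda>i. axis i 1) \<alpha>"

definition grad :: "(real ^ 'n::finite \<Rightarrow> real) \<Rightarrow> real ^ 'n \<Rightarrow> real ^ 'n" where
  "grad V x = (\<chi> i. dir_deriv (axis i 1) V x)"

definition L_inf :: "('a::euclidean_space \<Rightarrow> real) \<Rightarrow> bool" where
  "L_inf f \<longleftrightarrow> f \<in> borel_measurable lebesgue \<and> (\<exists>C. AE x in lebesgue. \<bar>f x\<bar> \<le> C)"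

section \<open>Phase space\<close>

text \<open>Points \<open>(x, v)\<close> and covectors \<open>(\<xi>, \<eta>)\<close> are both elements of \<open>'n phase_space\<close>; points of
  the \<open>4n\<close>-dimensional space are pairs \<open>((x, v), (\<xi>, \<eta>))\<close>.\<close>

type_synonym 'n phase_space = "(real ^ 'n) \<times> (real ^ 'n)"

definition partial_xv ::
  "'n::finite mindex \<Rightarrow> 'n mindex \<Rightarrow> ('n phase_space \<Rightarrow> 'b::real_normed_vector) \<Rightarrow> 'n phase_space \<Rightarrow> 'b"
  where "partial_xv \<alpha> \<beta> f =
    mpartial (\<lambda>i. (axis i 1, 0)) \<alpha> (mpartial (\<lambda>i. (0, axis i 1)) \<beta> f)"

definition partial_xv\<xi>\<eta> ::
  "'n::finite mindex \<Rightarrow> 'n mindex \<Rightarrow> 'n mindex \<Rightarrow> 'n mindex \<Rightarrow>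
    ('n phase_space \<times> 'n phase_space \<Rightarrow> 'b::real_normed_vector) \<Rightarrow> 'n phase_space \<times> 'n phase_space \<Rightarrow> 'b"
  where "partial_xv\<xi>\<eta> \<alpha> \<beta> \<gamma> \<delta> f =
    mpartial (\<lambda>i. ((axis i 1, 0), (0, 0))) \<alpha>
   (mpartial (\<lambda>i. ((0, axis i 1), (0, 0))) \<beta>
   (mpartial (\<lambda>i. ((0, 0), (axis i 1, 0))) \<gamma>
   (mpartial (\<lambda>i. ((0, 0), (0, axis i 1))) \<delta> f)))"

definition schwartz :: "('n::finite phase_space \<Rightarrow> complex) \<Rightarrow> bool" where
  "schwartz u \<longleftrightarrow> C_inf u \<and>
    (\<forall>k \<alpha> \<beta>. \<exists>C. \<forall>z. (1 + norm z) ^ k * norm (partial_xv \<alpha> \<beta> u z) \<le> C)"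

section \<open>Phase, operators and amplitude classes\<close>

definition x_flow :: "(real ^ 'n::finite \<Rightarrow> real) \<Rightarrow> real \<Rightarrow> real \<Rightarrow> real ^ 'n \<Rightarrow> real ^ 'n \<Rightarrow> real ^ 'n" where
  "x_flow V m t x v = x - t *\<^sub>R v - (t\<^sup>2 / (2 * m)) *\<^sub>R grad V x"

definition w_flow :: "(real ^ 'n::finite \<Rightarrow> real) \<Rightarrow> real \<Rightarrow> real \<Rightarrow> real ^ 'n \<Rightarrow> real ^ 'n" where
  "w_flow V m t x = (t / m) *\<^sub>R grad V x"

definition phase_re ::
  "(real ^ 'n::finite \<Rightarrow> real) \<Rightarrow> real \<Rightarrow> real \<Rightarrow> 'n phase_space \<Rightarrow> 'n phase_space \<Rightarrow> real"
  where "phase_re V m t = (\<lambda>(x, v) (\<xi>, \<eta>).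
    x_flow V m t x v \<bullet> \<xi> + (v + w_flow V m t x) \<bullet> \<eta>)"

definition phase_im ::
  "(real ^ 'n::finite \<Rightarrow> real) \<Rightarrow> real \<Rightarrow> real \<Rightarrow> real \<Rightarrow> real \<Rightarrow> 'n phase_space \<Rightarrow> 'n phase_space \<Rightarrow> real"
  where "phase_im V m \<beta> \<gamma> t = (\<lambda>(x, v) (\<xi>, \<eta>).
    let w = w_flow V m t x; \<zeta> = t *\<^sub>R \<xi> in
      \<gamma> / (\<beta> * m) * t * ((norm (\<eta> - \<zeta> /\<^sub>R 2))\<^sup>2 + 1 / 3 * (norm (\<zeta> /\<^sub>R 2))\<^sup>2)
    + \<gamma> * m * \<beta> / 4 * t * ((norm (v + w /\<^sub>R 2))\<^sup>2 + 1 / 3 * (norm (w /\<^sub>R 2))\<^sup>2))"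

definition phase ::
  "(real ^ 'n::finite \<Rightarrow> real) \<Rightarrow> real \<Rightarrow> real \<Rightarrow> real \<Rightarrow> real \<Rightarrow> 'n phase_space \<Rightarrow> 'n phase_space \<Rightarrow> complex"
  where "phase V m \<beta> \<gamma> t z \<zeta> = Complex (phase_re V m t z \<zeta>) (phase_im V m \<beta> \<gamma> t z \<zeta>)"

text \<open>In the definitions below \<open>(y, w) \<bullet> (\<xi>, \<eta>) = y \<bullet> \<xi> + w \<bullet> \<eta>\<close> is the inner product of the product
  space. The amplitude at time \<open>t\<close> is a function of \<open>((x, v), (\<xi>, \<eta>))\<close>.\<close>

definition E_kernel ::
  "(real ^ 'n::finite \<Rightarrow> real) \<Rightarrow> real \<Rightarrow> real \<Rightarrow> real \<Rightarrow> (real \<Rightarrow> 'n phase_space \<times> 'n phase_space \<Rightarrow> complex) \<Rightarrow>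
    real \<Rightarrow> 'n phase_space \<Rightarrow> 'n phase_space \<Rightarrow> complex"
  where "E_kernel V m \<beta> \<gamma> A t z z' =
    1 / of_real ((2 * pi) ^ (2 * CARD('n))) *
    (LINT \<zeta>|lborel. exp (\<i> * phase V m \<beta> \<gamma> t z \<zeta> - \<i> * of_real (z' \<bullet> \<zeta>)) * A t (z, \<zeta>))"

definition E_op ::
  "(real ^ 'n::finite \<Rightarrow> real) \<Rightarrow> real \<Rightarrow> real \<Rightarrow> real \<Rightarrow> (real \<Rightarrow> 'n phase_space \<times> 'n phase_space \<Rightarrow> complex) \<Rightarrow>
    real \<Rightarrow> ('n phase_space \<Rightarrow> complex) \<Rightarrow> 'n phase_space \<Rightarrow> complex"
  where "E_op V m \<beta> \<gamma> A t u z = (LINT z'|lborel. E_kernel V m \<beta> \<gamma> A t z z' * u z')"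

definition F_map :: "(real ^ 'n::finite \<Rightarrow> real) \<Rightarrow> real \<Rightarrow> real \<Rightarrow> 'n phase_space \<Rightarrow> 'n phase_space" where
  "F_map V m t = (\<lambda>(x, v). (x - t *\<^sub>R v - (t\<^sup>2 / (2 * m)) *\<^sub>R grad V x, v + (t / m) *\<^sub>R grad V x))"

definition pullback :: "('a \<Rightarrow> 'a) \<Rightarrow> ('a \<Rightarrow> 'b) \<Rightarrow> 'a \<Rightarrow> 'b" where
  "pullback F u = u \<circ> F"

text \<open>As usual for the standard quantization, the integral over \<open>(y, w)\<close> is the inner one.\<close>

definition Op ::
  "('n::finite phase_space \<times> 'n phase_space \<Rightarrow> complex) \<Rightarrow> ('n phase_space \<Rightarrow> complex) \<Rightarrow> 'n phase_space \<Rightarrow> complex"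
  where "Op a u z =
    1 / of_real ((2 * pi) ^ (2 * CARD('n))) *
    (LINT \<zeta>|lborel. LINT z'|lborel. exp (\<i> * of_real ((z - z') \<bullet> \<zeta>)) * a (z, \<zeta>) * u z')"

definition V_class ::
  "(real ^ 'n::finite \<Rightarrow> real) \<Rightarrow> real \<Rightarrow> real \<Rightarrow> (real \<Rightarrow> 'n phase_space \<Rightarrow> complex) set"
  where "V_class V \<nu> \<delta> = {a.
    continuous_on ({0<..<1} \<times> UNIV) (\<lambda>(t, z). a t z) \<and>
    (\<forall>t\<in>{0<..<1}. C_inf (a t)) \<and>
    (\<forall>\<alpha> \<beta>. \<exists>C>0. \<forall>t\<in>{0<..<1}. \<forall>x v.
      norm (partial_xv \<alpha> \<beta> (a t) (x, v)) \<le>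
        C * t powr (\<nu> + real (mord \<beta>) / 2) *
        (1 + norm ((t powr (1/2)) *\<^sub>R v) + norm ((t powr (3/2)) *\<^sub>R grad V x)) powr \<delta>)}"

definition A_class ::
  "(real ^ 'n::finite \<Rightarrow> real) \<Rightarrow> real \<Rightarrow> real \<Rightarrow> (real \<Rightarrow> 'n phase_space \<times> 'n phase_space \<Rightarrow> complex) set"
  where "A_class V \<nu> d = {A. \<exists>(J::nat) al be del a.
    (\<forall>j<J. del j \<ge> 0 \<and> a j \<in> V_class V \<nu> (del j) \<and> real (mord (al j)) + real (mord (be j)) + del j \<le> d) \<and>
    (\<forall>t\<in>{0<..<1}. \<forall>z \<xi> \<eta>. A t (z, (\<xi>, \<eta>)) =
      (\<Sum>j<J. a j t z * of_real (monom_pow ((t powr (3/2)) *\<^sub>R \<xi>) (al j)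
                                * monom_pow ((t powr (1/2)) *\<^sub>R \<eta>) (be j))))}"

end

theory Submission
  imports Defs
begin

text \<open>The real part of the phase is \<open>F_t(x, v) \<bullet> (\<xi>, \<eta>)\<close>, so after exchanging the two integrals the
  operator is \<open>u \<mapsto> (Op(a_t) u) \<circ> F_t\<close> with \<open>a_t(F_t(z), \<zeta>) = e^(-Im \<psi>(t, z, \<zeta>)) A(t, z, \<zeta>)\<close>. In the scaled
  variables \<open>X = t^(3/2) \<nabla>V(x)\<close>, \<open>Y = t^(1/2) v\<close>, \<open>\<Xi> = t^(3/2) \<xi>\<close>, \<open>H = t^(1/2) \<eta>\<close> the imaginary part of the
  phase is a positive definite quadratic form with coefficients independent of \<open>t\<close>, which gives the decay.
  The map \<open>F_t\<close> is inverted by \<open>y = (id + t^2/(2m) \<nabla>V)^(-1) (x + t v)\<close>, \<open>w = v - (t/m) \<nabla>V(y)\<close>; only one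
  inverse function on \<open>\<real>^n\<close>, a small perturbation of the identity, has to be controlled.

  All estimates are carried by classes of \<open>t\<close>-dependent functions whose derivatives, each rescaled by a
  power of \<open>t\<close>, are bounded by a weight. These classes are stable under sums, products and composition,
  which replaces higher-order chain rules by inductions on the order of differentiation.\<close>

section \<open>Directional derivatives and multi-indices\<close>

text \<open>\<open>grad V\<close> may be unbounded although all its derivatives are bounded, so the
  natural coordinates are unbounded functions with bounded rescaled derivatives; the estimates must
  keep apart the size of a function and the size of its derivatives. The factor e^(-Im \<psi>)
  decays like a Gaussian in these coordinates and absorbs every power of the weight, whether it
  comes from the amplitude, from its monomials or from differentiating the exponent; hence N is
  arbitrary and only \<nu> survives from the class of A. The formula for the inverse comes from
  eliminating the velocity: if (x', v') = F_t(x, v), then x' + t v' = x + t^2/(2m) \<nabla>V(x),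
  since t * (t/m) is twice t^2/(2m). For small t the perturbation has Lipschitz constant at most
  1/2; how small depends on V and m alone, so t_0 is fixed before \<nu>, d and A. The decay is known
  at F_t^(-1)(x, v) and has to be moved to (x, v); this works because the scaled coordinates at one
  point are bounded by a fixed multiple of those at the other.\<close>

lemma dir_deriv_eq: "(f has_derivative f') (at x) \<Longrightarrow> dir_deriv h f x = f' h"
  unfolding dir_deriv_def using frechet_derivative_at by metis

lemma has_derivative_dir_deriv:
  "f differentiable (at x) \<Longrightarrow> (f has_derivative (\<lambda>h. dir_deriv h f x)) (at x)"
  unfolding dir_deriv_def using frechet_derivative_works by metis

lemma linear_dir_deriv: "f differentiable (at x) \<Longrightarrow> linear (\<lambda>h. dir_deriv h f x)"
  using has_derivative_dir_deriv has_derivative_linear by blast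

lemma dir_deriv_expand:
  fixes f :: "'a::euclidean_space \<Rightarrow> 'b::real_normed_vector"
  assumes "f differentiable (at x)"
  shows "dir_deriv h f x = (\<Sum>b\<in>Basis. (h \<bullet> b) *\<^sub>R dir_deriv b f x)"
proof -
  have "dir_deriv (\<Sum>b\<in>Basis. (h \<bullet> b) *\<^sub>R b) f x = (\<Sum>b\<in>Basis. (h \<bullet> b) *\<^sub>R dir_deriv b f x)"
    by (simp only: linear_sum[OF linear_dir_deriv[OF assms]] linear_cmul[OF linear_dir_deriv[OF assms]])
  then show ?thesis by (simp add: euclidean_representation)
qed

lemma dir_deriv_bounded_linear:
  assumes "bounded_linear L" "f differentiable (at x)"
  shows "dir_deriv h (\<lambda>p. L (f p)) x = L (dir_deriv h f x)"
  using bounded_linear.has_derivative[OF assms(1) has_derivative_dir_deriv[OF assms(2)]]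
  by (rule dir_deriv_eq)

lemma dir_deriv_scaleR:
  assumes "f differentiable (at x)"
  shows "dir_deriv h (\<lambda>p. c *\<^sub>R f p) x = c *\<^sub>R dir_deriv h f x"
  using dir_deriv_bounded_linear[OF bounded_linear_scaleR_right assms] .

lemma C_inf_differentiable: "C_inf f \<Longrightarrow> f differentiable (at x)"
  unfolding C_inf_def by (metis C_k.simps(2))

lemma C_inf_dir_deriv: "C_inf f \<Longrightarrow> C_inf (dir_deriv h f)"
  unfolding C_inf_def by (metis C_k.simps(2))

lemma C_inf_continuous: "C_inf f \<Longrightarrow> continuous_on UNIV f"
  unfolding C_inf_def by (metis C_k.simps(1))

section \<open>Symmetry of second derivatives\<close>

lemma differentiable_along_line:
  fixes f :: "'a::real_normed_vector \<Rightarrow> real"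
  assumes "\<And>x. f differentiable (at x)"
  shows "((\<lambda>\<sigma>. f (x + \<sigma> *\<^sub>R h)) has_real_derivative dir_deriv h f (x + \<sigma> *\<^sub>R h)) (at \<sigma>)"
proof -
  have "((\<lambda>\<sigma>. f (x + \<sigma> *\<^sub>R h)) has_derivative (\<lambda>d. dir_deriv (d *\<^sub>R h) f (x + \<sigma> *\<^sub>R h))) (at \<sigma>)"
    by (rule has_derivative_compose[OF _ has_derivative_dir_deriv[OF assms]])
       (auto intro!: derivative_eq_intros)
  then show ?thesis
    unfolding has_field_derivative_def
    by (simp add: linear_cmul[OF linear_dir_deriv[OF assms]] mult.commute[of _ "dir_deriv h f (x + \<sigma> *\<^sub>R h)"])
qed

text \<open>The mean value theorem is applied twice: along h to the increment of f in the direction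
  k, then along k to the derivative in the direction h. The left side is symmetric in h and k while
  the right side is not, which is what yields Schwarz's theorem.\<close>

lemma second_difference:
  fixes f :: "'a::real_normed_vector \<Rightarrow> real"
  assumes f: "\<And>x. f differentiable (at x)" and fh: "\<And>x. dir_deriv h f differentiable (at x)" and s: "s > 0"
  shows "\<exists>\<sigma>\<in>{0<..<s}. \<exists>\<tau>\<in>{0<..<s}. f (x + s *\<^sub>R h + s *\<^sub>R k) - f (x + s *\<^sub>R h) - f (x + s *\<^sub>R k) + f x
     = s\<^sup>2 * dir_deriv k (dir_deriv h f) (x + \<sigma> *\<^sub>R h + \<tau> *\<^sub>R k)"
proof -
  have "\<exists>\<sigma>>0. \<sigma> < s \<and> (f ((x + s *\<^sub>R k) + s *\<^sub>R h) - f (x + s *\<^sub>R h)) - (f ((x + s *\<^sub>R k) + 0 *\<^sub>R h) - f (x + 0 *\<^sub>R h))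
     = (s - 0) * (dir_deriv h f ((x + s *\<^sub>R k) + \<sigma> *\<^sub>R h) - dir_deriv h f (x + \<sigma> *\<^sub>R h))"
    by (rule MVT2[OF s, where f="\<lambda>\<sigma>. f ((x + s *\<^sub>R k) + \<sigma> *\<^sub>R h) - f (x + \<sigma> *\<^sub>R h)" and f'="\<lambda>\<sigma>. dir_deriv h f ((x + s *\<^sub>R k) + \<sigma> *\<^sub>R h) - dir_deriv h f (x + \<sigma> *\<^sub>R h)"])
       (intro DERIV_diff differentiable_along_line f)
  then obtain \<sigma> where \<sigma>: "0 < \<sigma>" "\<sigma> < s" and 1: "f (x + s *\<^sub>R h + s *\<^sub>R k) - f (x + s *\<^sub>R h) - f (x + s *\<^sub>R k) + f x
     = s * (dir_deriv h f (x + \<sigma> *\<^sub>R h + s *\<^sub>R k) - dir_deriv h f (x + \<sigma> *\<^sub>R h))"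
    by (auto simp: algebra_simps)
  have "\<exists>\<tau>>0. \<tau> < s \<and> dir_deriv h f ((x + \<sigma> *\<^sub>R h) + s *\<^sub>R k) - dir_deriv h f ((x + \<sigma> *\<^sub>R h) + 0 *\<^sub>R k)
     = (s - 0) * dir_deriv k (dir_deriv h f) ((x + \<sigma> *\<^sub>R h) + \<tau> *\<^sub>R k)"
    by (rule MVT2[OF s]) (intro differentiable_along_line fh)
  then obtain \<tau> where \<tau>: "0 < \<tau>" "\<tau> < s"
    "dir_deriv h f (x + \<sigma> *\<^sub>R h + s *\<^sub>R k) - dir_deriv h f (x + \<sigma> *\<^sub>R h)
      = s * dir_deriv k (dir_deriv h f) (x + \<sigma> *\<^sub>R h + \<tau> *\<^sub>R k)"
    by auto
  show ?thesis
    by (rule bexI[of _ \<sigma>], rule bexI[of _ \<tau>]) (use \<sigma> \<tau>(1,2) in \<open>auto simp: 1 \<tau>(3) power2_eq_square\<close>)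
qed

text \<open>The intermediate points supplied by the mean value theorem depend on s in an
  uncontrolled way; they only stay within s * (|h| + |k|) of x, and continuity of D turns this into
  a limit from the right.\<close>

lemma tendsto_at_nearby_point:
  fixes D :: "'a::real_normed_vector \<Rightarrow> real"
  assumes D: "continuous_on UNIV D"
    and F: "\<And>s::real. s > 0 \<Longrightarrow> \<exists>\<sigma>\<in>{0<..<s}. \<exists>\<tau>\<in>{0<..<s}. F s = D (x + \<sigma> *\<^sub>R h + \<tau> *\<^sub>R k)"
  shows "(F \<longlongrightarrow> D x) (at_right 0)"
  unfolding tendsto_iff
proof (intro allI impI)
  fix \<epsilon> :: real assume \<epsilon>: "\<epsilon> > 0"
  obtain d where d: "d > 0" "\<And>y. dist y x < d \<Longrightarrow> dist (D y) (D x) < \<epsilon>"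
    using D \<epsilon> unfolding continuous_on_iff by (metis UNIV_I)
  define r where "r = d / (norm h + norm k + 1)"
  have den: "norm h + norm k + 1 > 0" by (simp add: add_nonneg_pos)
  have r: "r > 0" using d den by (simp add: r_def)
  show "\<forall>\<^sub>F s in at_right 0. dist (F s) (D x) < \<epsilon>"
    unfolding eventually_at_right_field
  proof (intro exI conjI allI impI)
    show "0 < r" by fact
    fix s assume s: "0 < s" "s < r"
    obtain \<sigma> \<tau> where st: "0 < \<sigma>" "\<sigma> < s" "0 < \<tau>" "\<tau> < s" "F s = D (x + \<sigma> *\<^sub>R h + \<tau> *\<^sub>R k)"
      using F[OF s(1)] by auto
    have "norm (\<sigma> *\<^sub>R h + \<tau> *\<^sub>R k) \<le> s * norm h + s * norm k"
      using st by (intro norm_triangle_mono) (auto intro: mult_right_mono)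
    also have "\<dots> < s * (norm h + norm k + 1)" using s by (simp add: algebra_simps)
    also have "\<dots> < d" using s den by (simp add: r_def pos_less_divide_eq)
    finally show "dist (F s) (D x) < \<epsilon>"
      unfolding st(5) by (intro d(2)) (simp add: dist_norm add.assoc)
  qed
qed

text \<open>One symmetric second difference quotient has both mixed derivatives as its limit at 0
  from the right, so they agree.\<close>

lemma dir_deriv_commute_real:
  fixes f :: "'a::real_normed_vector \<Rightarrow> real"
  assumes "C_inf f"
  shows "dir_deriv h (dir_deriv k f) x = dir_deriv k (dir_deriv h f) x"
proof -
  define Q where "Q s = (f (x + s *\<^sub>R h + s *\<^sub>R k) - f (x + s *\<^sub>R h) - f (x + s *\<^sub>R k) + f x) / s\<^sup>2" for s
  have diff: "\<And>x. f differentiable (at x)" "\<And>h x. dir_deriv h f differentiable (at x)"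
    using assms by (auto intro: C_inf_differentiable C_inf_dir_deriv)
  have cont: "continuous_on UNIV (dir_deriv h (dir_deriv k f))" for h k
    using assms by (auto intro: C_inf_continuous C_inf_dir_deriv)
  have 1: "(Q \<longlongrightarrow> dir_deriv k (dir_deriv h f) x) (at_right 0)"
  proof (rule tendsto_at_nearby_point[OF cont])
    fix s :: real assume "s > 0"
    with second_difference[OF diff, of s x h k]
    show "\<exists>\<sigma>\<in>{0<..<s}. \<exists>\<tau>\<in>{0<..<s}. Q s = dir_deriv k (dir_deriv h f) (x + \<sigma> *\<^sub>R h + \<tau> *\<^sub>R k)"
      by (simp add: Q_def nonzero_divide_eq_eq mult.commute)
  qed
  have 2: "(Q \<longlongrightarrow> dir_deriv h (dir_deriv k f) x) (at_right 0)"
  proof (rule tendsto_at_nearby_point[OF cont])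
    fix s :: real assume "s > 0"
    moreover have "Q s = (f (x + s *\<^sub>R k + s *\<^sub>R h) - f (x + s *\<^sub>R k) - f (x + s *\<^sub>R h) + f x) / s\<^sup>2"
      by (simp add: Q_def add.assoc add.commute[of "s *\<^sub>R h" "s *\<^sub>R k"])
    ultimately show "\<exists>\<sigma>\<in>{0<..<s}. \<exists>\<tau>\<in>{0<..<s}. Q s = dir_deriv h (dir_deriv k f) (x + \<sigma> *\<^sub>R k + \<tau> *\<^sub>R h)"
      using second_difference[OF diff, of s x k h] by (simp add: nonzero_divide_eq_eq mult.commute)
  qed
  show ?thesis using tendsto_unique[OF _ 2 1] by simp
qed

lemma C_inf_bounded_linear:
  assumes L: "bounded_linear L" and f: "C_inf f"
  shows "C_inf (\<lambda>x. L (f x))"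
proof -
  have "C_k k (\<lambda>x. L (f x))" for k using f
  proof (induction k arbitrary: f)
    case 0
    then show ?case
      using bounded_linear.continuous_on[OF L C_inf_continuous] by simp
  next
    case (Suc k)
    have "dir_deriv h (\<lambda>x. L (f x)) = (\<lambda>x. L (dir_deriv h f x))" for h
      using dir_deriv_bounded_linear[OF L C_inf_differentiable[OF Suc.prems]] by auto
    then show ?case
      using Suc.IH[OF C_inf_dir_deriv[OF Suc.prems]] C_inf_differentiable[OF Suc.prems]
        bounded_linear.has_derivative[OF L] unfolding differentiable_def C_k.simps by metis
  qed
  then show ?thesis by (simp add: C_inf_def)
qed

text \<open>Reduction to components, because the mean value theorem behind the real case is
  restricted to real-valued functions.\<close>

lemma dir_deriv_commute:
  fixes f :: "'a::real_normed_vector \<Rightarrow> 'b::euclidean_space"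
  assumes f: "C_inf f"
  shows "dir_deriv h (dir_deriv k f) = dir_deriv k (dir_deriv h f)"
proof (rule ext, rule euclidean_eqI)
  fix x and b :: 'b assume "b \<in> Basis"
  have L: "bounded_linear (\<lambda>y. y \<bullet> b)" by (rule bounded_linear_inner_left)
  have 1: "dir_deriv h (\<lambda>x. f x \<bullet> b) = (\<lambda>x. dir_deriv h f x \<bullet> b)" for h
    by (intro ext dir_deriv_bounded_linear[OF L C_inf_differentiable[OF f]])
  have 2: "dir_deriv k (\<lambda>x. dir_deriv h f x \<bullet> b) = (\<lambda>x. dir_deriv k (dir_deriv h f) x \<bullet> b)" for h k
    by (intro ext dir_deriv_bounded_linear[OF L C_inf_differentiable[OF C_inf_dir_deriv[OF f]]])
  show "dir_deriv h (dir_deriv k f) x \<bullet> b = dir_deriv k (dir_deriv h f) x \<bullet> b"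
    using dir_deriv_commute_real[OF C_inf_bounded_linear[OF L f], of h k x]
    unfolding 1 2 .
qed

section \<open>Iterated partial derivatives and multi-indices\<close>

lemma C_inf_funpow: "C_inf f \<Longrightarrow> C_inf ((dir_deriv h ^^ n) f)"
  by (induction n) (simp_all add: C_inf_dir_deriv)

lemma C_inf_foldr: "C_inf f \<Longrightarrow> C_inf (foldr (\<lambda>i. dir_deriv (e i) ^^ \<alpha> i) is f)"
  by (induction "is") (auto intro: C_inf_funpow)

lemma C_inf_mpartial: "C_inf f \<Longrightarrow> C_inf (mpartial e \<alpha> f)"
  unfolding mpartial_def by (rule C_inf_foldr)

lemma dir_deriv_funpow_commute:
  fixes f :: "'a::real_normed_vector \<Rightarrow> 'b::euclidean_space"
  assumes "C_inf f"
  shows "dir_deriv h ((dir_deriv k ^^ n) f) = (dir_deriv k ^^ n) (dir_deriv h f)"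
proof (induction n)
  case (Suc n)
  then show ?case
    using dir_deriv_commute[OF C_inf_funpow[OF assms], of h k n k] by simp
qed simp

lemma dir_deriv_foldr_commute:
  fixes f :: "'a::real_normed_vector \<Rightarrow> 'b::euclidean_space"
  assumes "C_inf f"
  shows "dir_deriv h (foldr (\<lambda>i. dir_deriv (e i) ^^ \<alpha> i) is f) =
    foldr (\<lambda>i. dir_deriv (e i) ^^ \<alpha> i) is (dir_deriv h f)"
  using assms by (induction "is") (auto simp: dir_deriv_funpow_commute[OF C_inf_foldr])

lemma dir_deriv_mpartial_commute:
  fixes f :: "'a::real_normed_vector \<Rightarrow> 'b::euclidean_space"
  assumes "C_inf f"
  shows "dir_deriv h (mpartial e \<alpha> f) = mpartial e \<alpha> (dir_deriv h f)"
  unfolding mpartial_def using assms by (rule dir_deriv_foldr_commute)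

lemma index_list: "distinct (index_list :: 'n::finite list)" "set (index_list :: 'n list) = UNIV"
proof -
  have "\<exists>is :: 'n list. distinct is \<and> set is = UNIV"
    using finite_distinct_list[of "UNIV :: 'n set"] by auto
  from someI_ex[OF this] show "distinct (index_list :: 'n list)" "set (index_list :: 'n list) = UNIV"
    unfolding index_list_def by auto
qed

text \<open>The extra derivative arises at the place of i in \<open>index_list\<close> and is moved
  to the front past the operators listed before it. The list is distinct, so i occurs only once and
  the exponents after it stay unchanged.\<close>

lemma mpartial_add_axis:
  fixes f :: "'a::real_normed_vector \<Rightarrow> 'b::euclidean_space"
  assumes f: "C_inf f"
  shows "mpartial e (\<alpha> + axis i 1) f = dir_deriv (e i) (mpartial e \<alpha> f)"
proof -
  have "i \<in> set is \<Longrightarrow> distinct is \<Longrightarrow> foldr (\<lambda>j. dir_deriv (e j) ^^ ((\<alpha> + axis i 1) $ j)) is f =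
     dir_deriv (e i) (foldr (\<lambda>j. dir_deriv (e j) ^^ (\<alpha> $ j)) is f)" for "is"
  proof (induction "is")
    case (Cons j js)
    show ?case
    proof (cases "j = i")
      case True
      have "foldr (\<lambda>j. dir_deriv (e j) ^^ ((\<alpha> + axis i 1) $ j)) js f =
        foldr (\<lambda>j. dir_deriv (e j) ^^ (\<alpha> $ j)) js f"
        using Cons.prems True by (intro foldr_cong) (auto simp: axis_def)
      then show ?thesis using True by (simp add: axis_def)
    next
      case False
      then show ?thesis using Cons
        by (simp add: axis_def dir_deriv_funpow_commute[OF C_inf_foldr[OF f]])
    qed
  qed simp
  from this[of index_list] show ?thesis by (simp add: mpartial_def index_list)
qed

lemma mord_add: "mord (\<alpha> + \<beta>) = mord \<alpha> + mord \<beta>"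
  by (simp add: mord_def sum.distrib)

lemma mord_axis [simp]: "mord (axis i 1) = 1"
  by (simp add: mord_def axis_def if_distrib)

lemma mord_zero [simp]: "mord 0 = 0"
  by (simp add: mord_def)

lemma mpartial_zero [simp]: "mpartial (e :: 'b::finite \<Rightarrow> _) 0 f = f"
proof -
  have "foldr (\<lambda>i. dir_deriv (e i) ^^ ((0::'b mindex) $ i)) is f = f" for "is"
    by (induction "is") auto
  then show ?thesis by (simp add: mpartial_def)
qed

section \<open>Symbol classes depending on a parameter\<close>

lemma C_k_add:
  assumes "C_k k f" "C_k k g"
  shows "C_k k (\<lambda>x. f x + g x)"
  using assms
proof (induction k arbitrary: f g)
  case 0
  then show ?case by (auto intro: continuous_intros)
next
  case (Suc k)
  have "dir_deriv h (\<lambda>x. f x + g x) = (\<lambda>x. dir_deriv h f x + dir_deriv h g x)" for h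
    using Suc.prems
    by (intro ext dir_deriv_eq has_derivative_add has_derivative_dir_deriv) auto
  then show ?case using Suc by (auto intro: differentiable_add)
qed

lemma C_k_scaleR:
  assumes "C_k k f"
  shows "C_k k (\<lambda>x. c *\<^sub>R f x)"
  using assms
proof (induction k arbitrary: f)
  case 0
  then show ?case by (auto intro: continuous_intros)
next
  case (Suc k)
  have "dir_deriv h (\<lambda>x. c *\<^sub>R f x) = (\<lambda>x. c *\<^sub>R dir_deriv h f x)" for h
    using Suc.prems by (intro ext dir_deriv_scaleR) auto
  then show ?case using Suc by auto
qed

lemma C_k_zero: "C_k k (\<lambda>x::'a::real_normed_vector. 0::'b::real_normed_vector)"
proof (induction k)
  case (Suc k)
  have "dir_deriv h (\<lambda>x::'a. 0::'b) = (\<lambda>x. 0)" for h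
    by (simp add: dir_deriv_def)
  then show ?case using Suc by simp
qed simp

lemma C_k_sum: "finite I \<Longrightarrow> (\<And>i. i \<in> I \<Longrightarrow> C_k k (f i)) \<Longrightarrow> C_k k (\<lambda>x. \<Sum>i\<in>I. f i x)"
  by (induction rule: finite_induct) (auto simp: C_k_zero intro: C_k_add)

lemma differentiable_componentwise:
  fixes f :: "'a::real_normed_vector \<Rightarrow> 'b::euclidean_space"
  shows "f differentiable (at x) \<longleftrightarrow> (\<forall>b\<in>Basis. (\<lambda>y. f y \<bullet> b) differentiable (at x))"
  by (rule differentiable_componentwise_within)

text \<open>Product rule in which f is merely continuous at p: since g vanishes there, the increment
  of f is multiplied by something of first order, and only \<open>f p\<close> enters the derivative.
  It serves for a product whose first factor is already known to be continuous but not yet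
  differentiable.\<close>

lemma has_derivative_scaleR_vanishing:
  fixes f :: "'a::real_normed_vector \<Rightarrow> real"
  assumes f: "f \<midarrow>p\<rightarrow> f p" and g: "(g has_derivative g') (at p)" and g0: "g p = 0"
  shows "((\<lambda>q. f q *\<^sub>R g q) has_derivative (\<lambda>y. f p *\<^sub>R g' y)) (at p)"
proof -
  interpret g': bounded_linear g' using g by (rule has_derivative_bounded_linear)
  obtain K where K: "\<And>y. norm (g' y) \<le> norm y * K" "K > 0" using g'.pos_bounded by blast
  have lim: "(\<lambda>y. norm (g y - g p - g' (y - p)) / norm (y - p)) \<midarrow>p\<rightarrow> 0"
    using g unfolding has_derivative_iff_norm by simp
  have "(\<lambda>y. \<bar>f y\<bar> * (norm (g y - g p - g' (y - p)) / norm (y - p)) + \<bar>f y - f p\<bar> * K) \<midarrow>p\<rightarrow> \<bar>f p\<bar> * 0 + \<bar>f p - f p\<bar> * K"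
    by (intro tendsto_intros f lim)
  then have lim0: "(\<lambda>y. \<bar>f y\<bar> * (norm (g y - g p - g' (y - p)) / norm (y - p)) + \<bar>f y - f p\<bar> * K) \<midarrow>p\<rightarrow> 0"
    by simp
  have "(\<lambda>y. norm (f y *\<^sub>R g y - f p *\<^sub>R g p - f p *\<^sub>R g' (y - p)) / norm (y - p)) \<midarrow>p\<rightarrow> 0"
  proof (rule Lim_null_comparison[OF _ lim0])
    show "\<forall>\<^sub>F y in at p. norm (norm (f y *\<^sub>R g y - f p *\<^sub>R g p - f p *\<^sub>R g' (y - p)) / norm (y - p))
      \<le> \<bar>f y\<bar> * (norm (g y - g p - g' (y - p)) / norm (y - p)) + \<bar>f y - f p\<bar> * K"
    proof (intro always_eventually allI)
      fix y
      have "f y *\<^sub>R g y - f p *\<^sub>R g p - f p *\<^sub>R g' (y - p)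
          = f y *\<^sub>R (g y - g p - g' (y - p)) + (f y - f p) *\<^sub>R g' (y - p)"
        by (simp add: g0 algebra_simps)
      then have "norm (f y *\<^sub>R g y - f p *\<^sub>R g p - f p *\<^sub>R g' (y - p))
          \<le> \<bar>f y\<bar> * norm (g y - g p - g' (y - p)) + \<bar>f y - f p\<bar> * norm (g' (y - p))"
        by (metis norm_scaleR norm_triangle_ineq)
      also have "\<dots> \<le> \<bar>f y\<bar> * norm (g y - g p - g' (y - p)) + \<bar>f y - f p\<bar> * (norm (y - p) * K)"
        by (intro add_left_mono mult_left_mono K) auto
      finally show "norm (norm (f y *\<^sub>R g y - f p *\<^sub>R g p - f p *\<^sub>R g' (y - p)) / norm (y - p))
        \<le> \<bar>f y\<bar> * (norm (g y - g p - g' (y - p)) / norm (y - p)) + \<bar>f y - f p\<bar> * K"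
        using K(2) by (cases "y = p") (auto simp: field_simps)
    qed
  qed
  then show ?thesis
    unfolding has_derivative_iff_norm using bounded_linear_const_scaleR[OF g'.bounded_linear_axioms]
    by (auto simp: has_derivative_iff_norm intro: bounded_linear_intros g'.bounded_linear_axioms)
qed

section \<open>Symbol estimates of finite order, uniform in the parameter\<close>

definition sderiv ::
  "('a::euclidean_space \<Rightarrow> real) \<Rightarrow> 'a \<Rightarrow> (real \<Rightarrow> 'a \<Rightarrow> 'b::real_normed_vector) \<Rightarrow> real \<Rightarrow> 'a \<Rightarrow> 'b"
  where "sderiv wt b f = (\<lambda>t p. t powr (- wt b) *\<^sub>R dir_deriv b (f t) p)"

locale symbol_times =
  fixes T :: "real set"
  assumes T: "T \<subseteq> {0<..<1}"
begin

definition dominated :: "(real \<Rightarrow> 'a \<Rightarrow> real) \<Rightarrow> (real \<Rightarrow> 'a \<Rightarrow> 'b::real_normed_vector) \<Rightarrow> bool"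
  where "dominated M f \<longleftrightarrow> (\<exists>C>0. \<forall>t\<in>T. \<forall>p. norm (f t p) \<le> C * M t p)"

text \<open>Differentiation along the basis vector \<open>b\<close> is allowed to gain the factor \<open>t^(wt b)\<close>, which \<open>sderiv\<close>
  divides out; \<open>k\<close> is the number of derivatives under control.\<close>

primrec symbol_k ::
  "nat \<Rightarrow> ('a::euclidean_space \<Rightarrow> real) \<Rightarrow> (real \<Rightarrow> 'a \<Rightarrow> real) \<Rightarrow> (real \<Rightarrow> 'a \<Rightarrow> 'b::real_normed_vector) \<Rightarrow> bool"
where
  "symbol_k 0 wt M f \<longleftrightarrow> dominated M f"
| "symbol_k (Suc k) wt M f \<longleftrightarrow> dominated M f \<and> (\<forall>t\<in>T. \<forall>p. f t differentiable (at p)) \<and>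
     (\<forall>b\<in>Basis. symbol_k k wt M (sderiv wt b f))"

lemma symbol_k_dominated: "symbol_k k wt M f \<Longrightarrow> dominated M f"
  by (cases k) auto

lemma symbol_k_SucD: "symbol_k (Suc k) wt M f \<Longrightarrow> symbol_k k wt M f"
  by (induction k arbitrary: f) auto

lemma symbol_k_sderiv: "symbol_k (Suc k) wt M f \<Longrightarrow> b \<in> Basis \<Longrightarrow> symbol_k k wt M (sderiv wt b f)"
  by simp

lemma symbol_k_differentiable: "symbol_k (Suc k) wt M f \<Longrightarrow> t \<in> T \<Longrightarrow> f t differentiable (at p)"
  by simp

lemma dominated_cong: "(\<And>t. t \<in> T \<Longrightarrow> f t = g t) \<Longrightarrow> dominated M f \<longleftrightarrow> dominated M g"
  by (simp add: dominated_def)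

lemma symbol_k_cong:
  "(\<And>t. t \<in> T \<Longrightarrow> f t = g t) \<Longrightarrow> symbol_k k wt M f \<longleftrightarrow> symbol_k k wt M g"
proof (induction k arbitrary: f g)
  case 0
  then show ?case by (simp add: dominated_cong[of f g])
next
  case (Suc k)
  have "symbol_k k wt M (sderiv wt b f) \<longleftrightarrow> symbol_k k wt M (sderiv wt b g)" for b
    by (rule Suc.IH) (simp add: sderiv_def Suc.prems)
  then show ?case using Suc.prems dominated_cong[of f g] by simp
qed

lemma symbol_k_congI:
  "symbol_k k wt M g \<Longrightarrow> (\<And>t. t \<in> T \<Longrightarrow> f t = g t) \<Longrightarrow> symbol_k k wt M f"
  using symbol_k_cong by blast

lemma dominated_weaken:
  assumes "dominated M f" "C > 0" "\<And>t p. t \<in> T \<Longrightarrow> M t p \<le> C * M' t p"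
  shows "dominated M' f"
proof -
  obtain D where D: "D > 0" "\<And>t p. t \<in> T \<Longrightarrow> norm (f t p) \<le> D * M t p"
    using assms(1) by (auto simp: dominated_def)
  have "norm (f t p) \<le> (D * C) * M' t p" if "t \<in> T" for t p
    using D(2)[OF that, of p] mult_left_mono[OF assms(3)[OF that, of p], of D] D(1) by (simp only: mult.assoc) linarith
  then show ?thesis using D(1) assms(2) unfolding dominated_def by (intro exI[of _ "D * C"]) simp
qed

lemma symbol_k_weaken:
  assumes "symbol_k k wt M f" "C > 0" "\<And>t p. t \<in> T \<Longrightarrow> M t p \<le> C * M' t p"
  shows "symbol_k k wt M' f"
  using assms(1) by (induction k arbitrary: f) (auto intro: dominated_weaken[OF _ assms(2,3)])

lemma dominated_add:
  assumes "dominated M f" "dominated M g"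
  shows "dominated M (\<lambda>t p. f t p + g t p)"
proof -
  obtain C D where C: "C > 0" "\<And>t p. t \<in> T \<Longrightarrow> norm (f t p) \<le> C * M t p"
    and D: "D > 0" "\<And>t p. t \<in> T \<Longrightarrow> norm (g t p) \<le> D * M t p"
    using assms by (auto simp: dominated_def)
  have "norm (f t p + g t p) \<le> (C + D) * M t p" if "t \<in> T" for t p
    using C(2)[OF that, of p] D(2)[OF that, of p] norm_triangle_ineq[of "f t p" "g t p"]
    by (simp add: distrib_right)
  then show ?thesis using C(1) D(1) unfolding dominated_def by (intro exI[of _ "C + D"]) simp
qed

lemma symbol_k_add:
  assumes "symbol_k k wt M f" "symbol_k k wt M g"
  shows "symbol_k k wt M (\<lambda>t p. f t p + g t p)"
  using assms
proof (induction k arbitrary: f g)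
  case (Suc k)
  have "symbol_k k wt M (sderiv wt b (\<lambda>t p. f t p + g t p))" if b: "b \<in> Basis" for b
  proof -
    have eq: "sderiv wt b (\<lambda>t p. f t p + g t p) t = (\<lambda>p. sderiv wt b f t p + sderiv wt b g t p)" if "t \<in> T" for t
    proof
      fix p
      have "dir_deriv b (\<lambda>p. f t p + g t p) p = dir_deriv b (f t) p + dir_deriv b (g t) p"
        using Suc.prems that by (intro dir_deriv_eq has_derivative_add has_derivative_dir_deriv) auto
      then show "sderiv wt b (\<lambda>t p. f t p + g t p) t p = sderiv wt b f t p + sderiv wt b g t p"
        by (simp add: sderiv_def scaleR_add_right)
    qed
    show ?thesis
      by (rule symbol_k_congI[OF Suc.IH[OF symbol_k_sderiv[OF Suc.prems(1) b] symbol_k_sderiv[OF Suc.prems(2) b]] eq])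
  qed
  then show ?case using Suc.prems by (auto intro: dominated_add differentiable_add)
qed (auto intro: dominated_add)

lemma symbol_k_bounded_linear:
  assumes L: "bounded_linear L" and "symbol_k k wt M f"
  shows "symbol_k k wt M (\<lambda>t p. L (f t p))"
  using assms(2)
proof (induction k arbitrary: f)
  case 0
  then obtain C where C: "C > 0" "\<And>t p. t \<in> T \<Longrightarrow> norm (f t p) \<le> C * M t p"
    by (auto simp: dominated_def)
  obtain K where K: "K > 0" "\<And>x. norm (L x) \<le> norm x * K"
    using bounded_linear.pos_bounded[OF L] by blast
  have "norm (L (f t p)) \<le> (C * K) * M t p" if "t \<in> T" for t p
    using K(2)[of "f t p"] mult_right_mono[OF C(2)[OF that, of p], of K] K(1) by (simp only: mult_ac) linarith
  then show ?case using C(1) K(1) unfolding symbol_k.simps dominated_def by (intro exI[of _ "C * K"]) simp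
next
  case (Suc k)
  have dom: "dominated M (\<lambda>t p. L (f t p))"
    using Suc.IH[OF symbol_k_SucD[OF Suc.prems]] by (rule symbol_k_dominated)
  have "symbol_k k wt M (sderiv wt b (\<lambda>t p. L (f t p)))" if b: "b \<in> Basis" for b
  proof -
    have eq: "sderiv wt b (\<lambda>t p. L (f t p)) t = (\<lambda>p. L (sderiv wt b f t p))" if "t \<in> T" for t
      using dir_deriv_bounded_linear[OF L, of "f t"] Suc.prems that
      by (auto simp: sderiv_def linear_cmul[OF bounded_linear.linear[OF L]])
    show ?thesis
      by (rule symbol_k_congI[OF Suc.IH[OF symbol_k_sderiv[OF Suc.prems b]] eq])
  qed
  moreover have "(\<lambda>p. L (f t p)) differentiable (at p)" if "t \<in> T" for t p
    using bounded_linear.has_derivative[OF L has_derivative_dir_deriv, of "f t" p] Suc.prems that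
    by (auto simp: differentiable_def)
  ultimately show ?case using dom by simp
qed

lemma symbol_k_bounded_bilinear:
  assumes B: "bounded_bilinear B" and "symbol_k k wt M f" "symbol_k k wt N g"
  shows "symbol_k k wt (\<lambda>t p. M t p * N t p) (\<lambda>t p. B (f t p) (g t p))"
  using assms(2,3)
proof (induction k arbitrary: f g)
  case 0
  then obtain C D where C: "C > 0" "\<And>t p. t \<in> T \<Longrightarrow> norm (f t p) \<le> C * M t p"
    and D: "D > 0" "\<And>t p. t \<in> T \<Longrightarrow> norm (g t p) \<le> D * N t p"
    by (auto simp: dominated_def)
  obtain K where K: "K > 0" "\<And>x y. norm (B x y) \<le> norm x * norm y * K"
    using bounded_bilinear.pos_bounded[OF B] by blast
  have "norm (B (f t p) (g t p)) \<le> (C * D * K) * (M t p * N t p)" if "t \<in> T" for t p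
  proof -
    have "norm (f t p) * norm (g t p) \<le> (C * M t p) * (D * N t p)"
      using order_trans[OF norm_ge_zero C(2)[OF that, of p]]
      by (intro mult_mono C(2)[OF that] D(2)[OF that]) auto
    then have "norm (f t p) * norm (g t p) * K \<le> (C * M t p) * (D * N t p) * K"
      using K(1) by (intro mult_right_mono) auto
    with K(2)[of "f t p" "g t p"] show ?thesis by (simp add: mult_ac)
  qed
  then show ?case using C(1) D(1) K(1) unfolding symbol_k.simps dominated_def
    by (intro exI[of _ "C * D * K"]) simp
next
  case (Suc k)
  have dom: "dominated (\<lambda>t p. M t p * N t p) (\<lambda>t p. B (f t p) (g t p))"
    using Suc.IH[OF symbol_k_SucD symbol_k_SucD] Suc.prems by (blast intro: symbol_k_dominated)
  have der: "((\<lambda>p. B (f t p) (g t p)) has_derivative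
      (\<lambda>h. B (f t p) (dir_deriv h (g t) p) + B (dir_deriv h (f t) p) (g t p))) (at p)" if "t \<in> T" for t p
    using Suc.prems that by (intro bounded_bilinear.FDERIV[OF B] has_derivative_dir_deriv) auto
  interpret B: bounded_bilinear B by fact
  have "symbol_k k wt (\<lambda>t p. M t p * N t p) (sderiv wt b (\<lambda>t p. B (f t p) (g t p)))" if b: "b \<in> Basis" for b
  proof -
    have eq: "sderiv wt b (\<lambda>t p. B (f t p) (g t p)) t =
        (\<lambda>p. B (f t p) (sderiv wt b g t p) + B (sderiv wt b f t p) (g t p))" if "t \<in> T" for t
      using dir_deriv_eq[OF der[OF that], of b]
      by (auto simp: sderiv_def B.scaleR_left B.scaleR_right scaleR_add_right)
    have "symbol_k k wt (\<lambda>t p. M t p * N t p) (\<lambda>t p. B (f t p) (sderiv wt b g t p) + B (sderiv wt b f t p) (g t p))"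
      by (intro symbol_k_add Suc.IH symbol_k_sderiv[OF _ b] Suc.prems symbol_k_SucD[OF Suc.prems(1)] symbol_k_SucD[OF Suc.prems(2)])
    then show ?thesis by (rule symbol_k_congI[OF _ eq])
  qed
  moreover have "(\<lambda>p. B (f t p) (g t p)) differentiable (at p)" if "t \<in> T" for t p
    using der[OF that] by (auto simp: differentiable_def)
  ultimately show ?case using dom by simp
qed

lemma symbol_k_param:
  fixes M :: "real \<Rightarrow> 'a::euclidean_space \<Rightarrow> real" and c :: "real \<Rightarrow> 'b::real_normed_vector"
  assumes "dominated M (\<lambda>t p. c t)"
  shows "symbol_k k wt M (\<lambda>t p. c t)"
proof -
  \<comment> \<open>The derivatives of a function constant in p vanish, so what remains is that 0 is
    dominated, that is, that M is nonnegative for t in T; this follows from the bound on c.\<close>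
  have dom: "dominated M (\<lambda>t p. 0 :: 'b)"
  proof -
    obtain C where C: "C > 0" "\<And>t p. t \<in> T \<Longrightarrow> norm (c t) \<le> C * M t p"
      using assms by (auto simp: dominated_def)
    have "0 \<le> C * M t p" if "t \<in> T" for t p
      using order_trans[OF norm_ge_zero C(2)[OF that, of p]] .
    then show ?thesis unfolding dominated_def using C(1) by (intro exI[of _ C]) simp
  qed
  have z: "sderiv wt b (\<lambda>t p. d t) = (\<lambda>t p. 0 :: 'b)" for b and d :: "real \<Rightarrow> 'b"
    by (simp add: sderiv_def dir_deriv_def)
  have "symbol_k k wt M (\<lambda>t p. 0 :: 'b)" for k
    by (induction k) (simp_all add: dom z[of _ "\<lambda>_. 0"])
  then show ?thesis using assms by (cases k) (simp_all add: z)
qed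

lemma symbol_k_scaleR:
  assumes "symbol_k k wt M f"
  shows "symbol_k k wt (\<lambda>t p. \<bar>c t\<bar> * M t p) (\<lambda>t p. c t *\<^sub>R f t p)"
proof -
  have "dominated (\<lambda>t p. \<bar>c t\<bar>) (\<lambda>t (p::'a). c t)"
    unfolding dominated_def by (intro exI[of _ 1]) simp
  from symbol_k_bounded_bilinear[OF bounded_bilinear_scaleR symbol_k_param[OF this] assms]
  show ?thesis .
qed

lemma symbol_k_scaleR_le:
  assumes "symbol_k k wt M f" "C > 0" "\<And>t p. t \<in> T \<Longrightarrow> \<bar>c t\<bar> * M t p \<le> C * N t p"
  shows "symbol_k k wt N (\<lambda>t p. c t *\<^sub>R f t p)"
  using symbol_k_weaken[OF symbol_k_scaleR[OF assms(1)] assms(2,3)] .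

lemma symbol_k_sum:
  fixes M :: "real \<Rightarrow> 'a::euclidean_space \<Rightarrow> real" and f :: "'i \<Rightarrow> real \<Rightarrow> 'a \<Rightarrow> 'b::real_normed_vector"
  assumes "finite I" "\<And>i. i \<in> I \<Longrightarrow> symbol_k k wt M (f i)" "\<And>t p. t \<in> T \<Longrightarrow> 0 \<le> M t p"
  shows "symbol_k k wt M (\<lambda>t p. \<Sum>i\<in>I. f i t p)"
  using assms(1,2)
proof (induction rule: finite_induct)
  case empty
  have "dominated M (\<lambda>t p. 0::'b)" using assms(3) unfolding dominated_def by (intro exI[of _ 1]) simp
  then show ?case using symbol_k_param[of M "\<lambda>_. 0"] by simp
qed (auto intro: symbol_k_add)

text \<open>One order is lost: the last level of \<open>symbol_k\<close> is only a bound, and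
  continuity is obtained from differentiability one level up. Derivatives along \<open>Basis\<close>
  suffice, since every direction is a fixed linear combination of them.\<close>

lemma symbol_k_imp_C_k: "symbol_k (Suc k) wt M f \<Longrightarrow> t \<in> T \<Longrightarrow> C_k k (f t)"
proof (induction k arbitrary: f)
  case 0
  then show ?case
    by (auto intro!: continuous_at_imp_continuous_on differentiable_imp_continuous_within)
next
  case (Suc k)
  have t: "t > 0" using Suc.prems(2) T by auto
  have diff: "f t differentiable (at p)" for p using Suc.prems by auto
  have "C_k k (dir_deriv b (f t))" if "b \<in> Basis" for b
  proof -
    have "dir_deriv b (f t) = (\<lambda>p. t powr (wt b) *\<^sub>R sderiv wt b f t p)"
      using t by (simp add: sderiv_def powr_minus)
    then show ?thesis using Suc.IH[OF symbol_k_sderiv[OF Suc.prems(1) that] Suc.prems(2)]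
      by (simp add: C_k_scaleR)
  qed
  then have "C_k k (\<lambda>p. \<Sum>b\<in>Basis. (h \<bullet> b) *\<^sub>R dir_deriv b (f t) p)" for h
    by (intro C_k_sum C_k_scaleR) auto
  then have "C_k k (dir_deriv h (f t))" for h
    unfolding dir_deriv_expand[OF diff, of h, abs_def] .
  then show ?case using diff by simp
qed

text \<open>No bound on the function itself, so that unbounded coordinates such as \<open>t^(1/2) v\<close> are admitted.\<close>

definition bounded_sderivs ::
  "nat \<Rightarrow> ('a::euclidean_space \<Rightarrow> real) \<Rightarrow> (real \<Rightarrow> 'a \<Rightarrow> 'b::real_normed_vector) \<Rightarrow> bool"
where
  "bounded_sderivs k wt f \<longleftrightarrow> (\<forall>t\<in>T. \<forall>p. f t differentiable (at p)) \<and>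
     (\<forall>b\<in>Basis. symbol_k k wt (\<lambda>_ _. 1) (sderiv wt b f))"

lemma bounded_sderivs_SucD: "bounded_sderivs (Suc k) wt f \<Longrightarrow> bounded_sderivs k wt f"
  unfolding bounded_sderivs_def using symbol_k_SucD by blast

lemma symbol_k_SucI:
  assumes "bounded_sderivs k wt f" "dominated M f" "C > 0" "\<And>t p. t \<in> T \<Longrightarrow> 1 \<le> C * M t p"
  shows "symbol_k (Suc k) wt M f"
  using assms by (auto simp: bounded_sderivs_def intro: symbol_k_weaken[of k wt "\<lambda>_ _. 1" _ C M])

section \<open>Chain rule and stability under composition\<close>

lemma differentiable_rescaled:
  fixes \<Phi> :: "real \<Rightarrow> 'c::euclidean_space \<Rightarrow> 'a::euclidean_space"
  assumes "\<And>b. b \<in> Basis \<Longrightarrow> bounded_sderivs k wt' (\<lambda>t p. t powr wt b *\<^sub>R (\<Phi> t p \<bullet> b))" and t: "t \<in> T"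
  shows "\<Phi> t differentiable (at p)"
  unfolding differentiable_componentwise[of "\<Phi> t"]
proof
  fix b :: 'a assume b: "b \<in> Basis"
  have "t > 0" using t T by auto
  have "(\<lambda>p. t powr wt b *\<^sub>R (\<Phi> t p \<bullet> b)) differentiable (at p)"
    using assms(1)[OF b] t by (auto simp: bounded_sderivs_def)
  then have "(\<lambda>p. t powr (- wt b) *\<^sub>R (t powr wt b *\<^sub>R (\<Phi> t p \<bullet> b))) differentiable (at p)"
    by auto
  then show "(\<lambda>p. \<Phi> t p \<bullet> b) differentiable (at p)"
    using \<open>t > 0\<close> by (simp add: powr_minus)
qed

text \<open>The chain rule in rescaled form: the factor t^(wt b) put on the component of \<Phi>
  along b cancels the factor t^(- wt b) in the rescaled derivative of F, so only the rescaled
  components of \<Phi> have to be controlled.\<close>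

lemma sderiv_compose:
  fixes F :: "real \<Rightarrow> 'a::euclidean_space \<Rightarrow> 'b::real_normed_vector"
    and \<Phi> :: "real \<Rightarrow> 'c::euclidean_space \<Rightarrow> 'a"
  assumes t: "t \<in> T" and F: "\<And>p. F t differentiable (at p)" and \<Phi>: "\<And>p. \<Phi> t differentiable (at p)"
  shows "sderiv wt' e (\<lambda>t p. F t (\<Phi> t p)) t =
      (\<lambda>p. \<Sum>b\<in>Basis. sderiv wt' e (\<lambda>t p. t powr wt b *\<^sub>R (\<Phi> t p \<bullet> b)) t p *\<^sub>R sderiv wt b F t (\<Phi> t p))"
proof
  fix p
  have "t > 0" using t T by auto
  have der: "((\<lambda>p. F t (\<Phi> t p)) has_derivative (\<lambda>h. dir_deriv (dir_deriv h (\<Phi> t) p) (F t) (\<Phi> t p))) (at p)"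
    by (rule has_derivative_compose[OF has_derivative_dir_deriv has_derivative_dir_deriv]) fact+
  have 1: "dir_deriv e (\<lambda>p. t powr wt b *\<^sub>R (\<Phi> t p \<bullet> b)) p = t powr wt b * (dir_deriv e (\<Phi> t) p \<bullet> b)" for b
    using dir_deriv_bounded_linear[OF bounded_linear_compose[OF bounded_linear_scaleR_right bounded_linear_inner_left] \<Phi>]
    by simp
  show "sderiv wt' e (\<lambda>t p. F t (\<Phi> t p)) t p = (\<Sum>b\<in>Basis. sderiv wt' e (\<lambda>t p. t powr wt b *\<^sub>R (\<Phi> t p \<bullet> b)) t p *\<^sub>R sderiv wt b F t (\<Phi> t p))"
    unfolding sderiv_def 1 dir_deriv_eq[OF der]
    apply (subst dir_deriv_expand[OF F])
    using \<open>t > 0\<close> by (simp add: scaleR_sum_right powr_minus field_simps)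
qed

lemma dominated_nonneg: "dominated M f \<Longrightarrow> t \<in> T \<Longrightarrow> 0 \<le> M t p"
proof -
  assume "dominated M f" "t \<in> T"
  then obtain C where C: "C > 0" "norm (f t p) \<le> C * M t p"
    by (auto simp: dominated_def)
  from order_trans[OF norm_ge_zero C(2)] C(1) show ?thesis by (simp add: zero_le_mult_iff)
qed

text \<open>By the chain rule each rescaled derivative of the composite is a sum of products of a
  bounded factor and a composite of the same form, with a derivative of F in place of F; hence
  induction on the order. Order k asks for derivatives of \<Phi> of total order at most k, which is
  \<open>bounded_sderivs j\<close> with k = Suc j. This exact count keeps the later induction for
  the inverse of the shear from being circular.\<close>

lemma symbol_k_compose:
  fixes F :: "real \<Rightarrow> 'a::euclidean_space \<Rightarrow> 'b::real_normed_vector"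
    and \<Phi> :: "real \<Rightarrow> 'c::euclidean_space \<Rightarrow> 'a"
  assumes "symbol_k k wt M F"
    and "\<And>j b. k = Suc j \<Longrightarrow> b \<in> Basis \<Longrightarrow> bounded_sderivs j wt' (\<lambda>t p. t powr wt b *\<^sub>R (\<Phi> t p \<bullet> b))"
  shows "symbol_k k wt' (\<lambda>t p. M t (\<Phi> t p)) (\<lambda>t p. F t (\<Phi> t p))"
  using assms
proof (induction k arbitrary: F)
  case 0
  then show ?case unfolding symbol_k.simps dominated_def by blast
next
  case (Suc k)
  have bd: "bounded_sderivs k wt' (\<lambda>t p. t powr wt b *\<^sub>R (\<Phi> t p \<bullet> b))" if "b \<in> Basis" for b
    using Suc.prems(2)[OF refl that] .
  have \<Phi>: "\<Phi> t differentiable (at p)" if "t \<in> T" for t p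
    using differentiable_rescaled[OF bd that] .
  have F: "F t differentiable (at p)" if "t \<in> T" for t p using Suc.prems(1) that by simp
  have "symbol_k k wt' (\<lambda>t p. M t (\<Phi> t p)) (sderiv wt' e (\<lambda>t p. F t (\<Phi> t p)))" if e: "e \<in> Basis" for e
  proof (rule symbol_k_congI[OF _ sderiv_compose[OF _ F \<Phi>]])
    show "symbol_k k wt' (\<lambda>t p. M t (\<Phi> t p)) (\<lambda>t p. \<Sum>b\<in>Basis. sderiv wt' e (\<lambda>t p. t powr wt b *\<^sub>R (\<Phi> t p \<bullet> b)) t p *\<^sub>R sderiv wt b F t (\<Phi> t p))"
    proof (rule symbol_k_sum)
      fix b :: 'a assume b: "b \<in> Basis"
      have 1: "symbol_k k wt' (\<lambda>_ _. 1) (sderiv wt' e (\<lambda>t p. t powr wt b *\<^sub>R (\<Phi> t p \<bullet> b)))"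
        using bd[OF b] e by (auto simp: bounded_sderivs_def)
      have "bounded_sderivs j wt' (\<lambda>t p. t powr wt c *\<^sub>R (\<Phi> t p \<bullet> c))" if "k = Suc j" "c \<in> Basis" for j c
        using bd[OF that(2)] that(1) bounded_sderivs_SucD by blast
      then have 2: "symbol_k k wt' (\<lambda>t p. M t (\<Phi> t p)) (\<lambda>t p. sderiv wt b F t (\<Phi> t p))"
        using Suc.IH[OF symbol_k_sderiv[OF Suc.prems(1) b]] by blast
      show "symbol_k k wt' (\<lambda>t p. M t (\<Phi> t p)) (\<lambda>t p. sderiv wt' e (\<lambda>t p. t powr wt b *\<^sub>R (\<Phi> t p \<bullet> b)) t p *\<^sub>R sderiv wt b F t (\<Phi> t p))"
        using symbol_k_bounded_bilinear[OF bounded_bilinear_scaleR 1 2] by simp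
    qed (auto intro: dominated_nonneg[OF symbol_k_dominated[OF Suc.prems(1)]])
  qed auto
  moreover have "dominated (\<lambda>t p. M t (\<Phi> t p)) (\<lambda>t p. F t (\<Phi> t p))"
    using Suc.prems(1) by (auto simp: dominated_def)
  moreover have "(\<lambda>p. F t (\<Phi> t p)) differentiable (at p)" if "t \<in> T" for t p
    using differentiable_compose[OF F[OF that] \<Phi>[OF that]] .
  ultimately show ?case by simp
qed

text \<open>F itself may be unbounded, so \<open>symbol_k_compose\<close> is not applied to it; one
  chain rule step is made by hand, and the lemma is then applied to the bounded derivatives of
  F.\<close>

lemma bounded_sderivs_compose:
  fixes F :: "real \<Rightarrow> 'a::euclidean_space \<Rightarrow> 'b::real_normed_vector"
    and \<Phi> :: "real \<Rightarrow> 'c::euclidean_space \<Rightarrow> 'a"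
  assumes F: "bounded_sderivs k wt F"
    and bd: "\<And>b. b \<in> Basis \<Longrightarrow> bounded_sderivs k wt' (\<lambda>t p. t powr wt b *\<^sub>R (\<Phi> t p \<bullet> b))"
  shows "bounded_sderivs k wt' (\<lambda>t p. F t (\<Phi> t p))"
proof -
  have \<Phi>d: "\<Phi> t differentiable (at p)" if "t \<in> T" for t p
    using differentiable_rescaled[OF bd that] .
  have Fd: "F t differentiable (at p)" if "t \<in> T" for t p using F that by (simp add: bounded_sderivs_def)
  have "symbol_k k wt' (\<lambda>_ _. 1) (sderiv wt' e (\<lambda>t p. F t (\<Phi> t p)))" if e: "e \<in> Basis" for e
  proof (rule symbol_k_congI[OF _ sderiv_compose[OF _ Fd \<Phi>d]])
    show "symbol_k k wt' (\<lambda>_ _. 1) (\<lambda>t p. \<Sum>b\<in>Basis. sderiv wt' e (\<lambda>t p. t powr wt b *\<^sub>R (\<Phi> t p \<bullet> b)) t p *\<^sub>R sderiv wt b F t (\<Phi> t p))"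
    proof (rule symbol_k_sum)
      fix b :: 'a assume b: "b \<in> Basis"
      have 1: "symbol_k k wt' (\<lambda>_ _. 1) (sderiv wt' e (\<lambda>t p. t powr wt b *\<^sub>R (\<Phi> t p \<bullet> b)))"
        using bd[OF b] e by (auto simp: bounded_sderivs_def)
      have "bounded_sderivs j wt' (\<lambda>t p. t powr wt c *\<^sub>R (\<Phi> t p \<bullet> c))" if "k = Suc j" "c \<in> Basis" for j c
        using bd[OF that(2)] that(1) bounded_sderivs_SucD by blast
      then have 2: "symbol_k k wt' (\<lambda>t p. 1) (\<lambda>t p. sderiv wt b F t (\<Phi> t p))"
        using symbol_k_compose[where M = "\<lambda>_ _. 1", of k wt "sderiv wt b F" wt' \<Phi>] F b
        unfolding bounded_sderivs_def by blast
      show "symbol_k k wt' (\<lambda>_ _. 1) (\<lambda>t p. sderiv wt' e (\<lambda>t p. t powr wt b *\<^sub>R (\<Phi> t p \<bullet> b)) t p *\<^sub>R sderiv wt b F t (\<Phi> t p))"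
        using symbol_k_bounded_bilinear[OF bounded_bilinear_scaleR 1 2] by simp
    qed auto
  qed auto
  moreover have "(\<lambda>p. F t (\<Phi> t p)) differentiable (at p)" if "t \<in> T" for t p
    using differentiable_compose[OF Fd[OF that] \<Phi>d[OF that]] .
  ultimately show ?thesis by (simp add: bounded_sderivs_def)
qed

lemma bounded_sderivs_add:
  fixes f :: "real \<Rightarrow> 'a::euclidean_space \<Rightarrow> 'b::real_normed_vector"
  assumes "bounded_sderivs k wt f" "bounded_sderivs k wt g"
  shows "bounded_sderivs k wt (\<lambda>t p. f t p + g t p)"
proof -
  have eq: "sderiv wt b (\<lambda>t p. f t p + g t p) t = (\<lambda>p. sderiv wt b f t p + sderiv wt b g t p)" if "t \<in> T" for b t
  proof
    fix p
    have "dir_deriv b (\<lambda>p. f t p + g t p) p = dir_deriv b (f t) p + dir_deriv b (g t) p"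
      using assms that by (intro dir_deriv_eq has_derivative_add has_derivative_dir_deriv) (auto simp: bounded_sderivs_def)
    then show "sderiv wt b (\<lambda>t p. f t p + g t p) t p = sderiv wt b f t p + sderiv wt b g t p"
      by (simp add: sderiv_def scaleR_add_right)
  qed
  show ?thesis
    unfolding bounded_sderivs_def
  proof (intro conjI ballI allI)
    fix b :: 'a assume "b \<in> Basis"
    then show "symbol_k k wt (\<lambda>_ _. 1) (sderiv wt b (\<lambda>t p. f t p + g t p))"
      using assms by (intro symbol_k_congI[OF symbol_k_add eq]) (auto simp: bounded_sderivs_def)
  qed (use assms in \<open>auto simp: bounded_sderivs_def intro: differentiable_add\<close>)
qed

lemma bounded_sderivs_scaleR:
  fixes f :: "real \<Rightarrow> 'a::euclidean_space \<Rightarrow> 'b::real_normed_vector"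
  assumes f: "bounded_sderivs k wt f" and c: "\<And>t. t \<in> T \<Longrightarrow> \<bar>c t\<bar> \<le> C"
  shows "bounded_sderivs k wt (\<lambda>t p. c t *\<^sub>R f t p)"
proof -
  have eq: "sderiv wt b (\<lambda>t p. c t *\<^sub>R f t p) t = (\<lambda>p. c t *\<^sub>R sderiv wt b f t p)" if "t \<in> T" for b t
    using f that by (auto simp: sderiv_def bounded_sderivs_def dir_deriv_scaleR)
  show ?thesis
    unfolding bounded_sderivs_def
  proof (intro conjI ballI allI)
    fix b :: 'a assume b: "b \<in> Basis"
    have "symbol_k k wt (\<lambda>_ _. 1) (\<lambda>t p. c t *\<^sub>R sderiv wt b f t p)"
    proof (rule symbol_k_scaleR_le[where C = "\<bar>C\<bar> + 1"])
      show "symbol_k k wt (\<lambda>_ _. 1) (sderiv wt b f)"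
        using f b by (auto simp: bounded_sderivs_def)
    qed (use c in fastforce)+
    then show "symbol_k k wt (\<lambda>_ _. 1) (sderiv wt b (\<lambda>t p. c t *\<^sub>R f t p))"
      by (rule symbol_k_congI[OF _ eq])
  qed (use f in \<open>auto simp: bounded_sderivs_def\<close>)
qed

lemma bounded_sderivs_bounded_linear:
  fixes f :: "real \<Rightarrow> 'a::euclidean_space \<Rightarrow> 'b::real_normed_vector"
  assumes L: "bounded_linear L" and f: "bounded_sderivs k wt f"
  shows "bounded_sderivs k wt (\<lambda>t p. L (f t p))"
proof -
  have eq: "sderiv wt b (\<lambda>t p. L (f t p)) t = (\<lambda>p. L (sderiv wt b f t p))" if "t \<in> T" for b t
    using f that dir_deriv_bounded_linear[OF L, of "f t"]
    by (auto simp: sderiv_def bounded_sderivs_def linear_cmul[OF bounded_linear.linear[OF L]])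
  show ?thesis
    unfolding bounded_sderivs_def
  proof (intro conjI ballI allI)
    fix b :: 'a assume b: "b \<in> Basis"
    show "symbol_k k wt (\<lambda>_ _. 1) (sderiv wt b (\<lambda>t p. L (f t p)))"
      by (rule symbol_k_congI[OF symbol_k_bounded_linear[OF L] eq])
         (use f b in \<open>auto simp: bounded_sderivs_def\<close>)
  next
    fix t p assume "t \<in> T"
    then show "(\<lambda>p. L (f t p)) differentiable (at p)"
      using f bounded_linear.has_derivative[OF L has_derivative_dir_deriv, of "f t" p]
      by (auto simp: bounded_sderivs_def differentiable_def)
  qed
qed

text \<open>The rescaled derivative along b is t^(c - wt b) * L b. It stays bounded for t < 1
  because the exponent is nonnegative whenever L b does not vanish.\<close>

lemma bounded_sderivs_linear:
  fixes L :: "'a::euclidean_space \<Rightarrow> 'b::real_normed_vector"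
  assumes L: "bounded_linear L" and w: "\<And>b. b \<in> Basis \<Longrightarrow> L b \<noteq> 0 \<Longrightarrow> wt b \<le> c"
  shows "bounded_sderivs k wt (\<lambda>t p. t powr c *\<^sub>R L p)"
proof -
  have der: "((\<lambda>p. t powr c *\<^sub>R L p) has_derivative (\<lambda>h. t powr c *\<^sub>R L h)) (at p)" for t p
    by (intro has_derivative_scaleR_right bounded_linear.has_derivative[OF L] has_derivative_ident)
  have eq: "sderiv wt b (\<lambda>t p. t powr c *\<^sub>R L p) = (\<lambda>t p. t powr (c - wt b) *\<^sub>R L b)" for b
    by (auto simp: sderiv_def dir_deriv_eq[OF der] powr_add[symmetric])
  have "symbol_k k wt (\<lambda>_ _. 1) (\<lambda>t p. t powr (c - wt b) *\<^sub>R L b)" if b: "b \<in> Basis" for b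
  proof (rule symbol_k_param)
    have "norm (t powr (c - wt b) *\<^sub>R L b) \<le> norm (L b) + 1" if "t \<in> T" for t
    proof (cases "L b = 0")
      case False
      then have "t powr (c - wt b) \<le> 1" using that T w[OF b] by (auto intro!: powr_le1)
      then have "\<bar>t powr (c - wt b)\<bar> * norm (L b) \<le> 1 * norm (L b)"
        by (intro mult_right_mono) auto
      then show ?thesis by simp
    qed simp
    then show "dominated (\<lambda>_ _. 1) (\<lambda>t (p::'a). t powr (c - wt b) *\<^sub>R L b)"
      unfolding dominated_def by (intro exI[of _ "norm (L b) + 1"]) (simp add: add_nonneg_pos)
  qed
  then show ?thesis
    unfolding bounded_sderivs_def eq using der by (auto simp: differentiable_def)
qed

end

section \<open>Symbols of all orders\<close>

context symbol_times begin

definition symbol ::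
  "('a::euclidean_space \<Rightarrow> real) \<Rightarrow> (real \<Rightarrow> 'a \<Rightarrow> real) \<Rightarrow> (real \<Rightarrow> 'a \<Rightarrow> 'b::real_normed_vector) \<Rightarrow> bool"
  where "symbol wt M f \<longleftrightarrow> (\<forall>k. symbol_k k wt M f)"

lemma symbol_dominated: "symbol wt M f \<Longrightarrow> dominated M f"
  unfolding symbol_def by (blast intro: symbol_k_dominated)

lemma symbol_C_inf: "symbol wt M f \<Longrightarrow> t \<in> T \<Longrightarrow> C_inf (f t)"
  unfolding symbol_def C_inf_def using symbol_k_imp_C_k by blast

text \<open>Undoing the rescaling moves the factor t^(wt b) into the weight; this is how the powers
  of t in the final estimate arise.\<close>

lemma symbol_dir_deriv:
  assumes f: "symbol wt M f" and b: "b \<in> Basis"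
  shows "symbol wt (\<lambda>t p. t powr wt b * M t p) (\<lambda>t. dir_deriv b (f t))"
  unfolding symbol_def
proof
  fix k
  have "symbol_k (Suc k) wt M f" using f by (simp only: symbol_def)
  from symbol_k_scaleR[OF symbol_k_sderiv[OF this b], of "\<lambda>t. t powr wt b"]
  have "symbol_k k wt (\<lambda>t p. t powr wt b * M t p) (\<lambda>t p. t powr wt b *\<^sub>R sderiv wt b f t p)"
    by simp
  then show "symbol_k k wt (\<lambda>t p. t powr wt b * M t p) (\<lambda>t. dir_deriv b (f t))"
    by (rule symbol_k_congI) (use T in \<open>auto simp: sderiv_def powr_minus\<close>)
qed

lemma symbol_cong:
  assumes "symbol wt M f" "\<And>t p. t \<in> T \<Longrightarrow> M t p = N t p" "\<And>t. t \<in> T \<Longrightarrow> f t = g t"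
  shows "symbol wt N g"
proof -
  have "symbol wt N f"
    unfolding symbol_def
    using assms(1,2) by (auto simp: symbol_def intro: symbol_k_weaken[where C = 1])
  then show ?thesis unfolding symbol_def using assms(3) symbol_k_congI[of _ wt N f g] by metis
qed

lemma symbol_funpow:
  assumes f: "symbol wt M f" and b: "b \<in> Basis"
  shows "symbol wt (\<lambda>t p. t powr (real n * wt b) * M t p) (\<lambda>t. (dir_deriv b ^^ n) (f t))"
proof (induction n)
  case 0
  show ?case by (rule symbol_cong[OF f]) (use T in auto)
next
  case (Suc n)
  show ?case
    by (rule symbol_cong[OF symbol_dir_deriv[OF Suc b]])
       (auto simp: powr_add[symmetric] mult.assoc[symmetric] distrib_right)
qed

lemma symbol_mpartial:
  fixes e :: "'n::finite \<Rightarrow> 'a::euclidean_space"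
  assumes f: "symbol wt M f" and e: "\<And>i. e i \<in> Basis" "\<And>i. wt (e i) = w"
  shows "symbol wt (\<lambda>t p. t powr (real (mord \<alpha>) * w) * M t p) (\<lambda>t. mpartial e \<alpha> (f t))"
proof -
  have "symbol wt (\<lambda>t p. t powr (real (\<Sum>i\<leftarrow>is. \<alpha> $ i) * w) * M t p)
    (\<lambda>t. foldr (\<lambda>i. dir_deriv (e i) ^^ (\<alpha> $ i)) is (f t))" for "is"
  proof (induction "is")
    case Nil
    show ?case by (rule symbol_cong[OF f]) (use T in auto)
  next
    case (Cons i "is")
    show ?case
      by (rule symbol_cong[OF symbol_funpow[OF Cons e(1)[of i], of "\<alpha> $ i"]])
         (auto simp: powr_add[symmetric] mult.assoc[symmetric] distrib_right e)
  qed
  from this[of index_list] show ?thesis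
    by (simp add: mpartial_def mord_def sum_list_distinct_conv_sum_set index_list)
qed

text \<open>A differentiated solution solves an equation of the same kind, with a right-hand side that
  involves only lower derivatives of \<open>h\<close>. This is what controls the inverse of a perturbation of the
  identity without differentiating a matrix inverse.\<close>

lemma symbol_k_linear_equation:
  fixes h :: "real \<Rightarrow> 'a::euclidean_space \<Rightarrow> 'b::euclidean_space"
  assumes eq: "\<And>t p. t \<in> T \<Longrightarrow> h t p + s t *\<^sub>R (\<Sum>b\<in>Basis. (h t p \<bullet> b) *\<^sub>R K b t p) = r t p"
    and small: "\<And>t p y. t \<in> T \<Longrightarrow> norm (s t *\<^sub>R (\<Sum>b\<in>Basis. (y \<bullet> b) *\<^sub>R K b t p)) \<le> norm y / 2"
    and s: "\<And>t. t \<in> T \<Longrightarrow> \<bar>s t\<bar> \<le> S"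
    and K: "\<And>b. b \<in> Basis \<Longrightarrow> symbol_k k wt (\<lambda>_ _. 1) (K b)"
    and r: "symbol_k k wt (\<lambda>_ _. 1) r"
  shows "symbol_k k wt (\<lambda>_ _. 1) h"
  using eq K r
proof (induction k arbitrary: h r)
  case 0
  have bound: "norm (h t p) \<le> 2 * norm (r t p)" if "t \<in> T" for t p
    using small[OF that, of "h t p" p] norm_triangle_ineq4[of "r t p" "s t *\<^sub>R (\<Sum>b\<in>Basis. (h t p \<bullet> b) *\<^sub>R K b t p)"]
    by (simp flip: "0.prems"(1)[OF that])
  obtain C where C: "C > 0" "\<And>t p. t \<in> T \<Longrightarrow> norm (r t p) \<le> C"
    using "0.prems"(3) by (auto simp: dominated_def)
  have "norm (h t p) \<le> 2 * C" if "t \<in> T" for t p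
    using bound[OF that, of p] C(2)[OF that, of p] by linarith
  then show ?case using C(1) unfolding symbol_k.simps dominated_def by (intro exI[of _ "2 * C"]) simp
next
  case (Suc k)
  have hk: "symbol_k k wt (\<lambda>_ _. 1) h"
    by (rule Suc.IH[OF Suc.prems(1)]) (use Suc.prems symbol_k_SucD in blast)+
  have diffK: "K b t differentiable (at p)" if "t \<in> T" "b \<in> Basis" for b t p
    using Suc.prems(2)[OF that(2)] that(1) by simp
  have diffr: "r t differentiable (at p)" if "t \<in> T" for t p
    using Suc.prems(3) that by simp
  \<comment> \<open>h is merely given as a solution, and its differentiability has to be proved. The
    coefficients are frozen at p: the resulting operator A is invertible by smallness, and A applied
    to the increment of h equals R, in which h multiplies only increments of the
    coefficients.\<close>
  have diff: "h t differentiable (at p)" if t: "t \<in> T" for t p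
  proof -
    define A where "A y = y + s t *\<^sub>R (\<Sum>b\<in>Basis. (y \<bullet> b) *\<^sub>R K b t p)" for y
    have lin: "linear A"
      unfolding A_def
      by (intro linearI) (auto simp: inner_add_left scaleR_add_left scaleR_add_right sum.distrib scaleR_sum_right mult_ac)
    have lower: "norm y \<le> 2 * norm (A y)" for y
      using small[OF t, of y p] norm_diff_ineq[of y "s t *\<^sub>R (\<Sum>b\<in>Basis. (y \<bullet> b) *\<^sub>R K b t p)"]
      by (simp add: A_def)
    have "inj A"
      unfolding linear_injective_0[OF lin] using lower by (metis norm_le_zero_iff norm_zero mult_zero_right)
    then obtain A' where A': "linear A'" "A' \<circ> A = id"
      using linear_injective_left_inverse[OF lin] by blast
    define R where "R q = r t q - r t p - s t *\<^sub>R (\<Sum>b\<in>Basis. (h t q \<bullet> b) *\<^sub>R (K b t q - K b t p))" for q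
    have AR: "A (h t q - h t p) = R q" for q
      unfolding R_def A_def Suc.prems(1)[OF t, symmetric]
      by (simp add: algebra_simps sum_subtractf scaleR_sum_right)
    obtain C where C: "C > 0" "\<And>q. norm (h t q) \<le> C"
      using symbol_k_dominated[OF hk] t by (auto simp: dominated_def)
    \<comment> \<open>This majorant of the increment of h uses only that h is bounded. It tends to 0
      at p, so h is continuous there, which is what \<open>has_derivative_scaleR_vanishing\<close>
      asks for.\<close>
    define bd where "bd q = 2 * (norm (r t q - r t p) + \<bar>s t\<bar> * (\<Sum>b\<in>Basis. C * norm (K b t q - K b t p)))" for q
    have bd: "norm (h t q - h t p) \<le> bd q" for q
    proof -
      have "norm (R q) \<le> norm (r t q - r t p) + norm (s t *\<^sub>R (\<Sum>b\<in>Basis. (h t q \<bullet> b) *\<^sub>R (K b t q - K b t p)))"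
        unfolding R_def by (rule norm_triangle_ineq4)
      also have "\<dots> \<le> norm (r t q - r t p) + \<bar>s t\<bar> * (\<Sum>b\<in>Basis. C * norm (K b t q - K b t p))"
        unfolding norm_scaleR
      proof (intro add_left_mono mult_left_mono sum_norm_le)
        fix b :: 'b assume "b \<in> Basis"
        then have "\<bar>h t q \<bullet> b\<bar> \<le> C" using C(2)[of q] Basis_le_norm[of b "h t q"] by linarith
        then show "norm ((h t q \<bullet> b) *\<^sub>R (K b t q - K b t p)) \<le> C * norm (K b t q - K b t p)"
          by (simp add: mult_right_mono)
      qed auto
      finally have "2 * norm (R q) \<le> bd q" unfolding bd_def by (rule mult_left_mono) simp
      then show ?thesis using lower[of "h t q - h t p"] unfolding AR by linarith
    qed
    have lim_r: "r t \<midarrow>p\<rightarrow> r t p"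
      using differentiable_imp_continuous_within[OF diffr[OF t, of p]] by (simp add: continuous_within)
    have lim_K: "K b t \<midarrow>p\<rightarrow> K b t p" if "b \<in> Basis" for b
      using differentiable_imp_continuous_within[OF diffK[OF t that, of p]] by (simp add: continuous_within)
    have "bd \<midarrow>p\<rightarrow> 2 * (norm (r t p - r t p) + \<bar>s t\<bar> * (\<Sum>b\<in>Basis. C * norm (K b t p - K b t p)))"
      unfolding bd_def by (intro tendsto_intros lim_r lim_K) auto
    then have "bd \<midarrow>p\<rightarrow> 0" by simp
    then have "(\<lambda>q. h t q - h t p) \<midarrow>p\<rightarrow> 0"
      by (rule Lim_null_comparison[rotated]) (use bd in auto)
    then have lim_h: "h t \<midarrow>p\<rightarrow> h t p"
      by (rule LIM_zero_cancel)
    have "((\<lambda>q. (h t q \<bullet> b) *\<^sub>R (K b t q - K b t p)) has_derivative (\<lambda>y. (h t p \<bullet> b) *\<^sub>R dir_deriv y (K b t) p)) (at p)"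
      if "b \<in> Basis" for b
    proof (rule has_derivative_scaleR_vanishing)
      show "(\<lambda>q. h t q \<bullet> b) \<midarrow>p\<rightarrow> h t p \<bullet> b" by (intro tendsto_intros lim_h)
      have "((\<lambda>q. K b t q - K b t p) has_derivative (\<lambda>y. dir_deriv y (K b t) p - 0)) (at p)"
        by (intro has_derivative_diff has_derivative_dir_deriv diffK t that has_derivative_const)
      then show "((\<lambda>q. K b t q - K b t p) has_derivative (\<lambda>y. dir_deriv y (K b t) p)) (at p)"
        by simp
    qed simp
    then have "((\<lambda>q. s t *\<^sub>R (\<Sum>b\<in>Basis. (h t q \<bullet> b) *\<^sub>R (K b t q - K b t p))) has_derivative
        (\<lambda>y. s t *\<^sub>R (\<Sum>b\<in>Basis. (h t p \<bullet> b) *\<^sub>R dir_deriv y (K b t) p))) (at p)"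
      by (intro has_derivative_scaleR_right has_derivative_sum)
    then have "R differentiable (at p)"
      unfolding R_def using diffr[OF t] by (intro differentiable_diff) (auto simp: differentiable_def)
    then have A'R: "(\<lambda>q. A' (R q)) differentiable (at p)"
      using bounded_linear.has_derivative[OF linear_conv_bounded_linear[THEN iffD1, OF A'(1)] has_derivative_dir_deriv]
      by (auto simp: differentiable_def)
    have h_eq: "h t = (\<lambda>q. A' (R q) + h t p)"
    proof
      fix q
      have "A' (A (h t q - h t p)) = h t q - h t p" using A'(2) by (metis comp_apply id_apply)
      then show "h t q = A' (R q) + h t p" unfolding AR by simp
    qed
    show ?thesis
      by (subst h_eq) (intro differentiable_add differentiable_const A'R)
  qed
  \<comment> \<open>Differentiating the equation leaves the same operator in front of the derivative
    of h. The terms in which \<open>K b\<close> is differentiated contain h itself, already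
    controlled to order k, and go to the right-hand side.\<close>
  have "symbol_k k wt (\<lambda>_ _. 1) (sderiv wt e h)" if e: "e \<in> Basis" for e
  proof (rule Suc.IH)
    fix t p assume t: "t \<in> T"
    have der: "((\<lambda>q. h t q + s t *\<^sub>R (\<Sum>b\<in>Basis. (h t q \<bullet> b) *\<^sub>R K b t q)) has_derivative
      (\<lambda>y. dir_deriv y (h t) p + s t *\<^sub>R (\<Sum>b\<in>Basis. (h t p \<bullet> b) *\<^sub>R dir_deriv y (K b t) p + (dir_deriv y (h t) p \<bullet> b) *\<^sub>R K b t p))) (at p)"
      by (intro has_derivative_add has_derivative_scaleR_right has_derivative_sum has_derivative_scaleR
          has_derivative_inner_left has_derivative_dir_deriv diff[OF t] diffK[OF t])
    have "dir_deriv e (r t) p = dir_deriv e (h t) p + s t *\<^sub>R (\<Sum>b\<in>Basis. (h t p \<bullet> b) *\<^sub>R dir_deriv e (K b t) p + (dir_deriv e (h t) p \<bullet> b) *\<^sub>R K b t p)"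
      using dir_deriv_eq[OF der, of e] Suc.prems(1)[OF t] by simp
    then show "sderiv wt e h t p + s t *\<^sub>R (\<Sum>b\<in>Basis. (sderiv wt e h t p \<bullet> b) *\<^sub>R K b t p) =
      sderiv wt e r t p + (- s t) *\<^sub>R (\<Sum>b\<in>Basis. (h t p \<bullet> b) *\<^sub>R sderiv wt e (K b) t p)"
      by (simp add: sderiv_def algebra_simps sum.distrib scaleR_sum_right sum_negf)
  next
    show "symbol_k k wt (\<lambda>_ _. 1) (K b)" if "b \<in> Basis" for b
      using Suc.prems(2)[OF that] by (rule symbol_k_SucD)
    have K_term: "symbol_k k wt (\<lambda>_ _. 1) (\<lambda>t p. (h t p \<bullet> b) *\<^sub>R sderiv wt e (K b) t p)" if "b \<in> Basis" for b
      using symbol_k_bounded_bilinear[OF bounded_bilinear_scaleR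
          symbol_k_bounded_linear[OF bounded_linear_inner_left hk] symbol_k_sderiv[OF Suc.prems(2)[OF that] e]]
      by simp
    show "symbol_k k wt (\<lambda>_ _. 1) (\<lambda>t p. sderiv wt e r t p + (- s t) *\<^sub>R (\<Sum>b\<in>Basis. (h t p \<bullet> b) *\<^sub>R sderiv wt e (K b) t p))"
    proof (intro symbol_k_add symbol_k_sderiv[OF Suc.prems(3) e] symbol_k_scaleR_le[OF symbol_k_sum[OF finite_Basis K_term]])
      show "\<bar>S\<bar> + 1 > 0" by simp
      show "\<bar>- s t\<bar> * 1 \<le> (\<bar>S\<bar> + 1) * 1" if "t \<in> T" for t using s[OF that] by simp
    qed auto
  qed
  then show ?case using diff symbol_k_dominated[OF hk] by simp
qed

text \<open>The class \<open>V_class\<close> bounds mixed partial derivatives in one fixed order only; this is where their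
  commutation is needed.\<close>

lemma symbol_V_class:
  fixes V :: "real ^ 'n::finite \<Rightarrow> real"
  assumes a: "a \<in> V_class V \<nu> \<delta>"
  shows "symbol (\<lambda>b. if fst b = 0 then 1/2 else 0)
    (\<lambda>t (x, v). t powr \<nu> * (1 + norm ((t powr (1/2)) *\<^sub>R v) + norm ((t powr (3/2)) *\<^sub>R grad V x)) powr \<delta>) a"
proof -
  let ?wt = "\<lambda>b :: 'n phase_space. if fst b = 0 then 1/2 else 0 :: real"
  define M where "M \<mu> t z = t powr \<mu> * (1 + norm ((t powr (1/2)) *\<^sub>R snd z) + norm ((t powr (3/2)) *\<^sub>R grad V (fst z))) powr \<delta>"
    for \<mu> t and z :: "'n phase_space"
  have smooth: "C_inf (a t)" if "t \<in> T" for t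
    using a that T by (auto simp: V_class_def)
  have dom: "dominated (M (\<nu> + real (mord \<beta>) / 2)) (\<lambda>t. partial_xv \<alpha> \<beta> (a t))" for \<alpha> \<beta>
  proof -
    obtain C where "C > 0" "\<And>t x v. t \<in> {0<..<1} \<Longrightarrow> norm (partial_xv \<alpha> \<beta> (a t) (x, v)) \<le>
        C * t powr (\<nu> + real (mord \<beta>) / 2) *
        (1 + norm ((t powr (1/2)) *\<^sub>R v) + norm ((t powr (3/2)) *\<^sub>R grad V x)) powr \<delta>"
      using a unfolding V_class_def by blast
    then show ?thesis
      unfolding dominated_def M_def using T by (intro exI[of _ C]) (force simp: mult.assoc)
  qed
  \<comment> \<open>All partial derivatives are treated at once, so that each further derivative is
    again covered by the induction hypothesis.\<close>
  have "symbol_k k ?wt (M (\<nu> + real (mord \<beta>) / 2)) (\<lambda>t. partial_xv \<alpha> \<beta> (a t))" for k \<alpha> \<beta>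
  proof (induction k arbitrary: \<alpha> \<beta>)
    case 0
    then show ?case using dom by simp
  next
    case (Suc k)
    have smooth': "C_inf (partial_xv \<alpha> \<beta> (a t))" if "t \<in> T" for t
      unfolding partial_xv_def by (intro C_inf_mpartial smooth that)
    have "symbol_k k ?wt (M (\<nu> + real (mord \<beta>) / 2)) (sderiv ?wt b (\<lambda>t. partial_xv \<alpha> \<beta> (a t)))"
      if b: "b \<in> Basis" for b
    proof -
      consider i where "b = (axis i 1, 0)" | i where "b = (0, axis i 1)"
        using b unfolding Basis_prod_def Basis_vec_def by fastforce
      then show ?thesis
      proof cases
        case 1
        have "sderiv ?wt b (\<lambda>t. partial_xv \<alpha> \<beta> (a t)) t = partial_xv (\<alpha> + axis i 1) \<beta> (a t)" if "t \<in> T" for t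
          using that T by (auto simp: sderiv_def 1 partial_xv_def mpartial_add_axis[OF C_inf_mpartial[OF smooth[OF that]]] simp del: One_nat_def)
        then show ?thesis by (intro symbol_k_congI[OF Suc.IH]) auto
      next
        case 2
        \<comment> \<open>The new v-derivative stands outside the x-derivatives and has to be
          commuted inwards to raise \<beta>; an x-derivative is already in place.\<close>
        have eq: "sderiv ?wt b (\<lambda>t. partial_xv \<alpha> \<beta> (a t)) t = (\<lambda>p. t powr (- 1/2) *\<^sub>R partial_xv \<alpha> (\<beta> + axis i 1) (a t) p)"
          if "t \<in> T" for t
          using that T by (auto simp: sderiv_def 2 partial_xv_def mpartial_add_axis[OF smooth[OF that]]
              dir_deriv_mpartial_commute[OF C_inf_mpartial[OF smooth[OF that]]] simp del: One_nat_def)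
        \<comment> \<open>The gain t^(1/2) that the class grants to a v-derivative cancels the
          rescaling exactly.\<close>
        have M: "\<bar>t powr (- 1/2)\<bar> * M (\<nu> + real (mord (\<beta> + axis i 1)) / 2) t z = M (\<nu> + real (mord \<beta>) / 2) t z" for t z
        proof -
          have "- 1/2 + (\<nu> + real (mord (\<beta> + axis i 1)) / 2) = \<nu> + real (mord \<beta>) / 2"
            by (simp add: mord_add add_divide_distrib del: One_nat_def)
          then have "\<bar>t powr (- 1/2)\<bar> * t powr (\<nu> + real (mord (\<beta> + axis i 1)) / 2) = t powr (\<nu> + real (mord \<beta>) / 2)"
            by (metis abs_of_nonneg powr_add powr_ge_zero)
          then show ?thesis unfolding M_def mult.assoc[symmetric] by (simp only:)
        qed
        have "symbol_k k ?wt (M (\<nu> + real (mord \<beta>) / 2)) (\<lambda>t p. t powr (- 1/2) *\<^sub>R partial_xv \<alpha> (\<beta> + axis i 1) (a t) p)"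
          by (rule symbol_k_scaleR_le[OF Suc.IH, where C = 1]) (rule zero_less_one, simp only: M mult_1 order_refl)
        then show ?thesis by (rule symbol_k_congI[OF _ eq])
      qed
    qed
    then show ?case using dom C_inf_differentiable[OF smooth'] by simp
  qed
  from this[of _ 0 0] have "symbol ?wt (M \<nu>) a"
    by (simp add: symbol_def partial_xv_def)
  then show ?thesis
    by (rule symbol_cong) (auto simp: M_def)
qed

end

section \<open>The inverse of the flow map\<close>

text \<open>A closed set of full Lebesgue measure is the whole space, so an essential bound on a
  continuous function holds everywhere.\<close>

lemma L_inf_continuous_imp_bounded:
  assumes "L_inf f" "continuous_on UNIV f"
  obtains C where "\<And>x. \<bar>f x\<bar> \<le> C"
proof -
  obtain C where "AE x in lebesgue. \<bar>f x\<bar> \<le> C" using assms(1) by (auto simp: L_inf_def)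
  moreover have "closed {x. \<bar>f x\<bar> \<le> C}"
    using assms(2) by (intro closed_Collect_le continuous_intros) auto
  ultimately have "\<bar>f x\<bar> \<le> C" for x
    using mem_closed_if_AE_lebesgue[of "{x. \<bar>f x\<bar> \<le> C}" x] by simp
  then show ?thesis by (rule that)
qed

lemma grad_eq_sum: "grad V x = (\<Sum>i\<in>UNIV. dir_deriv (axis i 1) V x *\<^sub>R axis i 1)"
  by (simp add: grad_def vec_eq_iff axis_def if_distrib cong: if_cong)

lemma partial_n_add_axis:
  fixes V :: "real ^ 'n::finite \<Rightarrow> 'b::euclidean_space"
  shows "C_inf V \<Longrightarrow> partial_n (\<alpha> + axis i 1) V = dir_deriv (axis i 1) (partial_n \<alpha> V)"
  unfolding partial_n_def by (rule mpartial_add_axis)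

lemma dir_deriv_axis_eq_partial_n:
  fixes V :: "real ^ 'n::finite \<Rightarrow> 'b::euclidean_space"
  shows "C_inf V \<Longrightarrow> dir_deriv (axis i 1) V = partial_n (axis i 1) V"
  using partial_n_add_axis[of V 0 i] by (simp add: partial_n_def)

lemma has_derivative_grad:
  fixes V :: "real ^ 'n::finite \<Rightarrow> real"
  assumes V: "C_inf V"
  shows "(grad V has_derivative (\<lambda>h. \<Sum>i\<in>UNIV. dir_deriv h (dir_deriv (axis i 1) V) x *\<^sub>R axis i 1)) (at x)"
  unfolding grad_eq_sum[abs_def]
  by (intro has_derivative_sum has_derivative_scaleR_left has_derivative_dir_deriv
      C_inf_differentiable C_inf_dir_deriv V)

lemma dir_deriv_grad:
  fixes V :: "real ^ 'n::finite \<Rightarrow> real"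
  assumes V: "C_inf V"
  shows "dir_deriv (axis j 1) (grad V) x = (\<Sum>i\<in>UNIV. partial_n (axis i 1 + axis j 1) V x *\<^sub>R axis i 1)"
  unfolding dir_deriv_eq[OF has_derivative_grad[OF V]] partial_n_add_axis[OF V] dir_deriv_axis_eq_partial_n[OF V] ..

text \<open>The derivatives of \<open>grad V\<close> are built from partial derivatives of V of
  order at least 2, a family that is bounded by hypothesis and stable under further differentiation.
  The scale is 0 since nothing depends on t.\<close>

lemma (in symbol_times) bounded_sderivs_grad:
  fixes V :: "real ^ 'n::finite \<Rightarrow> real"
  assumes V: "C_inf V" and bd: "\<And>\<alpha> :: 'n mindex. mord \<alpha> \<ge> 2 \<Longrightarrow> \<exists>C. \<forall>x. \<bar>partial_n \<alpha> V x\<bar> \<le> C"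
  shows "bounded_sderivs k (\<lambda>_. 0) (\<lambda>t. grad V)"
proof -
  have S: "symbol_k k (\<lambda>_. 0) (\<lambda>_ _. 1) (\<lambda>t. partial_n \<alpha> V)" if "mord \<alpha> \<ge> 2" for k \<alpha>
    using that
  proof (induction k arbitrary: \<alpha>)
    case 0
    obtain C where C: "\<And>x. \<bar>partial_n \<alpha> V x\<bar> \<le> C" using bd[OF 0] by blast
    have "\<bar>partial_n \<alpha> V x\<bar> \<le> \<bar>C\<bar> + 1" for x using C[of x] by linarith
    then show ?case unfolding symbol_k.simps dominated_def by (intro exI[of _ "\<bar>C\<bar> + 1"]) auto
  next
    case (Suc k)
    obtain C where C: "\<And>x. \<bar>partial_n \<alpha> V x\<bar> \<le> C" using bd[OF Suc.prems] by blast
    have C': "\<bar>partial_n \<alpha> V x\<bar> \<le> \<bar>C\<bar> + 1" for x using C[of x] by linarith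
    have "symbol_k k (\<lambda>_. 0) (\<lambda>_ _. 1) (sderiv (\<lambda>_. 0) b (\<lambda>t. partial_n \<alpha> V))" if b: "b \<in> Basis" for b
    proof -
      obtain i where i: "b = axis i 1" using b by (auto simp: Basis_vec_def)
      have "sderiv (\<lambda>_. 0) b (\<lambda>t. partial_n \<alpha> V) t = partial_n (\<alpha> + axis i 1) V" if "t \<in> T" for t
        using that T unfolding i partial_n_add_axis[OF V] by (auto simp: sderiv_def)
      then show ?thesis using Suc by (intro symbol_k_congI[OF Suc.IH]) (auto simp: mord_add)
    qed
    moreover have "dominated (\<lambda>_ _. 1) (\<lambda>t. partial_n \<alpha> V)"
      unfolding dominated_def using C' by (intro exI[of _ "\<bar>C\<bar> + 1"]) auto
    moreover have "partial_n \<alpha> V differentiable (at x)" for x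
      unfolding partial_n_def by (intro C_inf_differentiable C_inf_mpartial V)
    ultimately show ?case by simp
  qed
  have "symbol_k k (\<lambda>_. 0) (\<lambda>_ _. 1) (sderiv (\<lambda>_. 0) b (\<lambda>t. grad V))" if b: "b \<in> Basis" for b
  proof -
    obtain j where j: "b = axis j 1" using b by (auto simp: Basis_vec_def)
    have "sderiv (\<lambda>_. 0) b (\<lambda>t. grad V) t = (\<lambda>x. \<Sum>i\<in>UNIV. partial_n (axis i 1 + axis j 1) V x *\<^sub>R axis i 1)" if "t \<in> T" for t
      using that T by (auto simp: sderiv_def j dir_deriv_grad[OF V] simp del: One_nat_def)
    moreover have "symbol_k k (\<lambda>_. 0) (\<lambda>_ _. 1) (\<lambda>t x. \<Sum>i\<in>UNIV. partial_n (axis i 1 + axis j 1) V x *\<^sub>R axis i 1)"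
      by (intro symbol_k_sum symbol_k_bounded_linear[OF bounded_linear_scaleR_left] S) (auto simp: mord_add simp del: One_nat_def)
    ultimately show ?thesis by (rule symbol_k_congI[rotated])
  qed
  then show ?thesis
    using has_derivative_grad[OF V] by (auto simp: bounded_sderivs_def differentiable_def)
qed

section \<open>The shear y + t^2/(2m) \<nabla>V(y) and its inverse\<close>

locale phase_flow = symbol_times T for T +
  fixes V :: "real ^ 'n::finite \<Rightarrow> real" and m L :: real
  assumes m: "m > 0" and L: "L > 0" and smooth_V: "C_inf V"
    and grad_sderivs: "\<And>k. bounded_sderivs k (\<lambda>_. 0) (\<lambda>t. grad V)"
    and hess_bound: "\<And>x h. norm (dir_deriv h (grad V) x) \<le> L * norm h"
    and T_small: "\<And>t. t \<in> T \<Longrightarrow> t\<^sup>2 / (2 * m) * L \<le> 1 / 2"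
begin

lemma differentiable_grad: "grad V differentiable (at x)"
  using has_derivative_grad[OF smooth_V] by (auto simp: differentiable_def)

lemma grad_lipschitz: "norm (grad V x - grad V y) \<le> L * norm (x - y)"
proof (rule differentiable_bound[where S = UNIV])
  show "(grad V has_derivative (\<lambda>h. dir_deriv h (grad V) x)) (at x within UNIV)" for x
    by (intro has_derivative_dir_deriv differentiable_grad)
  show "onorm (\<lambda>h. dir_deriv h (grad V) x) \<le> L" for x
    by (rule onorm_le) (rule hess_bound)
qed auto

definition \<sigma> :: "real \<Rightarrow> real" where "\<sigma> t = t\<^sup>2 / (2 * m)"

lemma \<sigma>_nonneg: "\<sigma> t \<ge> 0"
  using m by (simp add: \<sigma>_def)

lemma \<sigma>_small: "t \<in> T \<Longrightarrow> \<sigma> t * L \<le> 1 / 2"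
  using T_small by (simp add: \<sigma>_def)

lemma \<sigma>_le: "t \<in> T \<Longrightarrow> \<bar>\<sigma> t\<bar> \<le> 1 / (2 * m)"
  using T m by (auto simp: \<sigma>_def divide_right_mono power_le_one)

definition shear_inv :: "real \<Rightarrow> real ^ 'n \<Rightarrow> real ^ 'n" where
  "shear_inv t p = (THE y. y + \<sigma> t *\<^sub>R grad V y = p)"

text \<open>The perturbation has Lipschitz constant at most 1/2, so the triangle inequality leaves
  at least half of the distance. This gives injectivity of the shear and the Lipschitz constant 2 of
  its inverse.\<close>

lemma shear_expanding: "norm (y - z) \<le> 2 * norm ((y + \<sigma> t *\<^sub>R grad V y) - (z + \<sigma> t *\<^sub>R grad V z))" if "t \<in> T"
proof -
  have "norm (\<sigma> t *\<^sub>R (grad V y - grad V z)) \<le> \<sigma> t * (L * norm (y - z))"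
    using \<sigma>_nonneg[of t] grad_lipschitz[of y z] by (simp add: mult_left_mono)
  also have "\<dots> \<le> 1 / 2 * norm (y - z)"
    unfolding mult.assoc[symmetric] by (rule mult_right_mono[OF \<sigma>_small[OF that]]) simp
  finally have *: "norm (\<sigma> t *\<^sub>R (grad V y - grad V z)) \<le> 1 / 2 * norm (y - z)" .
  have eq: "(y + \<sigma> t *\<^sub>R grad V y) - (z + \<sigma> t *\<^sub>R grad V z) = (y - z) + \<sigma> t *\<^sub>R (grad V y - grad V z)"
    by (simp add: algebra_simps)
  show ?thesis
    unfolding eq using * norm_diff_ineq[of "y - z" "\<sigma> t *\<^sub>R (grad V y - grad V z)"] by linarith
qed

lemma shear_eq_iff: "t \<in> T \<Longrightarrow> y + \<sigma> t *\<^sub>R grad V y = z + \<sigma> t *\<^sub>R grad V z \<longleftrightarrow> y = z"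
  using shear_expanding[of t y z] by fastforce

text \<open>The preimages of p are the fixed points of the map that sends y to p - \<sigma>(t)
  \<nabla>V(y), which contracts by 1/2.\<close>

lemma shear_inv: "shear_inv t p + \<sigma> t *\<^sub>R grad V (shear_inv t p) = p" if "t \<in> T"
proof -
  have "\<exists>!y. p - \<sigma> t *\<^sub>R grad V y = y"
  proof (rule banach_fix_type)
    show "\<forall>y z. dist (p - \<sigma> t *\<^sub>R grad V y) (p - \<sigma> t *\<^sub>R grad V z) \<le> 1 / 2 * dist y z"
    proof (intro allI)
      fix y z
      have "dist (p - \<sigma> t *\<^sub>R grad V y) (p - \<sigma> t *\<^sub>R grad V z) = \<sigma> t * norm (grad V y - grad V z)"
        using \<sigma>_nonneg[of t] by (simp add: dist_norm norm_minus_commute flip: scaleR_diff_right)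
      also have "\<dots> \<le> \<sigma> t * (L * norm (y - z))"
        using \<sigma>_nonneg[of t] grad_lipschitz[of y z] by (simp add: mult_left_mono)
      also have "\<dots> \<le> 1 / 2 * norm (y - z)"
        unfolding mult.assoc[symmetric] by (rule mult_right_mono[OF \<sigma>_small[OF that]]) simp
      finally show "dist (p - \<sigma> t *\<^sub>R grad V y) (p - \<sigma> t *\<^sub>R grad V z) \<le> 1 / 2 * dist y z"
        by (simp add: dist_norm)
    qed
  qed auto
  then obtain y where y: "y + \<sigma> t *\<^sub>R grad V y = p" by (metis diff_add_cancel)
  then have "shear_inv t p = y"
    unfolding shear_inv_def using shear_eq_iff[OF that] by (intro the_equality) auto
  then show ?thesis using y by simp
qed

lemma shear_inv_shear: "shear_inv t (y + \<sigma> t *\<^sub>R grad V y) = y" if "t \<in> T"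
  using shear_inv[OF that, of "y + \<sigma> t *\<^sub>R grad V y"] by (simp add: shear_eq_iff[OF that])

text \<open>This is the form in which \<open>symbol_k_linear_equation\<close> expects smallness,
  with the derivative of \<open>grad V\<close> written out in the basis.\<close>

lemma hess_small: "norm (\<sigma> t *\<^sub>R (\<Sum>b\<in>Basis. (h \<bullet> b) *\<^sub>R dir_deriv b (grad V) x)) \<le> norm h / 2" if "t \<in> T"
proof -
  have "norm (\<sigma> t *\<^sub>R dir_deriv h (grad V) x) \<le> \<sigma> t * (L * norm h)"
    using \<sigma>_nonneg[of t] hess_bound[of h x] by (simp add: mult_left_mono)
  also have "\<dots> \<le> 1 / 2 * norm h"
    unfolding mult.assoc[symmetric] by (rule mult_right_mono[OF \<sigma>_small[OF that]]) simp
  finally show ?thesis by (simp add: dir_deriv_expand[OF differentiable_grad, of h])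
qed

text \<open>The derivative A of the shear is bounded below, hence injective and left invertible.
  Together with the continuity of the inverse, which comes from its Lipschitz bound, this gives
  differentiability of the inverse at each point.\<close>

lemma differentiable_shear_inv: "shear_inv t differentiable (at p)" if t: "t \<in> T"
proof -
  define A where "A h = h + \<sigma> t *\<^sub>R dir_deriv h (grad V) (shear_inv t p)" for h
  have der: "((\<lambda>y. y + \<sigma> t *\<^sub>R grad V y) has_derivative A) (at (shear_inv t p))"
    unfolding A_def by (intro has_derivative_add has_derivative_ident has_derivative_scaleR_right
        has_derivative_dir_deriv differentiable_grad)
  have lower: "norm h \<le> 2 * norm (A h)" for h
    using hess_small[OF t, of h "shear_inv t p"] norm_diff_ineq[of h "\<sigma> t *\<^sub>R dir_deriv h (grad V) (shear_inv t p)"]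
    by (simp add: A_def dir_deriv_expand[OF differentiable_grad, of h])
  have lin: "linear A" using der by (rule has_derivative_linear)
  have "inj A"
    unfolding linear_injective_0[OF lin] using lower by (metis norm_le_zero_iff norm_zero mult_zero_right)
  then obtain A' where A': "linear A'" "A' \<circ> A = id"
    using linear_injective_left_inverse[OF lin] by blast
  have "2-lipschitz_on UNIV (shear_inv t)"
    using shear_expanding[OF t, of "shear_inv t _" "shear_inv t _"]
    by (intro lipschitz_onI) (auto simp: shear_inv[OF t] dist_norm)
  then have cont: "continuous (at p) (shear_inv t)"
    using lipschitz_on_continuous_on continuous_on_eq_continuous_at by blast
  have "(shear_inv t has_derivative A') (at p)"
  proof (rule has_derivative_inverse_basic[where f = "\<lambda>y. y + \<sigma> t *\<^sub>R grad V y" and f' = A and T = UNIV])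
    show "bounded_linear A'" using A'(1) by (simp add: linear_conv_bounded_linear)
    show "shear_inv t z + \<sigma> t *\<^sub>R grad V (shear_inv t z) = z" for z by (rule shear_inv[OF t])
  qed (rule der A' cont open_UNIV UNIV_I)+
  then show ?thesis by (auto simp: differentiable_def)
qed

text \<open>Differentiating the equation that defines \<open>shear_inv\<close> gives a linear
  equation for its first derivatives, with the Hessian of V at \<open>shear_inv t p\<close> as
  coefficient and a constant vector on the right. Controlling k derivatives of this coefficient
  takes derivatives of \<open>shear_inv\<close> of total order at most k, one less than what is
  being proved.\<close>

lemma shear_inv_sderivs: "bounded_sderivs k (\<lambda>_. 0) shear_inv"
proof -
  have "\<forall>e\<in>Basis. symbol_k k (\<lambda>_. 0) (\<lambda>_ _. 1) (sderiv (\<lambda>_. 0) e shear_inv)" for k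
  proof (induction k rule: less_induct)
    case (less k)
    have bd: "bounded_sderivs j (\<lambda>_. 0) (\<lambda>t p. t powr 0 *\<^sub>R (shear_inv t p \<bullet> b))" if "k = Suc j" for j b
    proof (rule bounded_sderivs_scaleR[where C = 1])
      have "bounded_sderivs j (\<lambda>_. 0) shear_inv"
        using less.IH[of j] that differentiable_shear_inv unfolding bounded_sderivs_def by simp
      from bounded_sderivs_bounded_linear[OF bounded_linear_inner_left this]
      show "bounded_sderivs j (\<lambda>_. 0) (\<lambda>t p. shear_inv t p \<bullet> b)" .
    qed (use T in auto)
    have K: "symbol_k k (\<lambda>_. 0) (\<lambda>_ _. 1) (\<lambda>t p. sderiv (\<lambda>_. 0) b (\<lambda>t. grad V) t (shear_inv t p))" if "b \<in> Basis" for b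
    proof (rule symbol_k_compose[where M = "\<lambda>_ _. 1" and wt = "\<lambda>_. 0" and \<Phi> = shear_inv, OF _ bd])
      show "symbol_k k (\<lambda>_. 0) (\<lambda>_ _. 1) (sderiv (\<lambda>_. 0) b (\<lambda>t. grad V))"
        using grad_sderivs[of k] that unfolding bounded_sderivs_def by blast
    qed
    show ?case
    proof (rule ballI, rule symbol_k_linear_equation[where s = \<sigma> and S = "1 / (2 * m)" and
          K = "\<lambda>b t p. sderiv (\<lambda>_. 0) b (\<lambda>t. grad V) t (shear_inv t p)"])
      fix e :: "real ^ 'n" and t p assume t: "t \<in> T"
      have t0: "t > 0" using t T by auto
      have gb: "((\<lambda>p. grad V (shear_inv t p)) has_derivative (\<lambda>h. dir_deriv (dir_deriv h (shear_inv t) p) (grad V) (shear_inv t p))) (at p)"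
        by (rule has_derivative_compose[OF has_derivative_dir_deriv[OF differentiable_shear_inv[OF t]] has_derivative_dir_deriv[OF differentiable_grad]])
      have "((\<lambda>p. shear_inv t p + \<sigma> t *\<^sub>R grad V (shear_inv t p)) has_derivative
          (\<lambda>h. dir_deriv h (shear_inv t) p + \<sigma> t *\<^sub>R dir_deriv (dir_deriv h (shear_inv t) p) (grad V) (shear_inv t p))) (at p)"
        by (rule has_derivative_add[OF has_derivative_dir_deriv[OF differentiable_shear_inv[OF t]] has_derivative_scaleR_right[OF gb]])
      then have "dir_deriv e (\<lambda>p. p) p = dir_deriv e (shear_inv t) p + \<sigma> t *\<^sub>R dir_deriv (dir_deriv e (shear_inv t) p) (grad V) (shear_inv t p)"
        unfolding shear_inv[OF t] by (rule dir_deriv_eq)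
      then have "dir_deriv e (shear_inv t) p + \<sigma> t *\<^sub>R dir_deriv (dir_deriv e (shear_inv t) p) (grad V) (shear_inv t p) = e"
        unfolding dir_deriv_eq[OF has_derivative_ident] by (rule sym)
      then show "sderiv (\<lambda>_. 0) e shear_inv t p + \<sigma> t *\<^sub>R (\<Sum>b\<in>Basis. (sderiv (\<lambda>_. 0) e shear_inv t p \<bullet> b) *\<^sub>R sderiv (\<lambda>_. 0) b (\<lambda>t. grad V) t (shear_inv t p)) = e"
        using t0 unfolding dir_deriv_expand[OF differentiable_grad, of "dir_deriv e (shear_inv t) p"] sderiv_def by simp
    next
      fix t p and y :: "real ^ 'n" assume t: "t \<in> T"
      show "norm (\<sigma> t *\<^sub>R (\<Sum>b\<in>Basis. (y \<bullet> b) *\<^sub>R sderiv (\<lambda>_. 0) b (\<lambda>t. grad V) t (shear_inv t p))) \<le> norm y / 2"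
        using hess_small[OF t, of y "shear_inv t p"] t T by (auto simp: sderiv_def)
    next
      fix e :: "real ^ 'n"
      show "symbol_k k (\<lambda>_. 0) (\<lambda>_ _. 1) (\<lambda>t (p :: real ^ 'n). e)"
        unfolding dominated_def
        by (intro symbol_k_param[unfolded dominated_def] exI[of _ "norm e + 1"]) (simp add: add_nonneg_pos)
    qed (rule \<sigma>_le K; assumption)+
  qed
  then show ?thesis using differentiable_shear_inv unfolding bounded_sderivs_def by blast
qed

end

lemma (in symbol_times) bounded_sderivs_cong:
  fixes f g :: "real \<Rightarrow> 'a::euclidean_space \<Rightarrow> 'b::real_normed_vector"
  assumes f: "bounded_sderivs k wt f" and eq: "\<And>t. t \<in> T \<Longrightarrow> g t = f t"
  shows "bounded_sderivs k wt g"
  unfolding bounded_sderivs_def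
proof (intro conjI ballI allI)
  fix t p assume "t \<in> T"
  then show "g t differentiable (at p)"
    using f unfolding eq[OF \<open>t \<in> T\<close>] bounded_sderivs_def by blast
next
  fix b :: 'a assume "b \<in> Basis"
  then have "symbol_k k wt (\<lambda>_ _. 1) (sderiv wt b f)"
    using f unfolding bounded_sderivs_def by blast
  then show "symbol_k k wt (\<lambda>_ _. 1) (sderiv wt b g)"
    by (rule symbol_k_congI) (simp add: sderiv_def eq)
qed

text \<open>The scales \<open>t^0, t^(1/2), t^(3/2), t^(1/2)\<close> of the variables \<open>x, v, \<xi>, \<eta>\<close>.\<close>

definition phase_wt :: "'n::finite phase_space \<times> 'n phase_space \<Rightarrow> real" where
  "phase_wt b = (if fst (fst b) \<noteq> 0 then 0 else if snd (fst b) \<noteq> 0 then 1/2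
     else if fst (snd b) \<noteq> 0 then 3/2 else 1/2)"

lemma diff_diff_double: "a - (b - (u + u)) - u = (a + u) - b" for a b u :: "'a::ab_group_add"
  by (simp add: algebra_simps)

lemma phase_wt_le: "phase_wt b \<le> 3/2"
  by (simp add: phase_wt_def)

lemma Basis_phase_cases:
  fixes b :: "'n::finite phase_space"
  assumes "b \<in> Basis"
  obtains (x) i where "b = (axis i 1, 0)" | (v) i where "b = (0, axis i 1)"
proof -
  have "(\<exists>i. b = (axis i 1, 0)) \<or> (\<exists>i. b = (0, axis i 1))"
    using assms by (auto simp: Basis_prod_def Basis_vec_def)
  then show thesis using x v by blast
qed

lemma Basis_phase2_cases:
  fixes b :: "'n::finite phase_space \<times> 'n phase_space"
  assumes "b \<in> Basis"
  obtains (x) i where "b = ((axis i 1, 0), (0, 0))" | (v) i where "b = ((0, axis i 1), (0, 0))"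
    | (\<xi>) i where "b = ((0, 0), (axis i 1, 0))" | (\<eta>) i where "b = ((0, 0), (0, axis i 1))"
proof -
  have "(\<exists>u\<in>Basis. b = (u, (0, 0))) \<or> (\<exists>u\<in>Basis. b = ((0, 0), u))"
    using assms unfolding Basis_prod_def[where ?'a = "'n phase_space"] zero_prod_def by blast
  then show thesis
  proof (elim disjE bexE)
    fix u :: "'n phase_space" assume "u \<in> Basis" and b: "b = (u, (0, 0))"
    from this(1) show thesis
      by (cases rule: Basis_phase_cases) (use x v b in simp_all)
  next
    fix u :: "'n phase_space" assume "u \<in> Basis" and b: "b = ((0, 0), u)"
    from this(1) show thesis
      by (cases rule: Basis_phase_cases) (use \<xi> \<eta> b in simp_all)
  qed
qed

lemma bounded_linear_phase:
  "bounded_linear (\<lambda>p. fst (fst p))" "bounded_linear (\<lambda>p. snd (fst p))"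
  "bounded_linear (\<lambda>p. fst (snd p))" "bounded_linear (\<lambda>p. snd (snd p))"
  subgoal by (rule bounded_linear_compose[of fst fst, OF bounded_linear_fst bounded_linear_fst])
  subgoal by (rule bounded_linear_compose[of snd fst, OF bounded_linear_snd bounded_linear_fst])
  subgoal by (rule bounded_linear_compose[of fst snd, OF bounded_linear_fst bounded_linear_snd])
  subgoal by (rule bounded_linear_compose[of snd snd, OF bounded_linear_snd bounded_linear_snd])
  done

lemma bounded_linear_phase_inner:
  "bounded_linear (\<lambda>p. fst (fst p) \<bullet> b)" "bounded_linear (\<lambda>p. snd (fst p) \<bullet> b)"
  "bounded_linear (\<lambda>p. fst (snd p) \<bullet> b)" "bounded_linear (\<lambda>p. snd (snd p) \<bullet> b)"
  subgoal by (rule bounded_linear_compose[of "\<lambda>x. x \<bullet> b" "\<lambda>p. fst (fst p)", OF bounded_linear_inner_left bounded_linear_phase(1)])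
  subgoal by (rule bounded_linear_compose[of "\<lambda>x. x \<bullet> b" "\<lambda>p. snd (fst p)", OF bounded_linear_inner_left bounded_linear_phase(2)])
  subgoal by (rule bounded_linear_compose[of "\<lambda>x. x \<bullet> b" "\<lambda>p. fst (snd p)", OF bounded_linear_inner_left bounded_linear_phase(3)])
  subgoal by (rule bounded_linear_compose[of "\<lambda>x. x \<bullet> b" "\<lambda>p. snd (snd p)", OF bounded_linear_inner_left bounded_linear_phase(4)])
  done

section \<open>The inverse flow map in the scaled variables\<close>

context phase_flow
begin

definition F_inv_x :: "real \<Rightarrow> 'n phase_space \<Rightarrow> real ^ 'n" where
  "F_inv_x t z = shear_inv t (fst z + t *\<^sub>R snd z)"

definition F_inv :: "real \<Rightarrow> 'n phase_space \<Rightarrow> 'n phase_space" where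
  "F_inv t z = (F_inv_x t z, snd z - (t / m) *\<^sub>R grad V (F_inv_x t z))"

lemma F_inv_F_map: "F_inv t (F_map V m t z) = z" if t: "t \<in> T"
proof -
  obtain x v where z: "z = (x, v)" by (cases z)
  have "t * (t / m) = t\<^sup>2 / (2 * m) + t\<^sup>2 / (2 * m)"
    using m by (simp add: field_simps power2_eq_square)
  then have "(t * (t / m)) *\<^sub>R grad V x = (t\<^sup>2 / (2 * m)) *\<^sub>R grad V x + (t\<^sup>2 / (2 * m)) *\<^sub>R grad V x"
    by (metis scaleR_left_distrib)
  then have "fst (F_map V m t z) + t *\<^sub>R snd (F_map V m t z) = x + \<sigma> t *\<^sub>R grad V x"
    by (simp add: F_map_def z \<sigma>_def scaleR_add_right)
  then have "F_inv_x t (F_map V m t z) = x"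
    by (simp add: F_inv_x_def shear_inv_shear[OF t])
  then show ?thesis by (simp add: F_inv_def F_map_def z)
qed

lemma F_map_F_inv: "F_map V m t (F_inv t z) = z" if t: "t \<in> T"
proof -
  obtain x v where z: "z = (x, v)" by (cases z)
  define y where "y = F_inv_x t z"
  have y: "y + \<sigma> t *\<^sub>R grad V y = x + t *\<^sub>R v"
    using shear_inv[OF t, of "x + t *\<^sub>R v"] by (simp add: y_def F_inv_x_def z)
  have "t * (t / m) = t\<^sup>2 / (2 * m) + t\<^sup>2 / (2 * m)"
    using m by (simp add: field_simps power2_eq_square)
  then have "(t * (t / m)) *\<^sub>R grad V y = \<sigma> t *\<^sub>R grad V y + \<sigma> t *\<^sub>R grad V y"
    unfolding \<sigma>_def by (metis scaleR_left_distrib)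
  then have "t *\<^sub>R (v - (t / m) *\<^sub>R grad V y) = t *\<^sub>R v - (\<sigma> t *\<^sub>R grad V y + \<sigma> t *\<^sub>R grad V y)"
    by (simp add: scaleR_diff_right)
  moreover have "y - (t *\<^sub>R v - (\<sigma> t *\<^sub>R grad V y + \<sigma> t *\<^sub>R grad V y)) - \<sigma> t *\<^sub>R grad V y = x"
    unfolding diff_diff_double y by simp
  ultimately have "y - t *\<^sub>R (v - (t / m) *\<^sub>R grad V y) - (t\<^sup>2 / (2 * m)) *\<^sub>R grad V y = x"
    unfolding \<sigma>_def by simp
  then show ?thesis
    by (simp add: F_inv_def F_map_def z flip: y_def[unfolded z])
qed

text \<open>In x + t v the velocity enters with the factor t, which for t < 1 is below the scale
  t^(1/2) expected of a v-derivative.\<close>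

lemma F_inv_x_sderivs: "bounded_sderivs k phase_wt (\<lambda>t p. F_inv_x t (fst p))"
  unfolding F_inv_x_def
proof (rule bounded_sderivs_compose[OF shear_inv_sderivs])
  fix b :: "real ^ 'n" assume "b \<in> Basis"
  have "bounded_sderivs k phase_wt (\<lambda>t p :: 'n phase_space \<times> 'n phase_space.
      t powr 0 *\<^sub>R (fst (fst p) \<bullet> b) + t powr 1 *\<^sub>R (snd (fst p) \<bullet> b))"
    by (rule bounded_sderivs_add[OF bounded_sderivs_linear[OF bounded_linear_phase_inner(1)]
          bounded_sderivs_linear[OF bounded_linear_phase_inner(2)]])
      (auto simp: phase_wt_def)
  then show "bounded_sderivs k phase_wt (\<lambda>t p :: 'n phase_space \<times> 'n phase_space.
      t powr 0 *\<^sub>R ((fst (fst p) + t *\<^sub>R snd (fst p)) \<bullet> b))"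
    by (rule bounded_sderivs_cong) (use T in \<open>auto simp: inner_add_left\<close>)
qed

lemma grad_F_inv_x_sderivs: "bounded_sderivs k phase_wt (\<lambda>t p. grad V (F_inv_x t (fst p)))"
proof (rule bounded_sderivs_compose[OF grad_sderivs])
  fix b :: "real ^ 'n"
  show "bounded_sderivs k phase_wt (\<lambda>t p. t powr 0 *\<^sub>R (F_inv_x t (fst p) \<bullet> b))"
    by (rule bounded_sderivs_scaleR[OF bounded_sderivs_bounded_linear[OF bounded_linear_inner_left F_inv_x_sderivs], where C = 1])
       (use T in auto)
qed

text \<open>Hypothesis of the composition lemma for the map (z, \<zeta>) to (F_t^(-1) z, \<zeta>),
  with the same scales on both sides. The correction (t/m) \<nabla>V in the velocity component,
  multiplied by the scale t^(1/2) of that component, is a function with bounded rescaled derivatives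
  times a coefficient of size at most 1/m.\<close>

lemma F_inv_sderivs:
  fixes b :: "'n phase_space \<times> 'n phase_space"
  assumes "b \<in> Basis"
  shows "bounded_sderivs k phase_wt (\<lambda>t p. t powr phase_wt b *\<^sub>R ((F_inv t (fst p), snd p) \<bullet> b))"
proof -
  show ?thesis
    using assms
  proof (cases rule: Basis_phase2_cases)
    case (x i)
    have "bounded_sderivs k phase_wt (\<lambda>t p. t powr 0 *\<^sub>R (F_inv_x t (fst p) \<bullet> axis i 1))"
      by (rule bounded_sderivs_scaleR[OF bounded_sderivs_bounded_linear[OF bounded_linear_inner_left F_inv_x_sderivs], where C = 1])
         (use T in auto)
    then show ?thesis by (simp add: x phase_wt_def F_inv_def inner_prod_def)
  next
    case (v i)
    have "bounded_sderivs k phase_wt (\<lambda>t p. t powr (1/2) *\<^sub>R (snd (fst p) \<bullet> axis i 1) +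
        (- (t powr (1/2) * (t / m))) *\<^sub>R (grad V (F_inv_x t (fst p)) \<bullet> axis i 1))"
    proof (rule bounded_sderivs_add[OF bounded_sderivs_linear[OF bounded_linear_phase_inner(2)]
          bounded_sderivs_scaleR[OF bounded_sderivs_bounded_linear[OF bounded_linear_inner_left grad_F_inv_x_sderivs], where C = "1 / m"]])
      fix t assume "t \<in> T"
      then have t: "0 < t" "t < 1" using T by auto
      have "t powr (1/2) * (t / m) \<le> 1 * (1 / m)"
        using t m by (intro mult_mono powr_le1 divide_right_mono) auto
      then show "\<bar>- (t powr (1/2) * (t / m))\<bar> \<le> 1 / m" using t m by simp
    qed (auto simp: phase_wt_def)
    then show ?thesis
      by (rule bounded_sderivs_cong) (auto simp: v phase_wt_def F_inv_def inner_diff_left algebra_simps inner_prod_def)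
  next
    case (\<xi> i)
    have "bounded_sderivs k phase_wt (\<lambda>t p :: 'n phase_space \<times> 'n phase_space. t powr (3/2) *\<^sub>R (fst (snd p) \<bullet> axis i 1))"
      by (intro bounded_sderivs_linear bounded_linear_phase_inner phase_wt_le)
    then show ?thesis by (simp add: \<xi> phase_wt_def inner_prod_def)
  next
    case (\<eta> i)
    have "bounded_sderivs k phase_wt (\<lambda>t p :: 'n phase_space \<times> 'n phase_space. t powr (1/2) *\<^sub>R (snd (snd p) \<bullet> axis i 1))"
    proof (rule bounded_sderivs_linear[OF bounded_linear_phase_inner(4)])
      fix b :: "'n phase_space \<times> 'n phase_space" assume "b \<in> Basis" "snd (snd b) \<bullet> axis i 1 \<noteq> 0"
      then show "phase_wt b \<le> 1/2"
        by (cases rule: Basis_phase2_cases) (auto simp: phase_wt_def)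
    qed
    then show ?thesis by (simp add: \<eta> phase_wt_def inner_prod_def)
  qed
qed

lemma fst_sderivs:
  fixes b :: "'n phase_space"
  assumes "b \<in> Basis"
  shows "bounded_sderivs k phase_wt (\<lambda>t p :: 'n phase_space \<times> 'n phase_space.
    t powr (if fst b = 0 then 1/2 else 0) *\<^sub>R (fst p \<bullet> b))"
proof (rule bounded_sderivs_linear[OF bounded_linear_compose[OF bounded_linear_inner_left bounded_linear_fst]])
  fix e :: "'n phase_space \<times> 'n phase_space" assume "e \<in> Basis" "fst e \<bullet> b \<noteq> 0"
  then show "phase_wt e \<le> (if fst b = 0 then 1/2 else 0)"
    by (cases rule: Basis_phase_cases[OF assms]; cases rule: Basis_phase2_cases[of e])
       (auto simp: phase_wt_def inner_prod_def)
qed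

section \<open>The weight of the final estimate\<close>

definition W :: "real \<Rightarrow> 'n phase_space \<times> 'n phase_space \<Rightarrow> real" where
  "W t p = 1 + norm ((t powr (3/2)) *\<^sub>R grad V (fst (fst p))) + norm ((t powr (1/2)) *\<^sub>R snd (fst p))
              + norm ((t powr (3/2)) *\<^sub>R fst (snd p)) + norm ((t powr (1/2)) *\<^sub>R snd (snd p))"

lemma W_ge_1: "W t p \<ge> 1"
  unfolding W_def by (simp add: add_nonneg_nonneg)

lemma W_pos: "W t p > 0"
  using W_ge_1[of t p] by linarith

lemma symbol_k_W_bilinear:
  assumes "bounded_bilinear B" "symbol_k k phase_wt (\<lambda>t p. W t p powr r) f" "symbol_k k phase_wt (\<lambda>t p. W t p powr s) g"
  shows "symbol_k k phase_wt (\<lambda>t p. W t p powr (r + s)) (\<lambda>t p. B (f t p) (g t p))"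
  using symbol_k_bounded_bilinear[OF assms] by (simp add: powr_add)

lemma symbol_k_W_param:
  fixes c :: "real \<Rightarrow> 'b::real_normed_vector"
  assumes "0 \<le> r" "\<And>t. t \<in> T \<Longrightarrow> norm (c t) \<le> C"
  shows "symbol_k k phase_wt (\<lambda>t p. W t p powr r) (\<lambda>t p. c t)"
proof (rule symbol_k_param)
  have "norm (c t) \<le> (\<bar>C\<bar> + 1) * W t p powr r" if "t \<in> T" for t p
  proof -
    have "(\<bar>C\<bar> + 1) * 1 \<le> (\<bar>C\<bar> + 1) * W t p powr r"
      using W_ge_1[of t p] assms(1) by (intro mult_left_mono ge_one_powr_ge_zero) auto
    moreover have "norm (c t) \<le> (\<bar>C\<bar> + 1) * 1" using assms(2)[OF that] by simp
    ultimately show ?thesis by (rule order_trans[rotated])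
  qed
  then show "dominated (\<lambda>t p. W t p powr r) (\<lambda>t p. c t)"
    unfolding dominated_def by (intro exI[of _ "\<bar>C\<bar> + 1"]) auto
qed

text \<open>The function is bounded by W and its derivatives by constants, and W \<ge> 1 lets W
  serve for both. It is applied to the four scaled coordinates, whose norms are summands of
  W.\<close>

lemma symbol_k_W_coord:
  fixes f :: "real \<Rightarrow> 'n phase_space \<times> 'n phase_space \<Rightarrow> 'b::real_normed_vector"
  assumes "bounded_sderivs k phase_wt f" "\<And>t p. norm (f t p) \<le> W t p"
  shows "symbol_k k phase_wt (\<lambda>t p. W t p powr 1) f"
proof (rule symbol_k_SucD, rule symbol_k_SucI[OF assms(1)])
  show "dominated (\<lambda>t p. W t p powr 1) f"
    unfolding dominated_def using assms(2) by (intro exI[of _ 1]) (simp add: abs_of_pos[OF W_pos])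
  show "1 \<le> 1 * W t p powr 1" for t p using W_ge_1 by (simp add: abs_of_pos[OF W_pos])
qed simp

lemma symbol_k_X: "symbol_k k phase_wt (\<lambda>t p. W t p powr 1) (\<lambda>t p. t powr (3/2) *\<^sub>R grad V (fst (fst p)))"
proof (rule symbol_k_W_coord)
  have "bounded_sderivs k phase_wt (\<lambda>t p :: 'n phase_space \<times> 'n phase_space. grad V (fst (fst p)))"
    by (rule bounded_sderivs_compose[OF grad_sderivs bounded_sderivs_linear[OF bounded_linear_phase_inner(1)]])
       (auto simp: phase_wt_def)
  then show "bounded_sderivs k phase_wt (\<lambda>t p :: 'n phase_space \<times> 'n phase_space. t powr (3/2) *\<^sub>R grad V (fst (fst p)))"
    by (rule bounded_sderivs_scaleR[where C = 1]) (use T in \<open>auto intro!: powr_le1\<close>)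
qed (auto simp: W_def)

lemma symbol_k_Y: "symbol_k k phase_wt (\<lambda>t p. W t p powr 1) (\<lambda>t p. t powr (1/2) *\<^sub>R snd (fst p))"
proof (rule symbol_k_W_coord)
  show "bounded_sderivs k phase_wt (\<lambda>t p :: 'n phase_space \<times> 'n phase_space. t powr (1/2) *\<^sub>R snd (fst p))"
    by (rule bounded_sderivs_linear[OF bounded_linear_phase(2)])
       (auto simp: phase_wt_def)
qed (auto simp: W_def)

lemma symbol_k_\<Xi>: "symbol_k k phase_wt (\<lambda>t p. W t p powr 1) (\<lambda>t p. t powr (3/2) *\<^sub>R fst (snd p))"
proof (rule symbol_k_W_coord)
  show "bounded_sderivs k phase_wt (\<lambda>t p :: 'n phase_space \<times> 'n phase_space. t powr (3/2) *\<^sub>R fst (snd p))"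
    by (intro bounded_sderivs_linear bounded_linear_phase phase_wt_le)
qed (auto simp: W_def)

lemma symbol_k_H: "symbol_k k phase_wt (\<lambda>t p. W t p powr 1) (\<lambda>t p. t powr (1/2) *\<^sub>R snd (snd p))"
proof (rule symbol_k_W_coord)
  show "bounded_sderivs k phase_wt (\<lambda>t p :: 'n phase_space \<times> 'n phase_space. t powr (1/2) *\<^sub>R snd (snd p))"
  proof (rule bounded_sderivs_linear[OF bounded_linear_phase(4)])
    fix b :: "'n phase_space \<times> 'n phase_space" assume "b \<in> Basis" "snd (snd b) \<noteq> 0"
    then show "phase_wt b \<le> 1/2"
      by (cases rule: Basis_phase2_cases) (auto simp: phase_wt_def)
  qed
qed (auto simp: W_def)

text \<open>With (y, w) the preimage of (x, v), the explicit forward map expresses (x, v) by (y, w).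
  The gradients at x and y differ by at most L * |x - y|; after multiplication by t^(3/2) this is at
  most L * (t^2 * Y + \<sigma>(t) * X) with X, Y the scaled norms at the preimage, and both
  coefficients are bounded for t < 1.\<close>

lemma W_le_W_F_inv: "\<exists>C>0. \<forall>t\<in>T. \<forall>p. W t p \<le> C * W t (F_inv t (fst p), snd p)"
proof -
  \<comment> \<open>It dominates the coefficient 1 + L/(2m) + 1/m of X, the coefficient L + 1 of Y
    and the coefficient 1 of the remaining summands.\<close>
  define C where "C = 2 + 1 / m + L / (2 * m) + L"
  have C: "C > 0" using m L by (auto simp: C_def intro!: add_pos_nonneg)
  have "W t p \<le> C * W t (F_inv t (fst p), snd p)" if t: "t \<in> T" for t p
  proof -
    have t01: "0 < t" "t < 1" using t T by auto
    obtain x v \<xi> \<eta> where p: "p = ((x, v), (\<xi>, \<eta>))" by (metis surj_pair)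
    obtain y w where yw: "F_inv t (x, v) = (y, w)" by (cases "F_inv t (x, v)")
    have xv: "x = y - t *\<^sub>R w - \<sigma> t *\<^sub>R grad V y" "v = w + (t / m) *\<^sub>R grad V y"
      using F_map_F_inv[OF t, of "(x, v)"] by (simp_all add: yw F_map_def \<sigma>_def)
    define X where "X = norm ((t powr (3/2)) *\<^sub>R grad V y)"
    define Y where "Y = norm ((t powr (1/2)) *\<^sub>R w)"
    have X0: "X \<ge> 0" and Y0: "Y \<ge> 0" by (simp_all add: X_def Y_def)
    have p32: "t powr (3/2) = t powr (1/2) * t"
      using t01 powr_add[of t "1/2" 1] by simp
    have v: "norm ((t powr (1/2)) *\<^sub>R v) \<le> Y + 1 / m * X"
    proof -
      have "(t powr (1/2)) *\<^sub>R v = (t powr (1/2)) *\<^sub>R w + (1 / m) *\<^sub>R ((t powr (3/2)) *\<^sub>R grad V y)"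
        by (simp add: xv(2) p32 scaleR_add_right mult.commute)
      also have "norm \<dots> \<le> Y + norm ((1 / m) *\<^sub>R ((t powr (3/2)) *\<^sub>R grad V y))"
        unfolding Y_def by (rule norm_triangle_ineq)
      finally show ?thesis unfolding X_def using m by simp
    qed
    have "norm (grad V x) \<le> norm (grad V y) + norm (grad V x - grad V y)"
      by (metis add.commute diff_add_cancel norm_triangle_ineq)
    also have "\<dots> \<le> norm (grad V y) + L * (t * norm w + \<sigma> t * norm (grad V y))"
    proof -
      have "norm (x - y) \<le> norm (- (t *\<^sub>R w)) + norm (\<sigma> t *\<^sub>R grad V y)"
        using norm_triangle_ineq4[of "- (t *\<^sub>R w)" "\<sigma> t *\<^sub>R grad V y"] by (simp add: xv(1))
      also have "\<dots> = t * norm w + \<sigma> t * norm (grad V y)"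
        using t01 \<sigma>_nonneg[of t] by simp
      finally have "L * norm (x - y) \<le> L * (t * norm w + \<sigma> t * norm (grad V y))"
        using L by (intro mult_left_mono) auto
      then show ?thesis using grad_lipschitz[of x y] by linarith
    qed
    finally have "t powr (3/2) * norm (grad V x) \<le> t powr (3/2) * (norm (grad V y) + L * (t * norm w + \<sigma> t * norm (grad V y)))"
      by (intro mult_left_mono) auto
    also have "\<dots> = X + L * (t\<^sup>2 * Y + \<sigma> t * X)"
      using t01 by (simp add: X_def Y_def p32 power2_eq_square algebra_simps)
    also have "\<dots> \<le> X + L * (1 * Y + 1 / (2 * m) * X)"
      using t01 L X0 Y0 \<sigma>_le[OF t]
      by (intro add_left_mono mult_left_mono add_mono mult_right_mono) (auto simp: power_le_one)
    finally have x: "norm ((t powr (3/2)) *\<^sub>R grad V x) \<le> X + L * Y + L / (2 * m) * X"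
      by (simp add: algebra_simps)
    define R where "R = norm ((t powr (3/2)) *\<^sub>R \<xi>) + norm ((t powr (1/2)) *\<^sub>R \<eta>)"
    have R0: "R \<ge> 0" by (simp add: R_def)
    have "W t p \<le> 1 + (X + L * Y + L / (2 * m) * X) + (Y + 1 / m * X) + R"
      using v x unfolding W_def p R_def by simp
    also have "\<dots> \<le> C * 1 + C * X + C * Y + C * R"
    proof -
      have "0 \<le> 1 / m" "0 \<le> L / (2 * m)" using m L by auto
      then have C1: "1 \<le> C" and C2: "1 + L / (2 * m) + 1 / m \<le> C" and C3: "L + 1 \<le> C"
        using L by (auto simp: C_def)
      have "(1 + L / (2 * m) + 1 / m) * X \<le> C * X" "(L + 1) * Y \<le> C * Y" "1 * R \<le> C * R"
        using C1 C2 C3 X0 Y0 R0 by (auto simp only: intro!: mult_right_mono)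
      then show ?thesis using C1 by (simp add: distrib_right)
    qed
    also have "\<dots> = C * W t (F_inv t (fst p), snd p)"
      unfolding W_def p X_def Y_def R_def by (simp add: yw algebra_simps)
    finally show ?thesis .
  qed
  then show ?thesis using C by blast
qed

end

section \<open>The amplitude with the damping factor\<close>

text \<open>Positive definiteness of one block of the damping form: |a|^2 is at most 2 |a - b/2|^2 +
  |b|^2/2, so the left side contains at most 3/2 |b|^2, and 3/2 = 18/12.\<close>

lemma norm_sq_split_le:
  fixes a b :: "'a::real_inner"
  shows "(norm a)\<^sup>2 + (norm b)\<^sup>2 \<le> 18 * ((norm (a - b /\<^sub>R 2))\<^sup>2 + 1 / 12 * (norm b)\<^sup>2)"
proof -
  have "norm a \<le> norm (a - b /\<^sub>R 2) + norm b / 2"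
    using norm_triangle_ineq[of "a - b /\<^sub>R 2" "b /\<^sub>R 2"] by simp
  then have "(norm a)\<^sup>2 \<le> (norm (a - b /\<^sub>R 2) + norm b / 2)\<^sup>2"
    by (intro power_mono) auto
  also have "\<dots> \<le> 2 * (norm (a - b /\<^sub>R 2))\<^sup>2 + 2 * (norm b / 2)\<^sup>2"
    using zero_le_power2[of "norm (a - b /\<^sub>R 2) - norm b / 2"] by (simp only: power2_sum power2_diff)
  finally have "(norm a)\<^sup>2 \<le> 2 * (norm (a - b /\<^sub>R 2))\<^sup>2 + (norm b)\<^sup>2 / 2"
    by (simp add: power_divide)
  then show ?thesis
    using zero_le_power2[of "norm (a - b /\<^sub>R 2)"] by argo
qed

section \<open>The damping form and its Gaussian decay\<close>

context phase_flow
begin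

definition X where "X t p = t powr (3/2) *\<^sub>R grad V (fst (fst p))"
  for p :: "'n phase_space \<times> 'n phase_space"
definition Y where "Y t p = t powr (1/2) *\<^sub>R snd (fst p)"
  for p :: "'n phase_space \<times> 'n phase_space"
definition \<Xi> where "\<Xi> t p = t powr (3/2) *\<^sub>R fst (snd p)"
  for p :: "'n phase_space \<times> 'n phase_space"
definition H where "H t p = t powr (1/2) *\<^sub>R snd (snd p)"
  for p :: "'n phase_space \<times> 'n phase_space"

lemma W_eq: "W t p = 1 + norm (X t p) + norm (Y t p) + norm (\<Xi> t p) + norm (H t p)"
  by (simp add: W_def X_def Y_def \<Xi>_def H_def)

text \<open>Both blocks have the shape \<open>|a - b/2|^2 + |b|^2/12\<close>, with \<open>a = Y\<close> and \<open>b = - X/m\<close> in the second one.\<close>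

definition Q :: "real \<Rightarrow> real \<Rightarrow> real \<Rightarrow> 'n phase_space \<times> 'n phase_space \<Rightarrow> real" where
  "Q \<beta> \<gamma> t p = \<gamma> / (\<beta> * m) * ((norm (H t p - \<Xi> t p /\<^sub>R 2))\<^sup>2 + 1 / 12 * (norm (\<Xi> t p))\<^sup>2)
    + \<gamma> * m * \<beta> / 4 * ((norm (Y t p - (- (1 / m) *\<^sub>R X t p) /\<^sub>R 2))\<^sup>2 + 1 / 12 * (norm (- (1 / m) *\<^sub>R X t p))\<^sup>2)"

text \<open>The prefactor t of the phase is the square of t^(1/2). This root turns v and \<eta> into
  Y and H, and it turns t \<xi> and (t/m) \<nabla>V into \<Xi> and X/m; a third of the square of a
  half is a twelfth of the square.\<close>

lemma phase_im_eq_Q: "phase_im V m \<beta> \<gamma> t (fst p) (snd p) = Q \<beta> \<gamma> t p" if t: "t \<in> T"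
proof -
  obtain x v \<xi> \<eta> where p: "p = ((x, v), (\<xi>, \<eta>))" by (metis surj_pair)
  have t0: "t > 0" using t T by auto
  define r where "r = t powr (1/2)"
  have rr: "r * r = t" "r\<^sup>2 = t" using t0 powr_add[of t "1/2" "1/2"] by (auto simp: r_def power2_eq_square)
  have p32: "t powr (3/2) = r * t" using t0 powr_add[of t "1/2" 1] by (simp add: r_def)
  have sc: "t * (norm a)\<^sup>2 = (norm (r *\<^sub>R a))\<^sup>2" for a :: "real ^ 'n"
    by (simp add: power_mult_distrib rr)
  have 1: "H t p - \<Xi> t p /\<^sub>R 2 = r *\<^sub>R (\<eta> - (t *\<^sub>R \<xi>) /\<^sub>R 2)"
    unfolding H_def \<Xi>_def p p32 by (simp add: r_def scaleR_diff_right)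
  have 2: "1 / 12 * (norm (\<Xi> t p))\<^sup>2 = t * (1 / 3 * (norm ((t *\<^sub>R \<xi>) /\<^sub>R 2))\<^sup>2)"
    unfolding \<Xi>_def p p32 using t0 by (simp add: power_mult_distrib rr power_divide)
  have 3: "Y t p - (- (1 / m) *\<^sub>R X t p) /\<^sub>R 2 = r *\<^sub>R (v + w_flow V m t x /\<^sub>R 2)"
    unfolding Y_def X_def p p32 w_flow_def by (simp add: r_def scaleR_add_right mult_ac)
  have 4: "1 / 12 * (norm (- (1 / m) *\<^sub>R X t p))\<^sup>2 = t * (1 / 3 * (norm (w_flow V m t x /\<^sub>R 2))\<^sup>2)"
    unfolding X_def p p32 w_flow_def using t0 m by (simp add: power_mult_distrib rr power_divide)
  show ?thesis
    unfolding Q_def 1 2 3 4 sc[symmetric] by (simp add: p phase_im_def Let_def algebra_simps)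
qed

lemma Q_lower:
  assumes "\<beta> > 0" "\<gamma> > 0"
  shows "\<exists>\<kappa>>0. \<forall>t p. \<kappa> * ((norm (X t p))\<^sup>2 + (norm (Y t p))\<^sup>2 + (norm (\<Xi> t p))\<^sup>2 + (norm (H t p))\<^sup>2) \<le> Q \<beta> \<gamma> t p"
proof -
  define c1 where "c1 = \<gamma> / (\<beta> * m) / 18"
  define c2 where "c2 = \<gamma> * m * \<beta> / 4 / 18"
  \<comment> \<open>The third entry accounts for b = - X/m, whose square is |X|^2/m^2; the 18 in
    \<open>c1\<close> and \<open>c2\<close> is the constant of
    \<open>norm_sq_split_le\<close>.\<close>
  define \<kappa> where "\<kappa> = min c1 (min c2 (c2 / m\<^sup>2))"
  have pos: "c1 > 0" "c2 > 0" using assms m by (auto simp: c1_def c2_def)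
  then have \<kappa>: "\<kappa> > 0" using m by (auto simp: \<kappa>_def)
  have le: "\<kappa> \<le> c1" "\<kappa> \<le> c2" "\<kappa> \<le> c2 / m\<^sup>2" by (auto simp: \<kappa>_def)
  have "\<kappa> * ((norm (X t p))\<^sup>2 + (norm (Y t p))\<^sup>2 + (norm (\<Xi> t p))\<^sup>2 + (norm (H t p))\<^sup>2) \<le> Q \<beta> \<gamma> t p" for t p
  proof -
    have 1: "c1 * ((norm (H t p))\<^sup>2 + (norm (\<Xi> t p))\<^sup>2) \<le> c1 * (18 * ((norm (H t p - \<Xi> t p /\<^sub>R 2))\<^sup>2 + 1 / 12 * (norm (\<Xi> t p))\<^sup>2))"
      using pos by (intro mult_left_mono norm_sq_split_le) auto
    have 2: "c2 * ((norm (Y t p))\<^sup>2 + (norm (- (1 / m) *\<^sub>R X t p))\<^sup>2) \<le>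
      c2 * (18 * ((norm (Y t p - (- (1 / m) *\<^sub>R X t p) /\<^sub>R 2))\<^sup>2 + 1 / 12 * (norm (- (1 / m) *\<^sub>R X t p))\<^sup>2))"
      using pos by (intro mult_left_mono norm_sq_split_le) auto
    have 3: "(norm (- (1 / m) *\<^sub>R X t p))\<^sup>2 = (norm (X t p))\<^sup>2 / m\<^sup>2"
      using m by (simp add: power_divide)
    have "c2 * ((norm (Y t p))\<^sup>2 + (norm (- (1 / m) *\<^sub>R X t p))\<^sup>2) = c2 * (norm (Y t p))\<^sup>2 + c2 / m\<^sup>2 * (norm (X t p))\<^sup>2"
      unfolding 3 by (simp add: distrib_left)
    moreover have "Q \<beta> \<gamma> t p = c1 * (18 * ((norm (H t p - \<Xi> t p /\<^sub>R 2))\<^sup>2 + 1 / 12 * (norm (\<Xi> t p))\<^sup>2)) +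
      c2 * (18 * ((norm (Y t p - (- (1 / m) *\<^sub>R X t p) /\<^sub>R 2))\<^sup>2 + 1 / 12 * (norm (- (1 / m) *\<^sub>R X t p))\<^sup>2))"
    proof -
      have "c1 * (18 * u) = \<gamma> / (\<beta> * m) * u" "c2 * (18 * u) = \<gamma> * m * \<beta> / 4 * u" for u
        by (simp_all add: c1_def c2_def)
      then show ?thesis by (simp only: Q_def)
    qed
    moreover have "\<kappa> * (norm (X t p))\<^sup>2 \<le> c2 / m\<^sup>2 * (norm (X t p))\<^sup>2" "\<kappa> * (norm (Y t p))\<^sup>2 \<le> c2 * (norm (Y t p))\<^sup>2"
      "\<kappa> * (norm (\<Xi> t p))\<^sup>2 \<le> c1 * (norm (\<Xi> t p))\<^sup>2" "\<kappa> * (norm (H t p))\<^sup>2 \<le> c1 * (norm (H t p))\<^sup>2"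
      using le by (auto simp only: intro!: mult_right_mono zero_le_power2)
    ultimately show ?thesis using 1 2 unfolding distrib_left by linarith
  qed
  then show ?thesis using \<kappa> by blast
qed

text \<open>A Gaussian beats every power of the weight. With S the sum of the squared norms of the
  coordinates, W is at most a multiple of 1 + S, hence of e^(\<kappa> S/k); the k-th power of this
  estimate has e^(\<kappa> S) on the right, which is at most e^Q.\<close>

lemma exp_Q_dominated:
  assumes "\<beta> > 0" "\<gamma> > 0"
  shows "dominated (\<lambda>t p. W t p powr N) (\<lambda>t p. exp (- Q \<beta> \<gamma> t p))"
proof -
  obtain \<kappa> where \<kappa>: "\<kappa> > 0" "\<And>t p. \<kappa> * ((norm (X t p))\<^sup>2 + (norm (Y t p))\<^sup>2 + (norm (\<Xi> t p))\<^sup>2 + (norm (H t p))\<^sup>2) \<le> Q \<beta> \<gamma> t p"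
    using Q_lower[OF assms] by blast
  obtain k0 where "\<bar>N\<bar> \<le> real k0" using real_arch_simple by blast
  \<comment> \<open>The exponent k dominates |N|; it is taken as a successor because \<kappa>/k
    occurs below.\<close>
  define k where "k = Suc k0"
  have k: "k \<ge> 1" "\<bar>N\<bar> \<le> real k"
    using \<open>\<bar>N\<bar> \<le> real k0\<close> by (auto simp: k_def)
  \<comment> \<open>Chosen so that 1 + S \<le> D * (1 + \<kappa>/k * S), to which 1 + x \<le> e^x
    applies.\<close>
  define D where "D = max 1 (real k / \<kappa>)"
  have D: "D \<ge> 1" "D * (\<kappa> / real k) \<ge> 1"
    using \<kappa>(1) k(1) by (auto simp: D_def field_simps max_def)
  have "exp (- Q \<beta> \<gamma> t p) \<le> (5 * D) ^ k * W t p powr N" for t p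
  proof -
    define S where "S = (norm (X t p))\<^sup>2 + (norm (Y t p))\<^sup>2 + (norm (\<Xi> t p))\<^sup>2 + (norm (H t p))\<^sup>2"
    have S: "S \<ge> 0" by (simp add: S_def)
    \<comment> \<open>Cauchy-Schwarz for five terms; the defect is the sum of the squared
      differences over all pairs.\<close>
    have sq: "(1 + a + b + c + d)\<^sup>2 \<le> 5 * (1 + (a\<^sup>2 + b\<^sup>2 + c\<^sup>2 + d\<^sup>2))" for a b c d :: real
    proof -
      have "0 \<le> (1 - a)\<^sup>2 + (1 - b)\<^sup>2 + (1 - c)\<^sup>2 + (1 - d)\<^sup>2 + (a - b)\<^sup>2 + (a - c)\<^sup>2 + (a - d)\<^sup>2
          + (b - c)\<^sup>2 + (b - d)\<^sup>2 + (c - d)\<^sup>2"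
        by simp
      then show ?thesis by (simp add: power2_eq_square algebra_simps)
    qed
    have "W t p \<le> (W t p)\<^sup>2"
      using W_ge_1[of t p] by (simp add: power2_eq_square)
    also have "\<dots> \<le> 5 * (1 + S)"
      unfolding W_eq S_def by (rule sq)
    also have "\<dots> \<le> 5 * (D * exp (\<kappa> / real k * S))"
    proof -
      have "1 * S \<le> (D * (\<kappa> / real k)) * S" using D(2) S by (rule mult_right_mono)
      then have "1 + S \<le> D * (1 + \<kappa> / real k * S)"
        using D(1) by (simp add: distrib_left mult.assoc)
      also have "\<dots> \<le> D * exp (\<kappa> / real k * S)"
        using D(1) by (intro mult_left_mono exp_ge_add_one_self) auto
      finally show ?thesis by simp
    qed
    finally have "W t p ^ k \<le> (5 * (D * exp (\<kappa> / real k * S))) ^ k"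
      using W_pos[of t p] by (intro power_mono) auto
    also have "\<dots> = (5 * D) ^ k * exp (\<kappa> * S)"
      using k(1) by (simp add: power_mult_distrib exp_of_nat_mult[symmetric])
    finally have Wk: "W t p ^ k \<le> (5 * D) ^ k * exp (\<kappa> * S)" .
    have "W t p powr (- N) \<le> W t p powr real k"
      using W_ge_1[of t p] k(2) by (intro powr_mono) auto
    also have "\<dots> = W t p ^ k" using W_pos[of t p] by (simp add: powr_realpow)
    finally have "W t p powr (- N) \<le> (5 * D) ^ k * exp (\<kappa> * S)" using Wk by linarith
    also have "\<dots> \<le> (5 * D) ^ k * exp (Q \<beta> \<gamma> t p)"
      using \<kappa>(2)[of t p] D(1) by (intro mult_left_mono) (auto simp: S_def)
    finally have "W t p powr (- N) * (W t p powr N * exp (- Q \<beta> \<gamma> t p)) \<le>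
        (5 * D) ^ k * exp (Q \<beta> \<gamma> t p) * (W t p powr N * exp (- Q \<beta> \<gamma> t p))"
      by (rule mult_right_mono) simp
    then show ?thesis
      using W_pos[of t p] by (simp add: powr_minus exp_minus field_simps)
  qed
  moreover have "(5 * D) ^ k > 0" using D(1) by simp
  ultimately show ?thesis unfolding dominated_def by (intro exI[of _ "(5 * D) ^ k"]) auto
qed

lemma symbol_k_norm_sq:
  fixes f :: "real \<Rightarrow> 'n phase_space \<times> 'n phase_space \<Rightarrow> real ^ 'n"
  assumes "symbol_k k phase_wt (\<lambda>t p. W t p powr 1) f"
  shows "symbol_k k phase_wt (\<lambda>t p. W t p powr 2) (\<lambda>t p. c * (norm (f t p))\<^sup>2)"
proof -
  have "symbol_k k phase_wt (\<lambda>t p. W t p powr (1 + 1)) (\<lambda>t p. c *\<^sub>R (f t p \<bullet> f t p))"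
    by (intro symbol_k_bounded_linear[OF bounded_linear_scaleR_right] symbol_k_W_bilinear[OF bounded_bilinear_inner] assms)
  then show ?thesis by (simp add: power2_norm_eq_inner)
qed

lemma symbol_k_Q: "symbol_k k phase_wt (\<lambda>t p. W t p powr 2) (Q \<beta> \<gamma>)"
proof -
  have X: "symbol_k k phase_wt (\<lambda>t p. W t p powr 1) X" and Y: "symbol_k k phase_wt (\<lambda>t p. W t p powr 1) Y"
    and \<Xi>: "symbol_k k phase_wt (\<lambda>t p. W t p powr 1) \<Xi>" and H: "symbol_k k phase_wt (\<lambda>t p. W t p powr 1) H"
    unfolding X_def[abs_def] Y_def[abs_def] \<Xi>_def[abs_def] H_def[abs_def]
    by (rule symbol_k_X symbol_k_Y symbol_k_\<Xi> symbol_k_H)+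
  have X': "symbol_k k phase_wt (\<lambda>t p. W t p powr 1) (\<lambda>t p. c *\<^sub>R X t p)" for c
    by (rule symbol_k_bounded_linear[OF bounded_linear_scaleR_right X])
  have \<Xi>': "symbol_k k phase_wt (\<lambda>t p. W t p powr 1) (\<lambda>t p. c *\<^sub>R \<Xi> t p)" for c
    by (rule symbol_k_bounded_linear[OF bounded_linear_scaleR_right \<Xi>])
  have S: "symbol_k k phase_wt (\<lambda>t p. W t p powr 2) (\<lambda>t p.
     (\<gamma> / (\<beta> * m) * (norm (H t p + (- 1 / 2) *\<^sub>R \<Xi> t p))\<^sup>2 + \<gamma> / (\<beta> * m) / 12 * (norm (\<Xi> t p))\<^sup>2)
    + (\<gamma> * m * \<beta> / 4 * (norm (Y t p + (1 / (2 * m)) *\<^sub>R X t p))\<^sup>2 + \<gamma> * m * \<beta> / 4 / 12 * (norm (- (1 / m) *\<^sub>R X t p))\<^sup>2))"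
    by (rule symbol_k_add[OF symbol_k_add[OF symbol_k_norm_sq[OF symbol_k_add[OF H \<Xi>']] symbol_k_norm_sq[OF \<Xi>]]
          symbol_k_add[OF symbol_k_norm_sq[OF symbol_k_add[OF Y X']] symbol_k_norm_sq[OF X']]])
  have eq: "Q \<beta> \<gamma> t p =
     (\<gamma> / (\<beta> * m) * (norm (H t p + (- 1 / 2) *\<^sub>R \<Xi> t p))\<^sup>2 + \<gamma> / (\<beta> * m) / 12 * (norm (\<Xi> t p))\<^sup>2)
    + (\<gamma> * m * \<beta> / 4 * (norm (Y t p + (1 / (2 * m)) *\<^sub>R X t p))\<^sup>2 + \<gamma> * m * \<beta> / 4 / 12 * (norm (- (1 / m) *\<^sub>R X t p))\<^sup>2)" for t p
  proof -
    have "H t p - \<Xi> t p /\<^sub>R 2 = H t p + (- 1 / 2) *\<^sub>R \<Xi> t p"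
      "Y t p - (- (1 / m) *\<^sub>R X t p) /\<^sub>R 2 = Y t p + (1 / (2 * m)) *\<^sub>R X t p"
      by (simp_all add: inverse_eq_divide)
    then show ?thesis unfolding Q_def by (simp only: distrib_left)
  qed
  show ?thesis by (rule symbol_k_congI[OF S]) (rule ext, rule eq)
qed

text \<open>Each derivative of the exponential brings down a derivative of Q, of size W^2. The
  exponential may be estimated by W^(N - 2) instead of W^N, which absorbs this loss; the induction
  therefore runs over all N at once.\<close>

lemma symbol_k_exp_Q:
  assumes "\<beta> > 0" "\<gamma> > 0"
  shows "symbol_k k phase_wt (\<lambda>t p. W t p powr N) (\<lambda>t p. exp (- Q \<beta> \<gamma> t p))"
proof (induction k arbitrary: N)
  case 0
  show ?case using exp_Q_dominated[OF assms] by simp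
next
  case (Suc k)
  have diffQ: "Q \<beta> \<gamma> t differentiable (at p)" if "t \<in> T" for t p
    by (rule symbol_k_differentiable[OF symbol_k_Q that])
  have der: "((\<lambda>p. exp (- Q \<beta> \<gamma> t p)) has_derivative (\<lambda>h. exp (- Q \<beta> \<gamma> t p) * - dir_deriv h (Q \<beta> \<gamma> t) p)) (at p)"
    if "t \<in> T" for t p
    by (rule has_derivative_exp[OF has_derivative_minus[OF has_derivative_dir_deriv[OF diffQ[OF that]]], simplified mult.commute])
  have "symbol_k k phase_wt (\<lambda>t p. W t p powr N) (sderiv phase_wt b (\<lambda>t p. exp (- Q \<beta> \<gamma> t p)))" if b: "b \<in> Basis" for b
  proof (rule symbol_k_congI)
    have "symbol_k k phase_wt (\<lambda>t p. W t p powr ((N - 2) + 2)) (\<lambda>t p. - (exp (- Q \<beta> \<gamma> t p) * sderiv phase_wt b (Q \<beta> \<gamma>) t p))"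
      by (rule symbol_k_bounded_linear[OF bounded_linear_minus[OF bounded_linear_ident]
            symbol_k_W_bilinear[OF bounded_bilinear_mult Suc.IH symbol_k_sderiv[OF symbol_k_Q b]]])
    then show "symbol_k k phase_wt (\<lambda>t p. W t p powr N) (\<lambda>t p. - (exp (- Q \<beta> \<gamma> t p) * sderiv phase_wt b (Q \<beta> \<gamma>) t p))"
      by simp
    show "sderiv phase_wt b (\<lambda>t p. exp (- Q \<beta> \<gamma> t p)) t = (\<lambda>p. - (exp (- Q \<beta> \<gamma> t p) * sderiv phase_wt b (Q \<beta> \<gamma>) t p))"
      if "t \<in> T" for t
      unfolding sderiv_def dir_deriv_eq[OF der[OF that]] by (simp add: mult_ac)
  qed
  then show ?case
    using exp_Q_dominated[OF assms] der by (simp add: differentiable_def) blast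
qed

section \<open>The damped amplitude and the symbol of the operator\<close>

lemma symbol_k_power:
  fixes f :: "real \<Rightarrow> 'n phase_space \<times> 'n phase_space \<Rightarrow> real"
  assumes "symbol_k k phase_wt (\<lambda>t p. W t p powr 1) f"
  shows "symbol_k k phase_wt (\<lambda>t p. W t p powr real n) (\<lambda>t p. f t p ^ n)"
proof (induction n)
  case 0
  show ?case using symbol_k_W_param[of 0 "\<lambda>_. 1 :: real" 1 k] by simp
next
  case (Suc n)
  from symbol_k_W_bilinear[OF bounded_bilinear_mult assms Suc] show ?case by simp
qed

lemma symbol_k_monom_pow:
  fixes f :: "real \<Rightarrow> 'n phase_space \<times> 'n phase_space \<Rightarrow> real ^ 'n"
  assumes "symbol_k k phase_wt (\<lambda>t p. W t p powr 1) f"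
  shows "symbol_k k phase_wt (\<lambda>t p. W t p powr real (mord \<alpha>)) (\<lambda>t p. monom_pow (f t p) \<alpha>)"
proof -
  have "symbol_k k phase_wt (\<lambda>t p. W t p powr real (\<Sum>i\<in>I. \<alpha> $ i)) (\<lambda>t p. \<Prod>i\<in>I. (f t p $ i) ^ (\<alpha> $ i))"
    if "finite I" for I :: "'n set"
    using that
  proof (induction I rule: finite_induct)
    case empty
    show ?case using symbol_k_W_param[of 0 "\<lambda>_. 1 :: real" 1 k] by simp
  next
    case (insert i I)
    have "symbol_k k phase_wt (\<lambda>t p. W t p powr real (\<alpha> $ i)) (\<lambda>t p. (f t p $ i) ^ (\<alpha> $ i))"
      by (rule symbol_k_power[OF symbol_k_bounded_linear[OF bounded_linear_vec_nth assms]])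
    from symbol_k_W_bilinear[OF bounded_bilinear_mult this insert.IH] show ?case
      using insert.hyps by simp
  qed
  from this[of UNIV] show ?thesis by (simp add: mord_def monom_pow_def)
qed

definition amp :: "real \<Rightarrow> real \<Rightarrow> (real \<Rightarrow> 'n phase_space \<times> 'n phase_space \<Rightarrow> complex) \<Rightarrow>
    real \<Rightarrow> 'n phase_space \<times> 'n phase_space \<Rightarrow> complex" where
  "amp \<beta> \<gamma> A t p = of_real (exp (- phase_im V m \<beta> \<gamma> t (fst p) (snd p))) * A t p"

text \<open>The estimate concerns (x, v) only and is pulled back along the projection. Its weight
  consists of some of the summands of W, and \<delta> \<ge> 0 allows it to be enlarged to
  W^\<delta>.\<close>

lemma symbol_k_V_class:
  assumes "a \<in> V_class V \<nu> \<delta>" "\<delta> \<ge> 0"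
  shows "symbol_k k phase_wt (\<lambda>t p. t powr \<nu> * W t p powr \<delta>) (\<lambda>t p. a t (fst p))"
proof -
  have "symbol_k k phase_wt (\<lambda>t p. (\<lambda>(x, v). t powr \<nu> * (1 + norm ((t powr (1/2)) *\<^sub>R v) + norm ((t powr (3/2)) *\<^sub>R grad V x)) powr \<delta>) (fst p))
     (\<lambda>t p :: 'n phase_space \<times> 'n phase_space. a t (fst p))"
    by (rule symbol_k_compose[OF symbol_V_class[OF assms(1), unfolded symbol_def, rule_format] fst_sderivs])
  then show ?thesis
  proof (rule symbol_k_weaken[where C = 1])
    fix t and p :: "'n phase_space \<times> 'n phase_space"
    have "1 + norm ((t powr (1/2)) *\<^sub>R snd (fst p)) + norm ((t powr (3/2)) *\<^sub>R grad V (fst (fst p))) \<le> W t p"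
      by (simp add: W_def)
    then show "(\<lambda>(x, v). t powr \<nu> * (1 + norm ((t powr (1/2)) *\<^sub>R v) + norm ((t powr (3/2)) *\<^sub>R grad V x)) powr \<delta>) (fst p)
      \<le> 1 * (t powr \<nu> * W t p powr \<delta>)"
      using assms(2) by (auto simp: case_prod_beta intro!: mult_left_mono powr_mono2 add_nonneg_nonneg)
  qed simp
qed

lemma symbol_k_amp:
  assumes "\<beta> > 0" "\<gamma> > 0" and A: "A \<in> A_class V \<nu> d"
  shows "symbol_k k phase_wt (\<lambda>t p. t powr \<nu> * W t p powr N) (amp \<beta> \<gamma> A)"
proof -
  obtain J :: nat and al be :: "nat \<Rightarrow> 'n mindex" and del a where
    j: "\<And>j. j < J \<Longrightarrow> del j \<ge> 0 \<and> a j \<in> V_class V \<nu> (del j) \<and> real (mord (al j)) + real (mord (be j)) + del j \<le> d"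
    and A_eq: "\<And>t z \<xi> \<eta>. t \<in> {0<..<1} \<Longrightarrow> A t (z, (\<xi>, \<eta>)) =
      (\<Sum>j<J. a j t z * of_real (monom_pow ((t powr (3/2)) *\<^sub>R \<xi>) (al j) * monom_pow ((t powr (1/2)) *\<^sub>R \<eta>) (be j)))"
    using A unfolding A_class_def by blast
  define P where "P j t p = of_real (exp (- Q \<beta> \<gamma> t p) * (monom_pow ((t powr (3/2)) *\<^sub>R fst (snd p)) (al j) * monom_pow ((t powr (1/2)) *\<^sub>R snd (snd p)) (be j))) * a j t (fst p)"
    for j t and p :: "'n phase_space \<times> 'n phase_space"
  have P: "symbol_k k phase_wt (\<lambda>t p. t powr \<nu> * W t p powr N) (P j)" if "j < J" for j
  proof -
    let ?r = "real (mord (al j)) + real (mord (be j))"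
    \<comment> \<open>The exponential is taken with an exponent lowered by the degree of the
      monomials and by \<open>del j\<close>, so that the growth of the term brings the total back to
      W^N.\<close>
    have "symbol_k k phase_wt (\<lambda>t p. W t p powr ((N - del j - ?r) + ?r))
      (\<lambda>t p. of_real (exp (- Q \<beta> \<gamma> t p) * (monom_pow ((t powr (3/2)) *\<^sub>R fst (snd p)) (al j) * monom_pow ((t powr (1/2)) *\<^sub>R snd (snd p)) (be j))) :: complex)"
      by (rule symbol_k_bounded_linear[OF bounded_linear_of_real symbol_k_W_bilinear[OF bounded_bilinear_mult symbol_k_exp_Q[OF assms(1,2)]
             symbol_k_W_bilinear[OF bounded_bilinear_mult symbol_k_monom_pow[OF symbol_k_\<Xi>] symbol_k_monom_pow[OF symbol_k_H]]]])
    from symbol_k_bounded_bilinear[OF bounded_bilinear_mult this symbol_k_V_class[of "a j" \<nu> "del j" k]] j[OF that]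
    have "symbol_k k phase_wt (\<lambda>t p. W t p powr ((N - del j - ?r) + ?r) * (t powr \<nu> * W t p powr del j)) (P j)"
      unfolding P_def[abs_def] by simp
    then show ?thesis
    proof (rule symbol_k_weaken[where C = 1])
      fix t p
      have "W t p powr N = W t p powr ((N - del j - ?r) + ?r) * W t p powr del j"
        unfolding powr_add[symmetric] by simp
      then show "W t p powr ((N - del j - ?r) + ?r) * (t powr \<nu> * W t p powr del j) \<le> 1 * (t powr \<nu> * W t p powr N)"
        by (simp add: mult_ac)
    qed simp
  qed
  have "symbol_k k phase_wt (\<lambda>t p. t powr \<nu> * W t p powr N) (\<lambda>t p. \<Sum>j\<in>{..<J}. P j t p)"
    by (rule symbol_k_sum) (use P in auto)
  then show ?thesis
  proof (rule symbol_k_congI, intro ext)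
    fix t and p :: "'n phase_space \<times> 'n phase_space" assume t: "t \<in> T"
    then have t1: "t \<in> {0<..<1}" using T by auto
    obtain z \<xi> \<eta> where p: "p = (z, (\<xi>, \<eta>))" by (metis surj_pair)
    show "amp \<beta> \<gamma> A t p = (\<Sum>j<J. P j t p)"
      unfolding amp_def phase_im_eq_Q[OF t] P_def unfolding p A_eq[OF t1]
      by (simp add: sum_distrib_left mult_ac)
  qed
qed

definition op_symbol :: "real \<Rightarrow> real \<Rightarrow> (real \<Rightarrow> 'n phase_space \<times> 'n phase_space \<Rightarrow> complex) \<Rightarrow>
    real \<Rightarrow> 'n phase_space \<times> 'n phase_space \<Rightarrow> complex" where
  "op_symbol \<beta> \<gamma> A t p = amp \<beta> \<gamma> A t (F_inv t (fst p), snd p)"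

text \<open>Composition with the inverse flow gives decay in the weight at the preimage, and
  \<open>W_le_W_F_inv\<close> moves it to the point itself. The sign of N decides which of the two
  weights has to be bounded by the other.\<close>

lemma symbol_op_symbol:
  assumes "\<beta> > 0" "\<gamma> > 0" "A \<in> A_class V \<nu> d" "N \<ge> 0"
  shows "symbol phase_wt (\<lambda>t p. t powr \<nu> * W t p powr (- N)) (op_symbol \<beta> \<gamma> A)"
  unfolding symbol_def
proof
  fix k
  obtain C where C: "C > 0" "\<And>t p. t \<in> T \<Longrightarrow> W t p \<le> C * W t (F_inv t (fst p), snd p)"
    using W_le_W_F_inv by blast
  have "symbol_k k phase_wt (\<lambda>t p. t powr \<nu> * W t (F_inv t (fst p), snd p) powr (- N)) (op_symbol \<beta> \<gamma> A)"
    unfolding op_symbol_def[abs_def] by (rule symbol_k_compose[OF symbol_k_amp[OF assms(1-3)] F_inv_sderivs])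
  then show "symbol_k k phase_wt (\<lambda>t p. t powr \<nu> * W t p powr (- N)) (op_symbol \<beta> \<gamma> A)"
  proof (rule symbol_k_weaken[where C = "C powr N"])
    fix t p assume t: "t \<in> T"
    have "W t p powr N \<le> (C * W t (F_inv t (fst p), snd p)) powr N"
      using C(2)[OF t, of p] W_pos[of t p] assms(4) by (intro powr_mono2) auto
    also have "\<dots> = C powr N * W t (F_inv t (fst p), snd p) powr N"
      using C(1) W_pos[of t] by (simp add: powr_mult less_imp_le)
    finally have "W t (F_inv t (fst p), snd p) powr (- N) \<le> C powr N * W t p powr (- N)"
      using W_pos[of t p] W_pos[of t "(F_inv t (fst p), snd p)"] by (simp add: powr_minus field_simps)
    then have "t powr \<nu> * W t (F_inv t (fst p), snd p) powr (- N) \<le> t powr \<nu> * (C powr N * W t p powr (- N))"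
      by (rule mult_left_mono) simp
    then show "t powr \<nu> * W t (F_inv t (fst p), snd p) powr (- N) \<le> C powr N * (t powr \<nu> * W t p powr (- N))"
      by (simp add: mult_ac)
  qed (use C in simp)
qed

end

section \<open>The operator identity\<close>

text \<open>Where |x| lies between k and k + 1 the function is at most C / (1 + k)^(D + 2), D being
  the dimension, and the ball of radius 1 + k has volume of order (1 + k)^D. The exponent D + 2 thus
  leaves the summable series of 1 / (1 + k)^2.\<close>

lemma integrable_rapid_decay:
  fixes f :: "'a::euclidean_space \<Rightarrow> complex"
  assumes cont: "continuous_on UNIV f" and bound: "\<And>x. (1 + norm x) ^ (DIM('a) + 2) * norm (f x) \<le> C"
  shows "integrable lborel f"
proof (rule integrableI_bounded)
  show meas: "f \<in> borel_measurable lborel"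
    using borel_measurable_continuous_onI[OF cont] by simp
  let ?D = "DIM('a)"
  have C: "C \<ge> 0" using order_trans[OF _ bound[of 0]] by simp
  define g where "g k = C / (1 + real k) ^ (?D + 2)" for k
  have g: "g k \<ge> 0" for k using C by (simp add: g_def)
  have pointwise: "ennreal (norm (f x)) \<le> (\<Sum>k. ennreal (g k) * indicator (cball 0 (1 + real k)) x)" for x
  proof -
    define k where "k = nat \<lfloor>norm x\<rfloor>"
    have "real k = of_int \<lfloor>norm x\<rfloor>" by (simp add: k_def)
    then have k: "real k \<le> norm x" "norm x \<le> 1 + real k" by linarith+
    have "(1 + real k) ^ (?D + 2) * norm (f x) \<le> (1 + norm x) ^ (?D + 2) * norm (f x)"
      using k by (intro mult_right_mono power_mono) auto
    also have "\<dots> \<le> C" by (rule bound)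
    finally have "norm (f x) \<le> g k"
      by (simp add: g_def pos_le_divide_eq mult.commute)
    then have "ennreal (norm (f x)) \<le> ennreal (g k) * indicator (cball 0 (1 + real k)) x"
      using k by (simp add: ennreal_leI)
    also have "\<dots> = (\<Sum>k\<in>{k}. ennreal (g k) * indicator (cball 0 (1 + real k)) x)"
      by (simp only: sum.insert finite.emptyI empty_iff not_False_eq_True sum.empty add_0_right)
    also have "\<dots> \<le> (\<Sum>k. ennreal (g k) * indicator (cball 0 (1 + real k)) x)"
      by (rule sum_le_suminf) (auto simp: summableI)
    finally show ?thesis .
  qed
  have "(\<integral>\<^sup>+ x. ennreal (norm (f x)) \<partial>lborel) \<le>
      (\<integral>\<^sup>+ (x::'a). (\<Sum>k. ennreal (g k) * indicator (cball 0 (1 + real k)) x) \<partial>lborel)"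
    by (rule nn_integral_mono) (rule pointwise)
  also have "\<dots> = (\<Sum>k. ennreal (g k) * emeasure lborel (cball (0::'a) (1 + real k)))"
  proof (subst nn_integral_suminf)
    show "(\<lambda>x::'a. ennreal (g k) * indicator (cball 0 (1 + real k)) x) \<in> borel_measurable lborel" for k
      by (intro borel_measurable_times_ennreal borel_measurable_const borel_measurable_indicator) auto
  qed (simp add: nn_integral_cmult_indicator)
  also have "\<dots> = (\<Sum>k. ennreal (C * unit_ball_vol (real ?D) * inverse (real (Suc k) ^ 2)))"
  proof (intro arg_cong[where f = suminf] ext)
    fix k
    have "ennreal (g k) * emeasure lborel (cball (0::'a) (1 + real k)) =
        ennreal (g k * (unit_ball_vol (real ?D) * (1 + real k) ^ ?D))"
      using g by (simp add: emeasure_cball ennreal_mult' )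
    also have "g k * (unit_ball_vol (real ?D) * (1 + real k) ^ ?D) = C * unit_ball_vol (real ?D) * inverse (real (Suc k) ^ 2)"
    proof -
      have "C / r ^ (?D + 2) * (v * r ^ ?D) = C * v * inverse (r ^ 2)" if "r > 0" for r v :: real
        using that by (simp add: power_add power2_eq_square field_simps)
      from this[of "1 + real k"] show ?thesis by (simp add: g_def add.commute)
    qed
    finally show "ennreal (g k) * emeasure lborel (cball (0::'a) (1 + real k)) =
      ennreal (C * unit_ball_vol (real ?D) * inverse (real (Suc k) ^ 2))" .
  qed
  also have "\<dots> < \<infinity>"
  proof -
    have "summable (\<lambda>k. inverse (real k ^ 2))" by (rule inverse_power_summable) simp
    then have "summable (\<lambda>k. inverse (real (Suc k) ^ 2))" by (subst summable_Suc_iff)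
    then have "summable (\<lambda>k. C * unit_ball_vol (real ?D) * inverse (real (Suc k) ^ 2))"
      by (rule summable_mult)
    then show ?thesis using C by (subst suminf_ennreal2) auto
  qed
  finally show "(\<integral>\<^sup>+ x. ennreal (norm (f x)) \<partial>lborel) < \<infinity>" .
qed

lemma schwartz_integrable:
  assumes "schwartz u"
  shows "integrable lborel u"
proof -
  obtain C where "\<And>z. (1 + norm z) ^ (DIM('a phase_space) + 2) * norm (partial_xv 0 0 u z) \<le> C"
    using assms unfolding schwartz_def by blast
  then show ?thesis
    using assms by (intro integrable_rapid_decay[of u C]) (auto simp: schwartz_def partial_xv_def C_inf_continuous)
qed

text \<open>The exponential has modulus 1, so the double integrand has the modulus of a product of
  two integrable functions and Fubini applies. The exchange is called for because the kernel
  integrates over \<zeta> first, while \<open>Op\<close> integrates over z' first.\<close>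

lemma integral_swap_oscillatory:
  fixes b u :: "'a::euclidean_space \<Rightarrow> complex"
  assumes b: "integrable lborel b" and u: "integrable lborel u"
  shows "(LINT z'|lborel. LINT \<zeta>|lborel. exp (\<i> * of_real ((z - z') \<bullet> \<zeta>)) * b \<zeta> * u z') =
    (LINT \<zeta>|lborel. LINT z'|lborel. exp (\<i> * of_real ((z - z') \<bullet> \<zeta>)) * b \<zeta> * u z')"
proof (rule lborel_pair.Fubini_integral)
  note [measurable] = borel_measurable_integrable[OF b] borel_measurable_integrable[OF u]
  have n: "norm (exp (\<i> * complex_of_real r)) = 1" for r by simp
  show "integrable (lborel \<Otimes>\<^sub>M lborel) (\<lambda>(\<zeta>, z'). exp (\<i> * of_real ((z - z') \<bullet> \<zeta>)) * b \<zeta> * u z')"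
  proof (rule lborel_pair.Fubini_integrable)
    show "(\<lambda>(\<zeta>, z'). exp (\<i> * of_real ((z - z') \<bullet> \<zeta>)) * b \<zeta> * u z') \<in> borel_measurable (lborel \<Otimes>\<^sub>M lborel)"
      by measurable
    show "integrable lborel (\<lambda>\<zeta>. LINT z'|lborel. norm (case (\<zeta>, z') of (\<zeta>, z') \<Rightarrow> exp (\<i> * of_real ((z - z') \<bullet> \<zeta>)) * b \<zeta> * u z'))"
      using b by (simp add: norm_mult n)
    have "integrable lborel (\<lambda>z'. exp (\<i> * of_real ((z - z') \<bullet> \<zeta>)) * b \<zeta> * u z')" for \<zeta>
      by (rule Bochner_Integration.integrable_bound[OF integrable_mult_right[OF u, of "b \<zeta>"]])
         (auto simp: norm_mult n)
    then show "AE \<zeta> in lborel. integrable lborel (\<lambda>z'. case (\<zeta>, z') of (\<zeta>, z') \<Rightarrow> exp (\<i> * of_real ((z - z') \<bullet> \<zeta>)) * b \<zeta> * u z')"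
      by simp
  qed
qed

lemma phase_re_eq: "phase_re V m t z \<zeta> = F_map V m t z \<bullet> \<zeta>"
  by (cases z; cases \<zeta>) (simp add: phase_re_def F_map_def x_flow_def w_flow_def)

context phase_flow
begin

text \<open>Here t is fixed, so the constant may blow up as t tends to 0. Since t < 1, the factor
  t^(3/2) is below both dual scales, and t^(3/2) * (1 + |\<zeta>|) is at most 2 W; decay in W thus
  becomes decay in \<zeta>.\<close>

lemma integrable_op_symbol:
  assumes "\<beta> > 0" "\<gamma> > 0" "A \<in> A_class V \<nu> d" and t: "t \<in> T"
  shows "integrable lborel (\<lambda>\<zeta>. op_symbol \<beta> \<gamma> A t (z, \<zeta>))"
proof -
  define K where "K = DIM('n phase_space) + 2"
  have t0: "0 < t" "t < 1" using t T by auto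
  have S: "symbol phase_wt (\<lambda>t p. t powr \<nu> * W t p powr (- real K)) (op_symbol \<beta> \<gamma> A)"
    by (rule symbol_op_symbol[OF assms(1-3)]) simp
  obtain C where C: "C > 0" "\<And>p. norm (op_symbol \<beta> \<gamma> A t p) \<le> C * (t powr \<nu> * W t p powr (- real K))"
    using t symbol_dominated[OF S] unfolding dominated_def by blast
  have bound: "(1 + norm \<zeta>) ^ K * norm (op_symbol \<beta> \<gamma> A t (z, \<zeta>)) \<le> C * t powr \<nu> * (2 / t powr (3/2)) ^ K" for \<zeta>
  proof -
    have r: "t powr (3/2) > 0" "t powr (3/2) \<le> t powr (1/2)" "t powr (3/2) \<le> 1"
      using t0 by (auto intro!: powr_mono' powr_le1)
    have "t powr (3/2) * norm \<zeta> \<le> t powr (3/2) * (norm (fst \<zeta>) + norm (snd \<zeta>))"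
      using norm_Pair_le[of "fst \<zeta>" "snd \<zeta>"] by (intro mult_left_mono) auto
    also have "\<dots> \<le> t powr (3/2) * norm (fst \<zeta>) + t powr (1/2) * norm (snd \<zeta>)"
      using r by (simp add: distrib_left mult_right_mono)
    also have "\<dots> \<le> W t (z, \<zeta>) - 1" by (simp add: W_def)
    finally have "t powr (3/2) * (1 + norm \<zeta>) \<le> 2 * W t (z, \<zeta>)"
      using r(3) W_ge_1[of t "(z, \<zeta>)"] unfolding distrib_left by linarith
    then have "1 + norm \<zeta> \<le> 2 / t powr (3/2) * W t (z, \<zeta>)"
      using r(1) by (simp add: field_simps)
    then have "(1 + norm \<zeta>) ^ K \<le> (2 / t powr (3/2) * W t (z, \<zeta>)) ^ K"
      by (intro power_mono) auto
    then have "(1 + norm \<zeta>) ^ K * norm (op_symbol \<beta> \<gamma> A t (z, \<zeta>)) \<le>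
        (2 / t powr (3/2) * W t (z, \<zeta>)) ^ K * (C * (t powr \<nu> * W t (z, \<zeta>) powr (- real K)))"
      using W_pos[of t "(z, \<zeta>)"] by (intro mult_mono C) auto
    also have "\<dots> = C * t powr \<nu> * (2 / t powr (3/2)) ^ K"
      using W_pos[of t "(z, \<zeta>)"] by (simp only: power_mult_distrib powr_minus powr_realpow) simp
    finally show ?thesis .
  qed
  have "continuous_on UNIV (op_symbol \<beta> \<gamma> A t)"
    by (rule C_inf_continuous[OF symbol_C_inf[OF S t]])
  then have "continuous_on UNIV (\<lambda>\<zeta>. op_symbol \<beta> \<gamma> A t (z, \<zeta>))"
    by (rule continuous_on_compose2) (auto intro: continuous_intros)
  then show ?thesis
    using bound by (intro integrable_rapid_decay) (auto simp: K_def)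
qed

text \<open>The exponent i \<psi> splits into the oscillating part given by the inner product of
  F_t(z) with \<zeta> and a real damping part. At the point F_t(z) the inverse flow inside
  \<open>op_symbol\<close> cancels, which returns the damped amplitude at z.\<close>

lemma E_op_eq_Op:
  assumes "\<beta> > 0" "\<gamma> > 0" "A \<in> A_class V \<nu> d" and t: "t \<in> T" and u: "schwartz u"
  shows "E_op V m \<beta> \<gamma> A t u = pullback (F_map V m t) (Op (op_symbol \<beta> \<gamma> A t) u)"
proof
  fix z
  define c :: complex where "c = 1 / of_real ((2 * pi) ^ (2 * CARD('n)))"
  define b where "b \<zeta> = op_symbol \<beta> \<gamma> A t (F_map V m t z, \<zeta>)" for \<zeta>
  have b: "b \<zeta> = of_real (exp (- phase_im V m \<beta> \<gamma> t z \<zeta>)) * A t (z, \<zeta>)" for \<zeta>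
    by (simp add: b_def op_symbol_def amp_def F_inv_F_map[OF t])
  have e: "exp (\<i> * phase V m \<beta> \<gamma> t z \<zeta> - \<i> * of_real (z' \<bullet> \<zeta>)) * A t (z, \<zeta>) =
      exp (\<i> * of_real ((F_map V m t z - z') \<bullet> \<zeta>)) * b \<zeta>" for \<zeta> z'
  proof -
    have eq: "\<i> * phase V m \<beta> \<gamma> t z \<zeta> - \<i> * of_real (z' \<bullet> \<zeta>) =
        \<i> * of_real ((F_map V m t z - z') \<bullet> \<zeta>) + of_real (- phase_im V m \<beta> \<gamma> t z \<zeta>)"
      by (simp add: phase_def phase_re_eq Complex_eq inner_diff_left algebra_simps)
    show ?thesis by (simp only: eq b exp_add exp_of_real mult.assoc)
  qed
  have "E_op V m \<beta> \<gamma> A t u z =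
      (LINT z'|lborel. c * (LINT \<zeta>|lborel. exp (\<i> * of_real ((F_map V m t z - z') \<bullet> \<zeta>)) * b \<zeta> * u z'))"
  proof -
    have "(LINT \<zeta>|lborel. exp (\<i> * of_real ((F_map V m t z - z') \<bullet> \<zeta>)) * b \<zeta>) * u z' =
        (LINT \<zeta>|lborel. exp (\<i> * of_real ((F_map V m t z - z') \<bullet> \<zeta>)) * b \<zeta> * u z')" for z'
      by (rule integral_mult_left_zero[symmetric])
    then show ?thesis unfolding E_op_def E_kernel_def e c_def[symmetric] mult.assoc[of c] by simp
  qed
  also have "\<dots> = c * (LINT z'|lborel. LINT \<zeta>|lborel. exp (\<i> * of_real ((F_map V m t z - z') \<bullet> \<zeta>)) * b \<zeta> * u z')"
    by simp
  also have "\<dots> = c * (LINT \<zeta>|lborel. LINT z'|lborel. exp (\<i> * of_real ((F_map V m t z - z') \<bullet> \<zeta>)) * b \<zeta> * u z')"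
    using integral_swap_oscillatory[OF integrable_op_symbol[OF assms(1-4)] schwartz_integrable[OF u]]
    by (simp add: b_def)
  also have "\<dots> = pullback (F_map V m t) (Op (op_symbol \<beta> \<gamma> A t) u) z"
    by (simp add: pullback_def Op_def c_def b_def)
  finally show "E_op V m \<beta> \<gamma> A t u z = pullback (F_map V m t) (Op (op_symbol \<beta> \<gamma> A t) u) z" .
qed

lemma op_symbol_partial_bound:
  assumes "\<beta> > 0" "\<gamma> > 0" "A \<in> A_class V \<nu> d" "N \<ge> 0"
  shows "\<exists>c>0. \<forall>t\<in>T. \<forall>p. norm (partial_xv\<xi>\<eta> \<alpha>' \<beta>' \<gamma>' \<delta>' (op_symbol \<beta> \<gamma> A t) p) \<le>
    c * t powr (\<nu> + (real (mord \<beta>') + real (mord \<delta>') + 3 * real (mord \<gamma>')) / 2) * W t p powr (- N)"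
proof -
  have basis: "((axis i 1, 0), (0, 0)) \<in> (Basis :: ('n phase_space \<times> 'n phase_space) set)"
    "((0, axis i 1), (0, 0)) \<in> (Basis :: ('n phase_space \<times> 'n phase_space) set)"
    "((0, 0), (axis i 1, 0)) \<in> (Basis :: ('n phase_space \<times> 'n phase_space) set)"
    "((0, 0), (0, axis i 1)) \<in> (Basis :: ('n phase_space \<times> 'n phase_space) set)" for i :: 'n
  proof -
    have Basis_fst: "(u, (0, 0)) \<in> (Basis :: ('n phase_space \<times> 'n phase_space) set)"
      and Basis_snd: "((0, 0), u) \<in> (Basis :: ('n phase_space \<times> 'n phase_space) set)"
      if "u \<in> Basis" for u :: "'n phase_space"
      using that by (simp_all add: Basis_prod_def[where ?'a = "'n phase_space"] flip: zero_prod_def)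
    have ax: "(axis i 1, 0) \<in> (Basis :: 'n phase_space set)" "(0, axis i 1) \<in> (Basis :: 'n phase_space set)"
      by (auto simp: Basis_prod_def Basis_vec_def)
    show "((axis i 1, 0), (0, 0)) \<in> (Basis :: ('n phase_space \<times> 'n phase_space) set)"
      "((0, axis i 1), (0, 0)) \<in> (Basis :: ('n phase_space \<times> 'n phase_space) set)"
      "((0, 0), (axis i 1, 0)) \<in> (Basis :: ('n phase_space \<times> 'n phase_space) set)"
      "((0, 0), (0, axis i 1)) \<in> (Basis :: ('n phase_space \<times> 'n phase_space) set)"
      by (rule Basis_fst[OF ax(1)] Basis_fst[OF ax(2)] Basis_snd[OF ax(1)] Basis_snd[OF ax(2)])+
  qed
  have wt: "phase_wt ((axis i 1, 0), (0, 0)) = 0" "phase_wt ((0, axis i 1), (0, 0)) = 1/2"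
    "phase_wt ((0, 0), (axis i 1, 0)) = 3/2" "phase_wt ((0, 0), (0, axis i 1)) = 1/2" for i :: 'n
    by (simp_all add: phase_wt_def axis_eq_0_iff)
  \<comment> \<open>The four blocks of derivatives are handled from the inside out, each derivative
    contributing its scale: 1/2 for \<eta>, 3/2 for \<xi>, 1/2 for v and 0 for x.\<close>
  have "symbol phase_wt (\<lambda>t p. t powr (real (mord \<alpha>') * 0) * (t powr (real (mord \<beta>') * (1/2)) *
      (t powr (real (mord \<gamma>') * (3/2)) * (t powr (real (mord \<delta>') * (1/2)) * (t powr \<nu> * W t p powr (- N))))))
    (\<lambda>t. partial_xv\<xi>\<eta> \<alpha>' \<beta>' \<gamma>' \<delta>' (op_symbol \<beta> \<gamma> A t))"
    unfolding partial_xv\<xi>\<eta>_def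
    by (rule symbol_mpartial[OF symbol_mpartial[OF symbol_mpartial[OF symbol_mpartial[OF symbol_op_symbol[OF assms] basis(4) wt(4)]
            basis(3) wt(3)] basis(2) wt(2)] basis(1) wt(1)])
  from symbol_dominated[OF this] obtain c where c: "c > 0" "\<And>t p. t \<in> T \<Longrightarrow> norm (partial_xv\<xi>\<eta> \<alpha>' \<beta>' \<gamma>' \<delta>' (op_symbol \<beta> \<gamma> A t) p) \<le>
      c * (t powr (real (mord \<alpha>') * 0) * (t powr (real (mord \<beta>') * (1/2)) *
      (t powr (real (mord \<gamma>') * (3/2)) * (t powr (real (mord \<delta>') * (1/2)) * (t powr \<nu> * W t p powr (- N))))))"
    unfolding dominated_def by blast
  have eq: "t powr (real (mord \<alpha>') * 0) * (t powr (real (mord \<beta>') * (1/2)) *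
      (t powr (real (mord \<gamma>') * (3/2)) * (t powr (real (mord \<delta>') * (1/2)) * (t powr \<nu> * W t p powr (- N))))) =
      t powr (\<nu> + (real (mord \<beta>') + real (mord \<delta>') + 3 * real (mord \<gamma>')) / 2) * W t p powr (- N)" if "t \<in> T" for t p
  proof -
    have "\<nu> + (real (mord \<beta>') + real (mord \<delta>') + 3 * real (mord \<gamma>')) / 2 =
      real (mord \<alpha>') * 0 + (real (mord \<beta>') * (1/2) + (real (mord \<gamma>') * (3/2) + (real (mord \<delta>') * (1/2) + \<nu>)))"
      by (simp add: field_simps)
    then show ?thesis by (simp only: powr_add mult.assoc)
  qed
  show ?thesis
  proof (intro exI[of _ c] conjI ballI allI)
    fix t p assume t: "t \<in> T"
    show "norm (partial_xv\<xi>\<eta> \<alpha>' \<beta>' \<gamma>' \<delta>' (op_symbol \<beta> \<gamma> A t) p) \<le>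
      c * t powr (\<nu> + (real (mord \<beta>') + real (mord \<delta>') + 3 * real (mord \<gamma>')) / 2) * W t p powr (- N)"
      using c(2)[OF t, of p] unfolding eq[OF t] by (simp only: mult.assoc)
  qed (rule c(1))
qed

end

section \<open>Choice of the time interval and conclusion\<close>

lemma hessian_bound:
  fixes V :: "real ^ 'n::finite \<Rightarrow> real"
  assumes V: "C_inf V" and bd: "\<And>\<alpha> :: 'n mindex. mord \<alpha> \<ge> 2 \<Longrightarrow> \<exists>C. \<forall>x. \<bar>partial_n \<alpha> V x\<bar> \<le> C"
  obtains L where "L > 0" "\<And>x h. norm (dir_deriv h (grad V) x) \<le> L * norm h"
proof -
  \<comment> \<open>A single dummy time: with scale 0 the rescaled derivative at t = 1/2 is the
    plain one, so the estimates of \<open>grad V\<close> can be read off there before the time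
    interval is known, which is itself chosen from L.\<close>
  interpret symbol_times "{1/2}" by standard auto
  have "\<exists>C>0. \<forall>x. norm (dir_deriv b (grad V) x) \<le> C" if b: "b \<in> Basis" for b
  proof -
    have "dominated (\<lambda>_ _. 1) (sderiv (\<lambda>_. 0) b (\<lambda>t. grad V))"
      using bounded_sderivs_grad[OF V bd, of 0] b by (simp add: bounded_sderivs_def)
    then obtain C where "C > 0" "\<And>x. norm (sderiv (\<lambda>_. 0) b (\<lambda>t. grad V) (1/2) x) \<le> C * 1"
      unfolding dominated_def by blast
    then show ?thesis by (intro exI[of _ C]) (simp add: sderiv_def)
  qed
  then obtain C where C: "\<And>b. b \<in> Basis \<Longrightarrow> C b > 0" "\<And>b x. b \<in> Basis \<Longrightarrow> norm (dir_deriv b (grad V) x) \<le> C b"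
    by metis
  have "norm (dir_deriv h (grad V) x) \<le> (\<Sum>b\<in>Basis. C b) * norm h" for x h
  proof -
    have "grad V differentiable (at x)"
      using has_derivative_grad[OF V] by (auto simp: differentiable_def)
    then have "norm (dir_deriv h (grad V) x) = norm (\<Sum>b\<in>Basis. (h \<bullet> b) *\<^sub>R dir_deriv b (grad V) x)"
      by (subst dir_deriv_expand) auto
    also have "\<dots> \<le> (\<Sum>b\<in>Basis. norm h * C b)"
    proof (rule sum_norm_le)
      fix b :: "real ^ 'n" assume b: "b \<in> Basis"
      show "norm ((h \<bullet> b) *\<^sub>R dir_deriv b (grad V) x) \<le> norm h * C b"
        using C(2)[OF b, of x] Basis_le_norm[OF b, of h] by (simp add: mult_mono)
    qed
    finally show ?thesis by (simp add: sum_distrib_left mult.commute)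
  qed
  moreover have "(\<Sum>b\<in>(Basis :: (real ^ 'n) set). C b) > 0"
    by (rule sum_pos) (use C in auto)
  ultimately show thesis by (rule that[rotated])
qed

theorem theorem1p8:
  fixes V :: "real ^ 'n::finite \<Rightarrow> real" and m \<beta> \<gamma> :: real
  assumes "m > 0" and "\<beta> > 0" and "\<gamma> > 0"
    and "C_inf V"
    and "\<And>\<alpha> :: 'n mindex. mord \<alpha> \<ge> 2 \<Longrightarrow> L_inf (partial_n \<alpha> V)"
  shows "\<exists>t\<^sub>0\<in>{0<..<1}. \<forall>\<nu> d. d \<ge> 0 \<longrightarrow> (\<forall>A\<in>A_class V \<nu> d.
    \<exists>a :: real \<Rightarrow> 'n phase_space \<times> 'n phase_space \<Rightarrow> complex.
      (\<forall>t\<in>{0<..<t\<^sub>0}. C_inf (a t)) \<and>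
      (\<forall>t\<in>{0<..<t\<^sub>0}. \<forall>u. schwartz u \<longrightarrow>
         E_op V m \<beta> \<gamma> A t u = pullback (F_map V m t) (Op (a t) u)) \<and>
      (\<forall>N>0. \<forall>\<alpha> \<beta>' \<gamma>' \<delta> :: 'n mindex. \<exists>c>0. \<forall>t\<in>{0<..<t\<^sub>0}. \<forall>x v \<xi> \<eta>.
         norm (partial_xv\<xi>\<eta> \<alpha> \<beta>' \<gamma>' \<delta> (a t) ((x, v), (\<xi>, \<eta>))) \<le>
           c * t powr (\<nu> + (real (mord \<beta>') + real (mord \<delta>) + 3 * real (mord \<gamma>')) / 2) *
           (1 + norm ((t powr (3/2)) *\<^sub>R grad V x) + norm ((t powr (1/2)) *\<^sub>R v)
              + norm ((t powr (3/2)) *\<^sub>R \<xi>) + norm ((t powr (1/2)) *\<^sub>R \<eta>)) powr (- N)))"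
proof -
  have bd: "\<exists>C. \<forall>x. \<bar>partial_n \<alpha> V x\<bar> \<le> C" if "mord \<alpha> \<ge> 2" for \<alpha> :: "'n mindex"
    using L_inf_continuous_imp_bounded[OF assms(5)[OF that]] C_inf_continuous[OF C_inf_mpartial[OF assms(4)]]
    unfolding partial_n_def by metis
  obtain L where L: "L > 0" "\<And>x h. norm (dir_deriv h (grad V) x) \<le> L * norm h"
    using hessian_bound[OF assms(4) bd] by blast
  \<comment> \<open>From t < 1 and t \<le> m/L follows t^2 \<le> m/L, which is the smallness
    required of the shear; the entry 1/2 keeps the interval inside (0, 1).\<close>
  define t0 where "t0 = min (1/2) (m / L)"
  have t0: "t0 \<in> {0<..<1}" using L assms(1) by (auto simp: t0_def)
  interpret S: symbol_times "{0<..<t0}" using t0 by unfold_locales auto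
  interpret phase_flow "{0<..<t0}" V m L
  proof unfold_locales
    fix t assume "t \<in> {0<..<t0}"
    then have t: "0 < t" "t < 1" "t \<le> m / L" by (auto simp: t0_def)
    have "t\<^sup>2 \<le> m / L" using t power2_eq_square[of t] mult_left_le[of t t] by linarith
    then show "t\<^sup>2 / (2 * m) * L \<le> 1 / 2" using L(1) assms(1) by (simp add: field_simps)
  qed (use assms L S.bounded_sderivs_grad[OF assms(4) bd] in auto)
  show ?thesis
  proof (rule bexI[OF _ t0], intro allI impI ballI)
    fix \<nu> d :: real and A assume A: "A \<in> A_class V \<nu> d"
    let ?a = "op_symbol \<beta> \<gamma> A"
    show "\<exists>a :: real \<Rightarrow> 'n phase_space \<times> 'n phase_space \<Rightarrow> complex.
      (\<forall>t\<in>{0<..<t0}. C_inf (a t)) \<and>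
      (\<forall>t\<in>{0<..<t0}. \<forall>u. schwartz u \<longrightarrow>
         E_op V m \<beta> \<gamma> A t u = pullback (F_map V m t) (Op (a t) u)) \<and>
      (\<forall>N>0. \<forall>\<alpha> \<beta>' \<gamma>' \<delta> :: 'n mindex. \<exists>c>0. \<forall>t\<in>{0<..<t0}. \<forall>x v \<xi> \<eta>.
         norm (partial_xv\<xi>\<eta> \<alpha> \<beta>' \<gamma>' \<delta> (a t) ((x, v), (\<xi>, \<eta>))) \<le>
           c * t powr (\<nu> + (real (mord \<beta>') + real (mord \<delta>) + 3 * real (mord \<gamma>')) / 2) *
           (1 + norm ((t powr (3/2)) *\<^sub>R grad V x) + norm ((t powr (1/2)) *\<^sub>R v)
              + norm ((t powr (3/2)) *\<^sub>R \<xi>) + norm ((t powr (1/2)) *\<^sub>R \<eta>)) powr (- N))"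
    proof (intro exI[of _ ?a] conjI ballI allI impI)
      fix t assume "t \<in> {0<..<t0}"
      then show "C_inf (?a t)"
        \<comment> \<open>\<open>order_refl\<close> selects N = 0: smoothness at fixed t follows
          from the symbol property with any rate of decay.\<close>
        using S.symbol_C_inf[OF symbol_op_symbol[OF assms(2,3) A order_refl]] by blast
    next
      fix t and u :: "'n phase_space \<Rightarrow> complex" assume "t \<in> {0<..<t0}" "schwartz u"
      then show "E_op V m \<beta> \<gamma> A t u = pullback (F_map V m t) (Op (?a t) u)"
        by (rule E_op_eq_Op[OF assms(2,3) A])
    next
      fix N :: real and \<alpha> \<beta>' \<gamma>' \<delta> :: "'n mindex" assume "N > 0"
      then obtain c where "c > 0" and c: "\<And>t p. t \<in> {0<..<t0} \<Longrightarrow> norm (partial_xv\<xi>\<eta> \<alpha> \<beta>' \<gamma>' \<delta> (?a t) p) \<le>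
          c * t powr (\<nu> + (real (mord \<beta>') + real (mord \<delta>) + 3 * real (mord \<gamma>')) / 2) * W t p powr (- N)"
        using op_symbol_partial_bound[OF assms(2,3) A less_imp_le] by blast
      show "\<exists>c>0. \<forall>t\<in>{0<..<t0}. \<forall>x v \<xi> \<eta>.
         norm (partial_xv\<xi>\<eta> \<alpha> \<beta>' \<gamma>' \<delta> (?a t) ((x, v), (\<xi>, \<eta>))) \<le>
           c * t powr (\<nu> + (real (mord \<beta>') + real (mord \<delta>) + 3 * real (mord \<gamma>')) / 2) *
           (1 + norm ((t powr (3/2)) *\<^sub>R grad V x) + norm ((t powr (1/2)) *\<^sub>R v)
              + norm ((t powr (3/2)) *\<^sub>R \<xi>) + norm ((t powr (1/2)) *\<^sub>R \<eta>)) powr (- N)"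
      proof (rule exI[of _ c], intro conjI ballI allI)
        fix t x v \<xi> \<eta> assume "t \<in> {0<..<t0}"
        from c[OF this, of "((x, v), (\<xi>, \<eta>))"]
        show "norm (partial_xv\<xi>\<eta> \<alpha> \<beta>' \<gamma>' \<delta> (?a t) ((x, v), (\<xi>, \<eta>))) \<le>
           c * t powr (\<nu> + (real (mord \<beta>') + real (mord \<delta>) + 3 * real (mord \<gamma>')) / 2) *
           (1 + norm ((t powr (3/2)) *\<^sub>R grad V x) + norm ((t powr (1/2)) *\<^sub>R v)
              + norm ((t powr (3/2)) *\<^sub>R \<xi>) + norm ((t powr (1/2)) *\<^sub>R \<eta>)) powr (- N)"
          by (simp only: W_def fst_conv snd_conv)
      qed (rule \<open>c > 0\<close>)
    qed
  qed
qed

end
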